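(* Let $M^n$ be a compact connected smooth manifold of dimension $n$ admitting $k$ closed $1$-forms $\beta_1,\dots,\beta_k$ which are linearly independent at every point of $M^n$. Then $M^n$ fibers over a torus $\mathbb{T}^k$.
   Context: Manifolds and differential forms are smooth, and compact manifolds are without boundary. $\mathbb{T}^k=S^1\times\cdots\times S^1$ ($k$ factors). "$M^n$ fibers over $\mathbb{T}^k$" means that there is a smooth surjective submersion $M^n\to\mathbb{T}^k$ which is a locally trivial fibration. *)

theory Defs
  imports "HOL-Analysis.Analysis"
begin

section \<open>Smooth maps between open subsets of Euclidean spaces\<close>

text \<open>For open \<open>S\<close> this is the usual class \<open>C\<^sup>k\<close>: in finite dimension it suffices
  that each directional derivative is of class \<open>C\<^sup>k\<^sup>-\<^sup>1\<close>.\<close>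

fun Ck_on :: "nat \<Rightarrow> ('e::euclidean_space \<Rightarrow> 'f::euclidean_space) \<Rightarrow> 'e set \<Rightarrow> bool" where
  "Ck_on 0 f S \<longleftrightarrow> continuous_on S f"
| "Ck_on (Suc k) f S \<longleftrightarrow> (\<forall>x\<in>S. f differentiable (at x)) \<and>
     (\<forall>v. Ck_on k (\<lambda>x. frechet_derivative f (at x) v) S)"

definition smooth_on :: "('e::euclidean_space \<Rightarrow> 'f::euclidean_space) \<Rightarrow> 'e set \<Rightarrow> bool" where
  "smooth_on f S \<longleftrightarrow> (\<forall>k. Ck_on k f S)"

section \<open>Smooth manifolds\<close>

text \<open>A chart is a pair of its domain and its coordinate map; the coordinate map is a total
  function whose values outside the domain are irrelevant. The point set of a manifold is the
  \<open>topspace\<close> of its topology, and its dimension is the dimension of the model space \<open>'e\<close>.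
  The atlas need not be maximal: any smooth atlas determines the smooth structure.\<close>

type_synonym ('a, 'e) chart = "'a set \<times> ('a \<Rightarrow> 'e)"

record ('a, 'e) manifold =
  mtop :: "'a topology"
  atlas :: "('a, 'e) chart set"

abbreviation mpoints :: "('a, 'e) manifold \<Rightarrow> 'a set" where
  "mpoints M \<equiv> topspace (mtop M)"

definition chart_image :: "('a, 'e) chart \<Rightarrow> 'e set" where
  "chart_image c = snd c ` fst c"

definition chart_inv :: "('a, 'e) chart \<Rightarrow> 'e \<Rightarrow> 'a" where
  "chart_inv c = inv_into (fst c) (snd c)"

definition charts_at :: "('a, 'e) manifold \<Rightarrow> 'a \<Rightarrow> ('a, 'e) chart set" where
  "charts_at M p = {c \<in> atlas M. p \<in> fst c}"

definition smooth_manifold :: "('a, 'e::euclidean_space) manifold \<Rightarrow> bool" where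
  "smooth_manifold M \<longleftrightarrow>
     Hausdorff_space (mtop M) \<and> second_countable (mtop M) \<and>
     (\<Union>c\<in>atlas M. fst c) = mpoints M \<and>
     (\<forall>c\<in>atlas M. openin (mtop M) (fst c) \<and> open (chart_image c) \<and>
        homeomorphic_map (subtopology (mtop M) (fst c)) (top_of_set (chart_image c)) (snd c)) \<and>
     (\<forall>c\<in>atlas M. \<forall>d\<in>atlas M. smooth_on (snd d \<circ> chart_inv c) (snd c ` (fst c \<inter> fst d)))"

definition prod_manifold ::
  "('a, 'e) manifold \<Rightarrow> ('b, 'f) manifold \<Rightarrow> ('a \<times> 'b, 'e \<times> 'f) manifold" where
  "prod_manifold M N =
     \<lparr>mtop = prod_topology (mtop M) (mtop N),
      atlas = {(fst c \<times> fst d, map_prod (snd c) (snd d)) | c d. c \<in> atlas M \<and> d \<in> atlas N}\<rparr>"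

section \<open>Tangent vectors\<close>

text \<open>A tangent vector at \<open>p\<close> is a family of coordinate vectors, one for each chart around \<open>p\<close>,
  which transform by the derivatives of the coordinate changes. Charts not containing \<open>p\<close> get
  the value \<open>0\<close>, so that distinct functions are distinct tangent vectors.\<close>

type_synonym ('a, 'e) tangent = "('a, 'e) chart \<Rightarrow> 'e"

definition coord_change_deriv ::
  "('a, 'e::euclidean_space) chart \<Rightarrow> ('a, 'e) chart \<Rightarrow> 'a \<Rightarrow> 'e \<Rightarrow> 'e" where
  "coord_change_deriv c d p = frechet_derivative (snd d \<circ> chart_inv c) (at (snd c p))"

definition tangent_space ::
  "('a, 'e::euclidean_space) manifold \<Rightarrow> 'a \<Rightarrow> ('a, 'e) tangent set" where
  "tangent_space M p =
     {v. (\<forall>c\<in>charts_at M p. \<forall>d\<in>charts_at M p. v d = coord_change_deriv c d p (v c)) \<and>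
         (\<forall>c. c \<notin> charts_at M p \<longrightarrow> v c = 0)}"

text \<open>The tangent vector at \<open>p\<close> whose coordinate vector in the chart \<open>c\<close> is \<open>w\<close>.\<close>

definition tangent_of_coords ::
  "('a, 'e::euclidean_space) manifold \<Rightarrow> ('a, 'e) chart \<Rightarrow> 'a \<Rightarrow> 'e \<Rightarrow> ('a, 'e) tangent" where
  "tangent_of_coords M c p w =
     (\<lambda>d. if d \<in> charts_at M p then coord_change_deriv c d p w else 0)"

section \<open>Differential 1-forms\<close>

type_synonym ('a, 'e) form1 = "'a \<Rightarrow> ('a, 'e) tangent \<Rightarrow> real"

text \<open>The coefficient of \<open>\<beta>\<close> in the chart \<open>c\<close> at the coordinate point \<open>x\<close>, evaluated on the
  constant coordinate vector \<open>w\<close>.\<close>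

definition form_in_chart :: "('a, 'e::euclidean_space) manifold \<Rightarrow> ('a, 'e) form1 \<Rightarrow>
    ('a, 'e) chart \<Rightarrow> 'e \<Rightarrow> 'e \<Rightarrow> real" where
  "form_in_chart M \<beta> c w x = \<beta> (chart_inv c x) (tangent_of_coords M c (chart_inv c x) w)"

definition smooth_form1 :: "('a, 'e::euclidean_space) manifold \<Rightarrow> ('a, 'e) form1 \<Rightarrow> bool" where
  "smooth_form1 M \<beta> \<longleftrightarrow>
     (\<forall>p\<in>mpoints M. \<forall>u\<in>tangent_space M p. \<forall>v\<in>tangent_space M p. \<forall>a b.
        \<beta> p (\<lambda>c. a *\<^sub>R u c + b *\<^sub>R v c) = a * \<beta> p u + b * \<beta> p v) \<and>
     (\<forall>c\<in>atlas M. \<forall>w. smooth_on (form_in_chart M \<beta> c w) (chart_image c))"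

text \<open>The exterior derivative in a chart: for basis vectors \<open>u = e\<^sub>i\<close> and \<open>v = e\<^sub>j\<close> this is
  \<open>\<partial>\<^sub>i \<beta>\<^sub>j - \<partial>\<^sub>j \<beta>\<^sub>i\<close>.\<close>

definition ext_deriv_in_chart :: "('a, 'e::euclidean_space) manifold \<Rightarrow> ('a, 'e) form1 \<Rightarrow>
    ('a, 'e) chart \<Rightarrow> 'e \<Rightarrow> 'e \<Rightarrow> 'e \<Rightarrow> real" where
  "ext_deriv_in_chart M \<beta> c x u v =
     frechet_derivative (form_in_chart M \<beta> c v) (at x) u
   - frechet_derivative (form_in_chart M \<beta> c u) (at x) v"

definition closed_form1 :: "('a, 'e::euclidean_space) manifold \<Rightarrow> ('a, 'e) form1 \<Rightarrow> bool" where
  "closed_form1 M \<beta> \<longleftrightarrow> smooth_form1 M \<beta> \<and>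
     (\<forall>c\<in>atlas M. \<forall>x\<in>chart_image c. \<forall>u v. ext_deriv_in_chart M \<beta> c x u v = 0)"

definition lin_indep_at ::
  "('a, 'e::euclidean_space) manifold \<Rightarrow> ('k::finite \<Rightarrow> ('a, 'e) form1) \<Rightarrow> 'a \<Rightarrow> bool" where
  "lin_indep_at M \<beta> p \<longleftrightarrow>
     (\<forall>a :: 'k \<Rightarrow> real. (\<forall>v\<in>tangent_space M p. (\<Sum>i\<in>UNIV. a i * \<beta> i p v) = 0) \<longrightarrow> (\<forall>i. a i = 0))"

section \<open>Smooth maps, submersions and fibrations\<close>

definition map_in_charts :: "('a, 'e) chart \<Rightarrow> ('b, 'f) chart \<Rightarrow> ('a \<Rightarrow> 'b) \<Rightarrow> 'e \<Rightarrow> 'f" where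
  "map_in_charts c d f = snd d \<circ> f \<circ> chart_inv c"

definition smooth_map_on :: "('a, 'e::euclidean_space) manifold \<Rightarrow> 'a set \<Rightarrow>
    ('b, 'f::euclidean_space) manifold \<Rightarrow> ('a \<Rightarrow> 'b) \<Rightarrow> bool" where
  "smooth_map_on M W N f \<longleftrightarrow>
     openin (mtop M) W \<and> continuous_map (subtopology (mtop M) W) (mtop N) f \<and>
     (\<forall>c\<in>atlas M. \<forall>d\<in>atlas N.
        smooth_on (map_in_charts c d f) (snd c ` {p \<in> fst c \<inter> W. f p \<in> fst d}))"

abbreviation smooth_map :: "('a, 'e::euclidean_space) manifold \<Rightarrow>
    ('b, 'f::euclidean_space) manifold \<Rightarrow> ('a \<Rightarrow> 'b) \<Rightarrow> bool" where
  "smooth_map M N f \<equiv> smooth_map_on M (mpoints M) N f"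

text \<open>The differential at \<open>p\<close>; by the chain rule it does not depend on the chosen chart \<open>c\<close>.\<close>

definition differential :: "('a, 'e::euclidean_space) manifold \<Rightarrow>
    ('b, 'f::euclidean_space) manifold \<Rightarrow> ('a \<Rightarrow> 'b) \<Rightarrow> 'a \<Rightarrow> ('a, 'e) tangent \<Rightarrow> ('b, 'f) tangent" where
  "differential M N f p v =
     (let c = (SOME c. c \<in> charts_at M p)
      in (\<lambda>d. if d \<in> charts_at N (f p)
              then frechet_derivative (map_in_charts c d f) (at (snd c p)) (v c) else 0))"

definition submersion :: "('a, 'e::euclidean_space) manifold \<Rightarrow>
    ('b, 'f::euclidean_space) manifold \<Rightarrow> ('a \<Rightarrow> 'b) \<Rightarrow> bool" where
  "submersion M N f \<longleftrightarrow> smooth_map M N f \<and>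
     (\<forall>p\<in>mpoints M. differential M N f p ` tangent_space M p = tangent_space N (f p))"

text \<open>Smoothness of a map between arbitrary subsets of manifolds: it extends locally to a smooth
  map of the ambient manifolds. For embedded submanifolds, such as the fibers of a submersion,
  this agrees with smoothness for the induced manifold structures.\<close>

definition smooth_between :: "('a, 'e::euclidean_space) manifold \<Rightarrow> 'a set \<Rightarrow>
    ('b, 'f::euclidean_space) manifold \<Rightarrow> 'b set \<Rightarrow> ('a \<Rightarrow> 'b) \<Rightarrow> bool" where
  "smooth_between M S N T f \<longleftrightarrow> f ` S \<subseteq> T \<and>
     (\<forall>p\<in>S. \<exists>W g. p \<in> W \<and> smooth_map_on M W N g \<and> (\<forall>q\<in>S \<inter> W. g q = f q))"

definition diffeo_between :: "('a, 'e::euclidean_space) manifold \<Rightarrow> 'a set \<Rightarrow>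
    ('b, 'f::euclidean_space) manifold \<Rightarrow> 'b set \<Rightarrow> ('a \<Rightarrow> 'b) \<Rightarrow> bool" where
  "diffeo_between M S N T h \<longleftrightarrow>
     bij_betw h S T \<and> smooth_between M S N T h \<and> smooth_between N T M S (inv_into S h)"

definition locally_trivial :: "('a, 'e::euclidean_space) manifold \<Rightarrow>
    ('b, 'f::euclidean_space) manifold \<Rightarrow> ('a \<Rightarrow> 'b) \<Rightarrow> bool" where
  "locally_trivial M N f \<longleftrightarrow>
     (\<forall>b\<in>mpoints N. \<exists>V h. openin (mtop N) V \<and> b \<in> V \<and>
        diffeo_between M {p \<in> mpoints M. f p \<in> V}
          (prod_manifold N M) (V \<times> {p \<in> mpoints M. f p = b}) h \<and>
        (\<forall>p\<in>mpoints M. f p \<in> V \<longrightarrow> fst (h p) = f p))"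

definition fibers_over :: "('a, 'e::euclidean_space) manifold \<Rightarrow>
    ('b, 'f::euclidean_space) manifold \<Rightarrow> bool" where
  "fibers_over M N \<longleftrightarrow>
     (\<exists>f. smooth_map M N f \<and> f ` mpoints M = mpoints N \<and> submersion M N f \<and> locally_trivial M N f)"

section \<open>The torus\<close>

text \<open>The circle is the unit circle in the complex plane. For each real \<open>t\<close>, the complement of
  the point \<open>- cis t\<close> carries the angle coordinate with values in \<open>{t - pi<..<t + pi}\<close>.\<close>

definition circle_chart :: "real \<Rightarrow> (complex, real) chart" where
  "circle_chart t = (sphere 0 1 - {- cis t}, \<lambda>z. t + Arg (z / cis t))"

definition circle :: "(complex, real) manifold" where
  "circle = \<lparr>mtop = top_of_set (sphere 0 1), atlas = range circle_chart\<rparr>"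

text \<open>The \<open>k\<close>-fold product of the circle, \<open>k = CARD('k)\<close>, with the product charts; the topology
  of \<open>complex ^ 'k\<close> is the product topology.\<close>

definition torus :: "(complex ^ 'k, real ^ 'k) manifold" where
  "torus =
     \<lparr>mtop = top_of_set {z. \<forall>i. z $ i \<in> mpoints circle},
      atlas = {({z. \<forall>i. z $ i \<in> fst (c i)}, \<lambda>z. \<chi> i. snd (c i) (z $ i)) | c.
                 \<forall>i. c i \<in> atlas circle}\<rparr>"

end

theory Submission
  imports Defs
begin

text \<open>The primitives of a closed form on the members of a finite cover differ by finitely many constants on
  the overlaps. By Dirichlet's approximation theorem a common multiple of these constants is almost
  integral, and a partition of unity absorbs the rounding errors: a form near a multiple of the given one
  is the derivative of a map to the circle. Linear independence is an open condition, so \<open>k\<close> forms give a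
  submersion to the torus; its image is open and closed.

  Such a submersion \<open>f\<close> is locally trivial. Moves along adapted coordinates, cut off by bump functions and
  composed over a finite cover of a fiber, give a smooth retraction \<open>R\<close> of a neighbourhood onto the fiber
  without solving an ordinary differential equation. By the inverse function theorem and compactness the
  pair \<open>(f, R)\<close> is a trivialization.\<close>

section \<open>Calculus of smooth maps on Euclidean spaces\<close>

text \<open>If all the constants by which local primitives differ were integers, \<open>cis\<close>
  of 2 pi times the primitives would be one global map; periods are never computed as integrals over
  loops. An overlap of open sets may have infinitely many components, so the constants are collected
  over overlaps of closed, hence compact, pieces \<open>K j\<close> inside the domains. Two demands
  fix the tolerance of the approximation. The rounding errors must stay additive on triple overlaps,
  or the partition of unity could not absorb them consistently; an absolute bound (1/8) suffices.
  The perturbed forms must stay independent, which gives a bound \<epsilon> depending on the forms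
  and the partition of unity. This bound is fixed before the multiple \<open>D\<close> is known:
  dividing the perturbed form by \<open>D \<ge> 1\<close> only shrinks the perturbation. So each
  form may have its own multiple, as scaling does not affect independence. The fibers receive no
  charts of their own. Statements about a fiber are phrased by maps of the ambient manifold: a
  linear section replaces a complement of the kernel, and a retraction replaces the projection of a
  product chart.\<close>

lemma frechet_derivative_cong_open:
  assumes "open S" "x \<in> S" "\<And>y. y \<in> S \<Longrightarrow> f y = g y"
  shows "frechet_derivative f (at x) = frechet_derivative g (at x)"
proof -
  \<comment> \<open>\<open>frechet_derivative\<close> is a choice, so it suffices that both
    functions have the same candidates; this covers points without a derivative as well.\<close>
  have "(f has_derivative D) (at x) \<longleftrightarrow> (g has_derivative D) (at x)" for D
    using has_derivative_transform_within_open[of f D x UNIV S g]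
      has_derivative_transform_within_open[of g D x UNIV S f] assms by auto
  then show ?thesis unfolding frechet_derivative_def by simp
qed

lemma Ck_on_cong_imp:
  assumes "open S" "\<And>x. x \<in> S \<Longrightarrow> f x = g x" "Ck_on k f S"
  shows "Ck_on k g S"
  using assms
proof (induction k arbitrary: f g)
  case 0
  then show ?case by (simp cong: continuous_on_cong)
next
  case (Suc k)
  have "g differentiable (at x)" if "x \<in> S" for x
  proof -
    obtain D where "(f has_derivative D) (at x)"
      using Suc.prems(3) \<open>x \<in> S\<close> unfolding Ck_on.simps differentiable_def by blast
    then have "(g has_derivative D) (at x)"
      by (rule has_derivative_transform_within_open[OF _ Suc.prems(1) that]) (use Suc.prems(2) in auto)
    then show ?thesis by (auto simp: differentiable_def)
  qed
  moreover have "Ck_on k (\<lambda>x. frechet_derivative g (at x) v) S" for v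
  proof (rule Suc.IH[of "\<lambda>x. frechet_derivative f (at x) v"])
    show "frechet_derivative f (at x) v = frechet_derivative g (at x) v" if "x \<in> S" for x
      using frechet_derivative_cong_open[of S x f g] Suc.prems that by simp
  qed (use Suc.prems in auto)
  ultimately show ?case by simp
qed

lemma Ck_on_subset: "Ck_on k f S \<Longrightarrow> T \<subseteq> S \<Longrightarrow> Ck_on k f T"
  by (induction k arbitrary: f) (auto intro: continuous_on_subset)

lemma Ck_on_local:
  assumes "\<And>x. x \<in> S \<Longrightarrow> \<exists>T. open T \<and> x \<in> T \<and> Ck_on k f T"
  shows "Ck_on k f S"
  using assms
proof (induction k arbitrary: f)
  case 0
  have "isCont f x" if "x \<in> S" for x
    using 0[OF that] by (auto simp: continuous_on_eq_continuous_at)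
  then show ?case by (simp add: continuous_at_imp_continuous_on)
next
  case (Suc k)
  have "f differentiable (at x)" if "x \<in> S" for x
    using Suc.prems[OF that] by auto
  moreover have "Ck_on k (\<lambda>x. frechet_derivative f (at x) v) S" for v
    using Suc.prems by (intro Suc.IH) fastforce
  ultimately show ?case by simp
qed

text \<open>\<open>Ck_on\<close> speaks of the chosen derivative; by uniqueness of derivatives any
  explicit formula may take its place. The basic differentiation rules below go through this
  introduction rule.\<close>

lemma Ck_on_SucI:
  assumes "open S" "\<And>x. x \<in> S \<Longrightarrow> (f has_derivative f' x) (at x)" "\<And>v. Ck_on k (\<lambda>x. f' x v) S"
  shows "Ck_on (Suc k) f S"
proof -
  have "f' x = frechet_derivative f (at x)" if "x \<in> S" for x
    using frechet_derivative_at assms(2)[OF that] by blast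
  then have "Ck_on k (\<lambda>x. frechet_derivative f (at x) v) S" for v
    using Ck_on_cong_imp[OF assms(1) _ assms(3)[of v]] by auto
  with assms(2) show ?thesis by (auto simp: differentiable_def)
qed

lemma Ck_on_SucD: "Ck_on (Suc k) f S \<Longrightarrow> Ck_on k f S"
proof (induction k arbitrary: f)
  case 0
  then show ?case
    by (auto intro!: continuous_at_imp_continuous_on differentiable_imp_continuous_within)
qed auto

lemma Ck_on_Suc_has_derivative:
  "Ck_on (Suc k) f S \<Longrightarrow> x \<in> S \<Longrightarrow> (f has_derivative frechet_derivative f (at x)) (at x)"
  by (simp add: frechet_derivative_works[symmetric])

lemma Ck_on_const: "open S \<Longrightarrow> Ck_on k (\<lambda>x. c) S"
proof (induction k arbitrary: c)
  case (Suc k)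
  then show ?case by (intro Ck_on_SucI[where f'="\<lambda>x v. 0"]) auto
qed auto

lemma Ck_on_linear: "open S \<Longrightarrow> bounded_linear L \<Longrightarrow> Ck_on k L S"
proof (induction k)
  case 0
  then show ?case by (auto intro: linear_continuous_on)
next
  case (Suc k)
  then show ?case
    by (intro Ck_on_SucI[where f'="\<lambda>x v. L v"]) (auto intro: bounded_linear_imp_has_derivative Ck_on_const)
qed

lemma Ck_on_bounded_linear:
  assumes "open S" "bounded_linear L" "Ck_on k f S"
  shows "Ck_on k (\<lambda>x. L (f x)) S"
  using assms
proof (induction k arbitrary: f)
  case 0
  then show ?case by (auto intro: bounded_linear.continuous_on)
next
  case (Suc k)
  show ?case
    by (rule Ck_on_SucI[where f'="\<lambda>x v. L (frechet_derivative f (at x) v)"])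
      (use Suc Ck_on_Suc_has_derivative[OF Suc.prems(3)] in \<open>auto intro: bounded_linear.has_derivative\<close>)
qed

lemma Ck_on_add:
  assumes "open S" "Ck_on k f S" "Ck_on k g S"
  shows "Ck_on k (\<lambda>x. f x + g x) S"
  using assms
proof (induction k arbitrary: f g)
  case 0
  then show ?case by (auto intro: continuous_intros)
next
  case (Suc k)
  show ?case
    by (rule Ck_on_SucI[where f'="\<lambda>x v. frechet_derivative f (at x) v + frechet_derivative g (at x) v"])
      (use Suc Ck_on_Suc_has_derivative[OF Suc.prems(2)] Ck_on_Suc_has_derivative[OF Suc.prems(3)]
        in \<open>auto intro: has_derivative_add\<close>)
qed

lemma Ck_on_sum:
  assumes "open S" "\<And>i. i \<in> I \<Longrightarrow> Ck_on k (f i) S"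
  shows "Ck_on k (\<lambda>x. \<Sum>i\<in>I. f i x) S"
  using assms(2)
  by (induction I rule: infinite_finite_induct) (auto intro!: Ck_on_const Ck_on_add assms(1))

lemma Ck_on_bilinear:
  assumes "open S" "bounded_bilinear B" "Ck_on k f S" "Ck_on k g S"
  shows "Ck_on k (\<lambda>x. B (f x) (g x)) S"
  using assms
proof (induction k arbitrary: f g)
  case 0
  then show ?case by (auto intro: bounded_bilinear.continuous_on)
next
  case (Suc k)
  \<comment> \<open>The product rule pairs each factor with the derivative of the other, so the
    undifferentiated factors are needed in class \<open>k\<close> too.\<close>
  have "Ck_on k f S" "Ck_on k g S"
    using Suc.prems Ck_on_SucD by blast+
  then show ?case
    using Suc Ck_on_Suc_has_derivative[OF Suc.prems(3)] Ck_on_Suc_has_derivative[OF Suc.prems(4)]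
    by (intro Ck_on_SucI[where f'="\<lambda>x v. B (f x) (frechet_derivative g (at x) v) + B (frechet_derivative f (at x) v) (g x)"])
      (auto intro!: bounded_bilinear.FDERIV Ck_on_add Suc.IH)
qed

lemmas Ck_on_mult = Ck_on_bilinear[OF _ bounded_bilinear_mult]
lemmas Ck_on_scaleR = Ck_on_bilinear[OF _ bounded_bilinear_scaleR]

lemma Ck_on_prod:
  fixes f :: "'i \<Rightarrow> 'e::euclidean_space \<Rightarrow> real"
  assumes "open S" "\<And>i. i \<in> I \<Longrightarrow> Ck_on k (f i) S"
  shows "Ck_on k (\<lambda>x. \<Prod>i\<in>I. f i x) S"
  using assms(2)
  by (induction I rule: infinite_finite_induct) (auto intro!: Ck_on_const Ck_on_mult assms(1))

lemma linear_euclidean_expansion: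
  fixes L :: "'e::euclidean_space \<Rightarrow> 'f::real_vector"
  assumes "linear L"
  shows "L v = (\<Sum>b\<in>Basis. (v \<bullet> b) *\<^sub>R L b)"
proof -
  have "L v = L (\<Sum>b\<in>Basis. (v \<bullet> b) *\<^sub>R b)"
    by (simp add: euclidean_representation)
  then show ?thesis
    by (simp add: linear_sum[OF assms] linear_scale[OF assms])
qed

lemma Ck_on_compose:
  assumes "open S" "open T" "f ` S \<subseteq> T" "Ck_on k f S" "Ck_on k g T"
  shows "Ck_on k (\<lambda>x. g (f x)) S"
  using assms(4,5)
proof (induction k arbitrary: g)
  case 0
  then show ?case using assms(3) continuous_on_compose2[of T g S f] by auto
next
  case (Suc k)
  let ?D = "\<lambda>x v. frechet_derivative g (at (f x)) (frechet_derivative f (at x) v)"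
  show ?case
  proof (rule Ck_on_SucI[OF assms(1), where f'="?D"])
    fix x assume "x \<in> S"
    then have "(f has_derivative frechet_derivative f (at x)) (at x)"
      "(g has_derivative frechet_derivative g (at (f x))) (at (f x))"
      using Ck_on_Suc_has_derivative[OF Suc.prems(1), of x] Ck_on_Suc_has_derivative[OF Suc.prems(2), of "f x"]
        assms(3) by auto
    then show "((\<lambda>x. g (f x)) has_derivative ?D x) (at x)"
      using has_derivative_compose by blast
  next
    fix v
    have k: "Ck_on k f S" using Suc.prems Ck_on_SucD by blast
    \<comment> \<open>In \<open>?D\<close> the derivative of \<open>g\<close> is applied to a vector
      that moves with \<open>x\<close>, whereas the induction hypothesis covers only fixed vectors.
      Expanding the moving vector in the basis separates the two dependencies.\<close>
    have "Ck_on k (\<lambda>x. \<Sum>b\<in>Basis. (frechet_derivative f (at x) v \<bullet> b) *\<^sub>R frechet_derivative g (at (f x)) b) S"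
      using Suc.prems k assms(1)
      by (intro Ck_on_sum Ck_on_scaleR Suc.IH Ck_on_bounded_linear[where L="\<lambda>x. x \<bullet> _"])
        (auto intro: bounded_linear_inner_left)
    moreover have "(\<Sum>b\<in>Basis. (frechet_derivative f (at x) v \<bullet> b) *\<^sub>R frechet_derivative g (at (f x)) b) = ?D x v"
      if "x \<in> S" for x
    proof -
      have "linear (frechet_derivative g (at (f x)))"
        using Ck_on_Suc_has_derivative[OF Suc.prems(2), of "f x"] assms(3) that
        by (auto intro: has_derivative_linear)
      then show ?thesis
        by (rule linear_euclidean_expansion[symmetric])
    qed
    ultimately show "Ck_on k (\<lambda>x. ?D x v) S"
      using Ck_on_cong_imp[OF assms(1)] by (metis (no_types, lifting))
  qed
qed

lemma Ck_on_vec_lambda: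
  fixes f :: "'i::finite \<Rightarrow> 'e::euclidean_space \<Rightarrow> 'b::euclidean_space"
  assumes "open S" "\<And>i. Ck_on k (f i) S"
  shows "Ck_on k (\<lambda>x. \<chi> i. f i x) S"
proof -
  have lin: "bounded_linear (\<lambda>y::'b. axis i y :: 'b^'i)" for i
    unfolding linear_conv_bounded_linear[symmetric]
    by (rule linearI) (auto simp: axis_def vec_eq_iff)
  have "(\<chi> i. f i x) = (\<Sum>i\<in>UNIV. axis i (f i x))" for x
    by (simp add: vec_eq_iff axis_def)
  then show ?thesis
    by (simp only:) (intro Ck_on_sum Ck_on_bounded_linear[OF _ lin] assms)
qed

lemma Ck_on_vec_nth:
  "open S \<Longrightarrow> Ck_on k f S \<Longrightarrow> Ck_on k (\<lambda>x. f x $ i) S"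
  by (rule Ck_on_bounded_linear) (auto intro: bounded_linear_vec_nth)

lemma Ck_on_Pair:
  assumes "open S" "Ck_on k f S" "Ck_on k g S"
  shows "Ck_on k (\<lambda>x. (f x, g x)) S"
proof -
  have "Ck_on k (\<lambda>x. (f x, 0) + (0, g x)) S"
    using assms
    by (intro Ck_on_add Ck_on_bounded_linear[where L="\<lambda>y. (y, 0)"] Ck_on_bounded_linear[where L="\<lambda>y. (0, y)"])
      (auto intro!: bounded_linear_Pair bounded_linear_ident bounded_linear_zero)
  then show ?thesis by simp
qed

text \<open>Closure under differentiation lets the induction on the order run without any formula
  for higher derivatives. It is applied to negative powers and to the derivatives of
  exp(-1/x).\<close>

lemma smooth_on_real_family:
  fixes F :: "(real \<Rightarrow> real) set"
  assumes "open S" "f \<in> F"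
    and "\<And>f. f \<in> F \<Longrightarrow> \<exists>f'\<in>F. \<forall>x\<in>S. (f has_real_derivative f' x) (at x)"
  shows "smooth_on f S"
  unfolding smooth_on_def
proof
  show "Ck_on k f S" for k
    using assms(2)
  proof (induction k arbitrary: f)
    case 0
    then show ?case
      using assms(3)[OF 0] by (auto intro!: continuous_at_imp_continuous_on DERIV_isCont)
  next
    case (Suc k)
    obtain f' where f': "f' \<in> F" "\<forall>x\<in>S. (f has_real_derivative f' x) (at x)"
      using assms(3)[OF Suc.prems] by blast
    show ?case
      by (rule Ck_on_SucI[OF assms(1), where f'="\<lambda>x v. f' x * v"])
        (use f' Suc.IH in \<open>auto simp: has_field_derivative_def assms(1) intro!: Ck_on_mult Ck_on_const\<close>)
  qed
qed

lemma smooth_on_inverse_real: "smooth_on (\<lambda>x::real. inverse x) (- {0})"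
proof (rule smooth_on_real_family[where F="{\<lambda>x. c * inverse x ^ Suc n |c n. True}"])
  show "(\<lambda>x::real. inverse x) \<in> {\<lambda>x. c * inverse x ^ Suc n |c n. True}"
    by (rule CollectI, rule exI[of _ 1], rule exI[of _ 0]) simp
next
  fix f :: "real \<Rightarrow> real" assume "f \<in> {\<lambda>x. c * inverse x ^ Suc n |c n. True}"
  then obtain c n where f: "f = (\<lambda>x. c * inverse x ^ Suc n)" by blast
  have "(f has_real_derivative (- c * Suc n) * inverse x ^ Suc (Suc n)) (at x)" if "x \<noteq> 0" for x
  proof -
    have "((\<lambda>x. c * inverse x ^ Suc n) has_real_derivative
        c * (real (Suc n) * (inverse x ^ n * (- (inverse x ^ Suc (Suc 0)))))) (at x)"
      using DERIV_cmult[OF DERIV_power[OF DERIV_inverse[OF that]], of c "Suc n"]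
      by (simp add: mult.commute mult.left_commute)
    also have "c * (real (Suc n) * (inverse x ^ n * (- (inverse x ^ Suc (Suc 0))))) = (- c * Suc n) * inverse x ^ Suc (Suc n)"
      by (simp only: power_Suc power_0) (simp add: algebra_simps)
    finally show ?thesis unfolding f .
  qed
  then show "\<exists>f'\<in>{\<lambda>x. c * inverse x ^ Suc n |c n. True}. \<forall>x\<in>- {0}. (f has_real_derivative f' x) (at x)"
    by (intro bexI[of _ "\<lambda>x. (- c * Suc n) * inverse x ^ Suc (Suc n)"]) blast+
qed auto

lemma Ck_on_divide:
  fixes f g :: "'e::euclidean_space \<Rightarrow> real"
  assumes "open S" "Ck_on k f S" "Ck_on k g S" "\<And>x. x \<in> S \<Longrightarrow> g x \<noteq> 0"
  shows "Ck_on k (\<lambda>x. f x / g x) S"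
proof -
  have "Ck_on k (\<lambda>x. inverse (g x)) S"
    by (rule Ck_on_compose[of _ "- {0}" g _ inverse])
      (use assms(1,3,4) smooth_on_inverse_real[unfolded smooth_on_def] in \<open>auto simp: open_Compl\<close>)
  then show ?thesis
    unfolding divide_inverse by (intro Ck_on_mult assms(1,2))
qed

text \<open>The determinant is a polynomial in the entries. It is needed for Cramer's rule in the
  inverse function theorem.\<close>

lemma Ck_on_det:
  fixes A :: "'e::euclidean_space \<Rightarrow> real^'n^'n"
  assumes "open S" "\<And>i j. Ck_on k (\<lambda>x. A x $ i $ j) S"
  shows "Ck_on k (\<lambda>x. det (A x)) S"
  unfolding det_def by (intro Ck_on_sum Ck_on_mult Ck_on_prod Ck_on_const assms)

section \<open>Transfer of the calculus from finite order to smooth maps\<close>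

lemma smooth_on_Ck_on: "smooth_on f S \<Longrightarrow> Ck_on k f S"
  by (simp add: smooth_on_def)

lemma smooth_on_cong:
  "open S \<Longrightarrow> (\<And>x. x \<in> S \<Longrightarrow> f x = g x) \<Longrightarrow> smooth_on f S \<Longrightarrow> smooth_on g S"
  unfolding smooth_on_def using Ck_on_cong_imp by blast

lemma smooth_on_subset: "smooth_on f S \<Longrightarrow> T \<subseteq> S \<Longrightarrow> smooth_on f T"
  unfolding smooth_on_def using Ck_on_subset by blast

lemma smooth_on_local:
  "(\<And>x. x \<in> S \<Longrightarrow> \<exists>T. open T \<and> x \<in> T \<and> smooth_on f T) \<Longrightarrow> smooth_on f S"
  unfolding smooth_on_def by (blast intro!: Ck_on_local)

lemma smooth_on_compose:
  assumes "open S" "open T" "f ` S \<subseteq> T" "smooth_on f S" "smooth_on g T"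
  shows "smooth_on (\<lambda>x. g (f x)) S"
  using assms Ck_on_compose unfolding smooth_on_def by blast

lemma smooth_on_continuous: "smooth_on f S \<Longrightarrow> continuous_on S f"
  using smooth_on_Ck_on[of f S 0] by simp

lemma smooth_on_has_derivative:
  "smooth_on f S \<Longrightarrow> x \<in> S \<Longrightarrow> (f has_derivative frechet_derivative f (at x)) (at x)"
  using Ck_on_Suc_has_derivative[of 0] smooth_on_Ck_on by blast

lemma smooth_on_frechet_derivative:
  "smooth_on f S \<Longrightarrow> smooth_on (\<lambda>x. frechet_derivative f (at x) v) S"
  unfolding smooth_on_def by (metis Ck_on.simps(2))

lemma smooth_onI_derivative:
  assumes "open S" "\<And>x. x \<in> S \<Longrightarrow> (f has_derivative f' x) (at x)" "\<And>v. smooth_on (\<lambda>x. f' x v) S"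
  shows "smooth_on f S"
  unfolding smooth_on_def
proof
  show "Ck_on k f S" for k
    using Ck_on_SucI[OF assms(1,2)] assms(3) Ck_on_SucD unfolding smooth_on_def by blast
qed

context
  fixes S :: "'e::euclidean_space set" assumes S: "open S"
begin

lemma smooth_on_const: "smooth_on (\<lambda>x. c) S"
  and smooth_on_linear: "bounded_linear L \<Longrightarrow> smooth_on L S"
  and smooth_on_bounded_linear: "bounded_linear L' \<Longrightarrow> smooth_on f S \<Longrightarrow> smooth_on (\<lambda>x. L' (f x)) S"
  and smooth_on_add: "smooth_on f S \<Longrightarrow> smooth_on g S \<Longrightarrow> smooth_on (\<lambda>x. f x + g x) S"
  and smooth_on_scaleR: "smooth_on h S \<Longrightarrow> smooth_on f S \<Longrightarrow> smooth_on (\<lambda>x. h x *\<^sub>R f x) S"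
  and smooth_on_divide: "smooth_on a S \<Longrightarrow> smooth_on b S \<Longrightarrow> (\<And>x. x \<in> S \<Longrightarrow> b x \<noteq> 0) \<Longrightarrow> smooth_on (\<lambda>x. a x / b x :: real) S"
  and smooth_on_Pair: "smooth_on f S \<Longrightarrow> smooth_on f2 S \<Longrightarrow> smooth_on (\<lambda>x. (f x, f2 x)) S"
  using S unfolding smooth_on_def
  by (auto intro: Ck_on_const Ck_on_linear Ck_on_bounded_linear Ck_on_add Ck_on_scaleR
      Ck_on_divide Ck_on_Pair)

lemma smooth_on_id: "smooth_on (\<lambda>x. x) S"
  by (rule smooth_on_linear) (rule bounded_linear_ident)

lemma smooth_on_diff: "smooth_on f S \<Longrightarrow> smooth_on g S \<Longrightarrow> smooth_on (\<lambda>x. f x - g x) S"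
  using smooth_on_add[of f "\<lambda>x. (-1) *\<^sub>R g x"] smooth_on_scaleR[of "\<lambda>x. -1" g]
  by (auto simp: smooth_on_const)

end

lemma smooth_on_compose_UNIV:
  "open S \<Longrightarrow> smooth_on g UNIV \<Longrightarrow> smooth_on f S \<Longrightarrow> smooth_on (\<lambda>x. g (f x)) S"
  by (rule smooth_on_compose[of _ UNIV]) auto

subsection \<open>Bump functions\<close>

text \<open>For \<open>P = 1\<close> this is the classical flat function exp(-1/x). The polynomial
  factor is there to make the family closed under differentiation.\<close>

definition flat_poly :: "real poly \<Rightarrow> real \<Rightarrow> real" where
  "flat_poly P x = (if x > 0 then poly P (inverse x) * exp (- inverse x) else 0)"

lemma tendsto_poly_times_exp_minus: "((\<lambda>u::real. poly P u * exp (- u)) \<longlongrightarrow> 0) at_top"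
proof -
  have "((\<lambda>u::real. \<Sum>i\<le>degree P. coeff P i * (u ^ i / exp u)) \<longlongrightarrow> (\<Sum>i\<le>degree P. coeff P i * 0)) at_top"
    by (intro tendsto_intros tendsto_power_div_exp_0)
  then show ?thesis
    by (simp add: poly_altdef sum_distrib_right exp_minus divide_inverse mult.assoc)
qed

text \<open>Both factors are functions of 1/x, whose derivative -1/x^2 yields the factor
  \<open>[:0, 0, 1:]\<close>, and the product rule yields \<open>P - pderiv P\<close>. At 0 the
  exponential beats every power of 1/x.\<close>

lemma flat_poly_derivative:
  "(flat_poly P has_real_derivative flat_poly ([:0, 0, 1:] * (P - pderiv P)) x) (at x)"
proof (cases x "0::real" rule: linorder_cases)
  case less
  have "((\<lambda>x. 0) has_real_derivative 0) (at x)" by simp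
  then have "(flat_poly P has_real_derivative 0) (at x)"
    by (rule has_field_derivative_transform_within_open[where S="{..<0}"]) (use less in \<open>auto simp: flat_poly_def\<close>)
  then show ?thesis using less by (simp add: flat_poly_def)
next
  case greater
  have "((\<lambda>x. poly P (inverse x) * exp (- inverse x)) has_real_derivative
      flat_poly ([:0, 0, 1:] * (P - pderiv P)) x) (at x)"
    using greater
    by (auto intro!: derivative_eq_intros simp: flat_poly_def field_simps power2_eq_square)
  then show ?thesis
    by (rule has_field_derivative_transform_within_open[where S="{0<..}"]) (use greater in \<open>auto simp: flat_poly_def\<close>)
next
  case equal
  have "((\<lambda>h. flat_poly P h / h) \<longlongrightarrow> 0) (at 0)"
  proof (rule filterlim_split_at)
    show "((\<lambda>h. flat_poly P h / h) \<longlongrightarrow> 0) (at_left 0)"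
      by (rule tendsto_eventually) (auto simp: flat_poly_def eventually_at_left_field intro: exI[of _ "-1"])
  next
    \<comment> \<open>The difference quotient carries one more factor 1/h, which
      \<open>pCons 0\<close> encodes.\<close>
    have "((\<lambda>h. poly (pCons 0 P) (inverse h) * exp (- inverse h)) \<longlongrightarrow> 0) (at_right (0::real))"
      using filterlim_compose[OF tendsto_poly_times_exp_minus filterlim_inverse_at_top_right] by blast
    then show "((\<lambda>h. flat_poly P h / h) \<longlongrightarrow> 0) (at_right 0)"
      by (rule Lim_transform_eventually)
        (auto simp: flat_poly_def eventually_at_right_field divide_inverse intro!: exI[of _ 1])
  qed
  then show ?thesis
    using equal by (simp add: DERIV_def flat_poly_def)
qed

lemma smooth_on_flat_poly: "smooth_on (flat_poly P) UNIV"
  by (rule smooth_on_real_family[where F="range flat_poly"]) (use flat_poly_derivative in blast)+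

lemma smooth_bump:
  fixes x0 :: "'e::euclidean_space"
  assumes "r > 0"
  obtains h :: "'e \<Rightarrow> real" where "smooth_on h UNIV" "\<And>x. 0 \<le> h x"
    "\<And>x. x \<in> ball x0 r \<Longrightarrow> h x = 1" "\<And>x. x \<notin> cball x0 (2 * r) \<Longrightarrow> h x = 0"
proof -
  define \<eta> where "\<eta> = flat_poly 1"
  have \<eta>: "smooth_on \<eta> UNIV" "\<eta> s \<ge> 0" "\<eta> s > 0 \<longleftrightarrow> s > 0" "\<eta> s = 0 \<longleftrightarrow> s \<le> 0" for s
    by (auto simp: \<eta>_def smooth_on_flat_poly flat_poly_def)
  define s where "s x = (x - x0) \<bullet> (x - x0)" for x
  have s: "smooth_on s UNIV"
    unfolding s_def smooth_on_def
    by (intro allI Ck_on_bilinear[OF _ bounded_bilinear_inner] smooth_on_Ck_on smooth_on_diff smooth_on_id smooth_on_const open_UNIV)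
  \<comment> \<open>\<open>a\<close> is positive exactly inside radius \<open>2 * r\<close> and
    \<open>b\<close> exactly beyond radius \<open>r\<close>, so they never vanish together and
    \<open>a / (a + b)\<close> is the bump. The squared distance \<open>s\<close> is used because it
    is smooth at the centre.\<close>
  define a b where "a x = \<eta> (4 * r\<^sup>2 - s x)" and "b x = \<eta> (s x - r\<^sup>2)" for x
  have ab: "smooth_on a UNIV" "smooth_on b UNIV"
    unfolding a_def b_def
    by (intro smooth_on_compose_UNIV[OF _ \<eta>(1)] smooth_on_diff s smooth_on_const open_UNIV)+
  have pos: "a x + b x > 0" for x
  proof (cases "s x < 4 * r\<^sup>2")
    case True
    then show ?thesis using \<eta>(3)[of "4 * r\<^sup>2 - s x"] \<eta>(2)[of "s x - r\<^sup>2"] by (simp add: a_def b_def)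
  next
    case False
    then have "s x > r\<^sup>2" using assms by (smt (verit) zero_less_power)
    then show ?thesis using \<eta>(3)[of "s x - r\<^sup>2"] \<eta>(2)[of "4 * r\<^sup>2 - s x"] by (simp add: a_def b_def)
  qed
  have sd: "s x = (dist x0 x)\<^sup>2" for x
    unfolding dist_commute[of x0] by (simp add: s_def dist_norm power2_norm_eq_inner)
  show thesis
  proof
    show "smooth_on (\<lambda>x. a x / (a x + b x)) UNIV"
      using pos by (intro smooth_on_divide smooth_on_add ab open_UNIV) (metis less_irrefl)
    show "0 \<le> a x / (a x + b x)" for x
      using pos[of x] \<eta>(2) by (simp add: a_def)
    show "a x / (a x + b x) = 1" if "x \<in> ball x0 r" for x
    proof -
      have "s x \<le> r\<^sup>2" using that by (simp add: sd power_mono)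
      then have "b x = 0" using \<eta>(4) by (simp add: b_def)
      then show ?thesis using pos[of x] by simp
    qed
    show "a x / (a x + b x) = 0" if "x \<notin> cball x0 (2 * r)" for x
    proof -
      have "(2 * r)\<^sup>2 \<le> s x" using that assms unfolding sd by (intro power_mono) auto
      then have "a x = 0" using \<eta>(4) by (simp add: a_def power_mult_distrib)
      then show ?thesis by simp
    qed
  qed
qed

subsection \<open>The smooth inverse function theorem\<close>

text \<open>The classical theorem provides a differentiable inverse \<open>g\<close>. Its derivative
  is an explicit expression in the derivative of \<open>f\<close> at \<open>g y\<close>, hence of
  class k whenever \<open>g\<close> is; so \<open>g\<close> bootstraps itself from continuous to
  smooth.\<close>

lemma smooth_inverse_function:
  fixes f :: "real^'n \<Rightarrow> real^'n"
  assumes S: "open S" and f: "smooth_on f S" and x0: "x0 \<in> S"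
    and inj: "inj (frechet_derivative f (at x0))"
  obtains U V g where "open U" "x0 \<in> U" "U \<subseteq> S" "open V" "f ` U = V" "g ` V = U"
    "\<And>x. x \<in> U \<Longrightarrow> g (f x) = x" "\<And>y. y \<in> V \<Longrightarrow> f (g y) = y" "smooth_on g V"
proof -
  define f' where "f' x = Blinfun (frechet_derivative f (at x))" for x
  have der: "(f has_derivative frechet_derivative f (at x)) (at x)" if "x \<in> S" for x
    using smooth_on_has_derivative[OF f that] .
  have app: "blinfun_apply (f' x) = frechet_derivative f (at x)" if "x \<in> S" for x
    unfolding f'_def using has_derivative_bounded_linear[OF der[OF that]]
    by (rule bounded_linear_Blinfun_apply)
  have cont: "continuous_on S f'"
  proof (rule continuous_on_blinfun_componentwise)
    fix i :: "real^'n" assume "i \<in> Basis"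
    have "continuous_on S (\<lambda>x. frechet_derivative f (at x) i)"
      by (rule smooth_on_continuous[OF smooth_on_frechet_derivative[OF f]])
    then show "continuous_on S (\<lambda>x. blinfun_apply (f' x) i)"
      by (simp add: app cong: continuous_on_cong)
  qed
  have "linear (frechet_derivative f (at x0))"
    using der[OF x0] has_derivative_linear by blast
  then obtain g0 where g0: "linear g0" "g0 \<circ> frechet_derivative f (at x0) = id"
    using linear_injective_left_inverse inj by blast
  have inv: "Blinfun g0 o\<^sub>L f' x0 = id_blinfun"
  proof (rule blinfun_eqI)
    fix i show "blinfun_apply (Blinfun g0 o\<^sub>L f' x0) i = blinfun_apply id_blinfun i"
      using g0 app[OF x0] by (simp add: bounded_linear_Blinfun_apply linear_conv_bounded_linear[symmetric] pointfree_idE)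
  qed
  obtain U V g g' where *: "open U" "U \<subseteq> S" "x0 \<in> U" "open V" "homeomorphism U V f g"
    and g': "\<And>y. y \<in> V \<Longrightarrow> (g has_derivative (g' y)) (at y)"
    "\<And>y. y \<in> V \<Longrightarrow> g' y = inv (blinfun_apply (f'(g y)))"
    "\<And>y. y \<in> V \<Longrightarrow> bij (blinfun_apply (f'(g y)))"
    using inverse_function_theorem[OF S _ cont x0 inv] der app by metis
  have gV: "g y \<in> S" if "y \<in> V" for y
    using * that by (auto simp: homeomorphism_def)
  define A where "A y = matrix (frechet_derivative f (at (g y)))" for y
  have lin: "linear (frechet_derivative f (at (g y)))" if "y \<in> V" for y
    using der[OF gV[OF that]] has_derivative_linear by blast
  have detA: "det (A y) \<noteq> 0" if "y \<in> V" for y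
    using g'(3)[OF that] app[OF gV[OF that]] lin[OF that] det_nz_iff_inj[of "frechet_derivative f (at (g y))"]
    by (auto simp: A_def bij_def)
  \<comment> \<open>Cramer's rule replaces the pointwise inverse of a linear map by quotients of
    determinants, to which the calculus of \<open>Ck_on\<close> applies.\<close>
  have g'_eq: "g' y v = (\<chi> k. det (\<chi> i j. if j = k then v $ i else A y $ i $ j) / det (A y))"
    if "y \<in> V" for y v
  proof -
    have "A y *v g' y v = frechet_derivative f (at (g y)) (g' y v)"
      using lin[OF that] by (simp add: A_def matrix_works)
    also have "\<dots> = v"
      using g'(2,3)[OF that] app[OF gV[OF that]] by (simp add: bij_is_surj surj_f_inv_f)
    finally show ?thesis
      using cramer[OF detA[OF that]] by blast
  qed
  have "Ck_on k g V" for k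
  proof (induction k)
    case 0
    then show ?case using * by (simp add: homeomorphism_def)
  next
    case (Suc k)
    have A: "Ck_on k (\<lambda>y. A y $ i $ j) V" for i j
    proof -
      have "Ck_on k (\<lambda>y. frechet_derivative f (at (g y)) (axis j 1)) V"
        using gV by (intro Ck_on_compose[OF \<open>open V\<close> S _ Suc smooth_on_Ck_on[OF smooth_on_frechet_derivative[OF f]]]) auto
      then show ?thesis
        using Ck_on_vec_nth[OF \<open>open V\<close>] by (simp add: A_def matrix_def)
    qed
    show ?case
    proof (rule Ck_on_SucI[OF \<open>open V\<close> g'(1)])
      fix v
      have 1: "Ck_on k (\<lambda>y. (\<chi> i j. if j = l then v $ i else A y $ i $ j) $ i' $ j') V" for i' j' l
        by (cases "j' = l") (simp_all add: A Ck_on_const \<open>open V\<close>)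
      have "Ck_on k (\<lambda>y. \<chi> l. det (\<chi> i j. if j = l then v $ i else A y $ i $ j) / det (A y)) V"
        by (intro Ck_on_vec_lambda Ck_on_divide Ck_on_det A 1 detA \<open>open V\<close>)
      then show "Ck_on k (\<lambda>x. g' x v) V"
        using Ck_on_cong_imp[OF \<open>open V\<close>] g'_eq by (metis (no_types, lifting))
    qed
  qed
  then show thesis
    using * by (intro that[of U V g]) (auto simp: homeomorphism_def smooth_on_def)
qed

subsection \<open>The Poincare lemma\<close>

text \<open>The primitive at \<open>x\<close> is the integral of the form along the segment from
  \<open>x0\<close>. By closedness, the derivative of the integrand in direction \<open>w\<close>
  equals d/dt of t times \<open>\<omega> w (z x t)\<close>, so its integral collapses to the value
  at t = 1.\<close>

lemma poincare_lemma:
  fixes \<omega> :: "'e::euclidean_space \<Rightarrow> 'e \<Rightarrow> real"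
  assumes U: "open U" "convex U" "x0 \<in> U"
    and sm: "\<And>w. smooth_on (\<omega> w) U"
    and lin: "\<And>x. x \<in> U \<Longrightarrow> linear (\<lambda>w. \<omega> w x)"
    and closed: "\<And>x u v. x \<in> U \<Longrightarrow>
      frechet_derivative (\<omega> v) (at x) u = frechet_derivative (\<omega> u) (at x) v"
  obtains F where "smooth_on F U" "\<And>x. x \<in> U \<Longrightarrow> (F has_derivative (\<lambda>w. \<omega> w x)) (at x)"
proof -
  define z where "z x t = x0 + t *\<^sub>R (x - x0)" for x and t :: real
  have zU: "z x t \<in> U" if "x \<in> U" "t \<in> {0..1}" for x t
  proof -
    have "z x t = (1 - t) *\<^sub>R x0 + t *\<^sub>R x" by (simp add: z_def algebra_simps)
    then show ?thesis using that U by (auto simp: convex_def)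
  qed
  define D where "D w x = frechet_derivative (\<omega> w) (at x)" for w x
  have D: "(\<omega> w has_derivative D w x) (at x)" if "x \<in> U" for w x
    unfolding D_def by (rule smooth_on_has_derivative[OF sm that])
  have linD: "linear (D w x)" if "x \<in> U" for w x
    using D[OF that] has_derivative_linear by blast
  have expand: "\<omega> w x = (\<Sum>b\<in>Basis. (w \<bullet> b) * \<omega> b x)" if "x \<in> U" for w x
    using linear_euclidean_expansion[OF lin[OF that], of w] by simp
  define f where "f x t = (\<Sum>b\<in>Basis. ((x - x0) \<bullet> b) * \<omega> b (z x t))" for x t
  define fd where "fd x t w = (\<Sum>b\<in>Basis. ((x - x0) \<bullet> b) * D b (z x t) (t *\<^sub>R w) + (w \<bullet> b) * \<omega> b (z x t))" for x t w
  have der: "((\<lambda>x. f x t) has_derivative fd x t) (at x)" if "x \<in> U" "t \<in> {0..1}" for x t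
  proof -
    have "((\<lambda>x. z x t) has_derivative (\<lambda>w. t *\<^sub>R w)) (at x)"
      unfolding z_def by (auto intro!: derivative_eq_intros)
    then have "((\<lambda>x. \<omega> b (z x t)) has_derivative (\<lambda>w. D b (z x t) (t *\<^sub>R w))) (at x)" for b
      by (rule has_derivative_compose[where f="\<lambda>x. z x t" and g="\<omega> b" for b, OF _ D[OF zU[OF that]]])
    moreover have "((\<lambda>x. (x - x0) \<bullet> b) has_derivative (\<lambda>w. w \<bullet> b)) (at x)" for b
      by (auto intro!: derivative_eq_intros)
    ultimately show ?thesis
      unfolding f_def fd_def by (intro has_derivative_sum has_derivative_mult)
  qed
  \<comment> \<open>Closedness exchanges the direction of differentiation with the argument of the
    form; the sum over the basis then becomes the derivative of \<open>\<omega> w\<close> along the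
    ray.\<close>
  have fd_eq: "fd x t w = \<omega> w (z x t) + t * D w (z x t) (x - x0)" if "x \<in> U" "t \<in> {0..1}" for x t w
  proof -
    have zz: "z x t \<in> U" using zU that by blast
    have "fd x t w = t * (\<Sum>b\<in>Basis. ((x - x0) \<bullet> b) * D b (z x t) w) + \<omega> w (z x t)"
      unfolding fd_def expand[OF zz, of w] linear_scale[OF linD[OF zz]]
      by (simp add: sum.distrib sum_distrib_left mult.left_commute)
    also have "(\<Sum>b\<in>Basis. ((x - x0) \<bullet> b) * D b (z x t) w) = (\<Sum>b\<in>Basis. ((x - x0) \<bullet> b) * D w (z x t) b)"
      using closed[OF zz] by (simp add: D_def)
    also have "\<dots> = D w (z x t) (\<Sum>b\<in>Basis. ((x - x0) \<bullet> b) *\<^sub>R b)"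
      by (simp add: linear_sum[OF linD[OF zz]] linear_scale[OF linD[OF zz]])
    finally show ?thesis by (simp add: euclidean_representation)
  qed
  \<comment> \<open>Differentiation under the integral asks for an operator-valued derivative
    depending continuously on both variables; in finite dimension continuity of the components is
    enough.\<close>
  define fx where "fx x t = Blinfun (fd x t)" for x t
  have fx: "blinfun_apply (fx x t) = fd x t" if "x \<in> U" "t \<in> {0..1}" for x t
    unfolding fx_def using has_derivative_bounded_linear[OF der[OF that]] by (rule bounded_linear_Blinfun_apply)
  have contz: "continuous_on (U \<times> {0..1}) (\<lambda>p. z (fst p) (snd p))"
    unfolding z_def by (intro continuous_intros)
  have zsub: "(\<lambda>p. z (fst p) (snd p)) ` (U \<times> {0..1}) \<subseteq> U"
    using zU by auto
  have cont\<omega>: "continuous_on (U \<times> {0..1}) (\<lambda>p. \<omega> b (z (fst p) (snd p)))" for b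
    using continuous_on_compose2[OF smooth_on_continuous[OF sm] contz zsub] by simp
  have contD: "continuous_on (U \<times> {0..1}) (\<lambda>p. D b (z (fst p) (snd p)) w)" for b w
    using continuous_on_compose2[OF smooth_on_continuous[OF smooth_on_frechet_derivative[OF sm]] contz zsub]
    by (simp add: D_def)
  have contfx: "continuous_on (U \<times> cbox 0 1) (\<lambda>(x, t). fx x t)"
    unfolding case_prod_unfold
  proof (rule continuous_on_blinfun_componentwise)
    fix i :: 'e
    have "continuous_on (U \<times> {0..1}) (\<lambda>p. \<Sum>b\<in>Basis. ((fst p - x0) \<bullet> b) * (snd p * D b (z (fst p) (snd p)) i) + (i \<bullet> b) * \<omega> b (z (fst p) (snd p)))"
      by (intro continuous_intros cont\<omega> contD)
    also have "?this \<longleftrightarrow> continuous_on (U \<times> {0..1}) (\<lambda>p. blinfun_apply (fx (fst p) (snd p)) i)"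
      by (rule continuous_on_cong) (auto simp: fx fd_def linear_scale[OF linD] zU)
    finally show "continuous_on (U \<times> cbox 0 1) (\<lambda>p. blinfun_apply (fx (fst p) (snd p)) i)"
      by simp
  qed
  have slice: "continuous_on {0..1} (\<lambda>t. h (x, t))" if "continuous_on (U \<times> {0..1}) h" "x \<in> U"
    for h :: "'e \<times> real \<Rightarrow> 'x::topological_space" and x
    by (rule continuous_on_compose2[OF that(1)]) (use that(2) in \<open>auto intro!: continuous_intros\<close>)
  define F where "F x = integral (cbox 0 1) (f x)" for x
  have derF: "(F has_derivative (\<lambda>w. \<omega> w x)) (at x)" if x: "x \<in> U" for x
  proof -
    have intf: "f x integrable_on cbox 0 1" if "x \<in> U" for x
    proof -
      have "continuous_on {0..1} (\<lambda>t. f x t)"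
        unfolding f_def using slice[OF cont\<omega> that] by (auto intro!: continuous_intros)
      then show ?thesis by (simp add: integrable_continuous_real)
    qed
    have "(F has_derivative integral (cbox 0 1) (fx x)) (at x within U)"
      unfolding F_def
      by (rule leibniz_rule[OF _ intf contfx x \<open>convex U\<close>])
        (use der fx in \<open>auto intro: has_derivative_at_withinI\<close>)
    then have "(F has_derivative integral (cbox 0 1) (fx x)) (at x)"
      using U(1) x at_within_open by metis
    moreover have "blinfun_apply (integral (cbox 0 1) (fx x)) w = \<omega> w x" for w
    proof -
      have int: "fx x integrable_on cbox 0 1"
        using slice[of "\<lambda>p. fx (fst p) (snd p)", OF _ x] contfx
        by (simp add: integrable_continuous_real case_prod_unfold)
      have "blinfun_apply (integral (cbox 0 1) (fx x)) w = integral (cbox 0 1) ((\<lambda>g. blinfun_apply g w) \<circ> fx x)"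
        using integral_linear[OF int, of "\<lambda>g. blinfun_apply g w"]
        by (simp add: blinfun.bounded_linear_left)
      also have "\<dots> = integral {0..1} (\<lambda>t. \<omega> w (z x t) + t * D w (z x t) (x - x0))"
        unfolding box_real by (rule integral_cong) (use fx[OF x] fd_eq[OF x] in auto)
      also have "\<dots> = 1 * \<omega> w (z x 1) - 0 * \<omega> w (z x 0)"
      proof (rule integral_unique, rule fundamental_theorem_of_calculus)
        fix t :: real assume t: "t \<in> {0..1}"
        have "((\<lambda>t. z x t) has_derivative (\<lambda>s. s *\<^sub>R (x - x0))) (at t within {0..1})"
          unfolding z_def by (auto intro!: derivative_eq_intros)
        then have "((\<lambda>t. \<omega> w (z x t)) has_derivative (\<lambda>s. D w (z x t) (s *\<^sub>R (x - x0)))) (at t within {0..1})"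
          by (rule has_derivative_compose[where f="\<lambda>t. z x t" and g="\<omega> w", OF _ D[OF zU[OF x t]]])
        then have "((\<lambda>t. \<omega> w (z x t)) has_real_derivative D w (z x t) (x - x0)) (at t within {0..1})"
          by (simp add: has_field_derivative_def linear_scale[OF linD[OF zU[OF x t]]] mult_commute_abs)
        then have "((\<lambda>t. t * \<omega> w (z x t)) has_real_derivative \<omega> w (z x t) + t * D w (z x t) (x - x0)) (at t within {0..1})"
          by (auto intro!: derivative_eq_intros)
        then show "((\<lambda>t. t * \<omega> w (z x t)) has_vector_derivative \<omega> w (z x t) + t * D w (z x t) (x - x0)) (at t within {0..1})"
          by (simp add: has_real_derivative_iff_has_vector_derivative)
      qed auto
      finally show ?thesis by (simp add: z_def)
    qed
    then have "blinfun_apply (integral (cbox 0 1) (fx x)) = (\<lambda>w. \<omega> w x)" by (rule ext)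
    ultimately show ?thesis by simp
  qed
  show thesis
    by (rule that[of F]) (use derF smooth_onI_derivative[OF U(1) derF sm] in auto)
qed

section \<open>Smooth maps between manifolds\<close>

text \<open>Neither the Hausdorff property nor second countability matters for the local calculus.\<close>

definition smooth_atlas :: "('a, 'e::euclidean_space) manifold \<Rightarrow> bool" where
  "smooth_atlas M \<longleftrightarrow>
     (\<Union>c\<in>atlas M. fst c) = mpoints M \<and>
     (\<forall>c\<in>atlas M. openin (mtop M) (fst c) \<and> open (chart_image c) \<and>
        homeomorphic_map (subtopology (mtop M) (fst c)) (top_of_set (chart_image c)) (snd c)) \<and>
     (\<forall>c\<in>atlas M. \<forall>d\<in>atlas M. smooth_on (snd d \<circ> chart_inv c) (snd c ` (fst c \<inter> fst d)))"

lemma smooth_manifold_atlas: "smooth_manifold M \<Longrightarrow> smooth_atlas M"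
  by (simp add: smooth_manifold_def smooth_atlas_def)

section \<open>Charts as coordinate homeomorphisms\<close>

lemma chart_in: "p \<in> fst c \<Longrightarrow> snd c p \<in> chart_image c"
  by (simp add: chart_image_def)

lemma chart_inv_in: "x \<in> chart_image c \<Longrightarrow> chart_inv c x \<in> fst c"
  by (simp add: chart_image_def chart_inv_def inv_into_into)

lemma chart_chart_inv [simp]: "x \<in> chart_image c \<Longrightarrow> snd c (chart_inv c x) = x"
  by (simp add: chart_image_def chart_inv_def f_inv_into_f)

lemma charts_at_iff: "c \<in> charts_at M p \<longleftrightarrow> c \<in> atlas M \<and> p \<in> fst c"
  by (simp add: charts_at_def)

context
  fixes M :: "('a, 'e::euclidean_space) manifold" and c :: "('a, 'e) chart"
  assumes M: "smooth_atlas M" and c: "c \<in> atlas M"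
begin

lemma chart_openin: "openin (mtop M) (fst c)"
  and open_chart_image: "open (chart_image c)"
  and chart_homeo: "homeomorphic_map (subtopology (mtop M) (fst c)) (top_of_set (chart_image c)) (snd c)"
  using M c by (auto simp: smooth_atlas_def)

lemma chart_subset: "fst c \<subseteq> mpoints M"
  using chart_openin openin_subset by blast

lemma topspace_chart: "topspace (subtopology (mtop M) (fst c)) = fst c"
  using chart_subset by (simp add: topspace_subtopology inf.absorb2)

lemma inj_on_chart: "inj_on (snd c) (fst c)"
  using chart_homeo unfolding homeomorphic_eq_everything_map topspace_chart by blast

lemma chart_inv_chart: "p \<in> fst c \<Longrightarrow> chart_inv c (snd c p) = p"
  using inj_on_chart by (simp add: chart_inv_def inv_into_f_f)

lemma openin_chart_preimage: "open X \<Longrightarrow> openin (mtop M) {p \<in> fst c. snd c p \<in> X}"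
proof -
  assume "open X"
  then have "openin (top_of_set (chart_image c)) (X \<inter> chart_image c)"
    using openin_open_Int[of X "chart_image c"] by (simp add: Int_commute)
  then have "openin (subtopology (mtop M) (fst c)) {p \<in> fst c. snd c p \<in> X \<inter> chart_image c}"
    using chart_homeo openin_continuous_map_preimage[of "subtopology (mtop M) (fst c)" "top_of_set (chart_image c)" "snd c"]
    unfolding homeomorphic_eq_everything_map topspace_chart by blast
  then have "openin (mtop M) {p \<in> fst c. snd c p \<in> X \<inter> chart_image c}"
    using openin_trans_full chart_openin by blast
  also have "{p \<in> fst c. snd c p \<in> X \<inter> chart_image c} = {p \<in> fst c. snd c p \<in> X}"
    by (auto simp: chart_in)
  finally show ?thesis .
qed

lemma open_chart_img: "openin (mtop M) A \<Longrightarrow> open (snd c ` (fst c \<inter> A))"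
proof -
  assume "openin (mtop M) A"
  then have "openin (subtopology (mtop M) (fst c)) (fst c \<inter> A)"
    using openin_subtopology_Int by (metis inf_commute)
  then have "openin (top_of_set (chart_image c)) (snd c ` (fst c \<inter> A))"
    using chart_homeo by (simp add: homeomorphic_eq_everything_map open_map_def)
  then show ?thesis
    using open_chart_image openin_open_eq by blast
qed

lemma chart_image_mem_iff:
  "A \<subseteq> fst c \<Longrightarrow> x \<in> snd c ` A \<longleftrightarrow> x \<in> chart_image c \<and> chart_inv c x \<in> A"
proof
  assume "A \<subseteq> fst c" "x \<in> snd c ` A"
  then obtain a where "x = snd c a" "a \<in> A" "a \<in> fst c" by blast
  then show "x \<in> chart_image c \<and> chart_inv c x \<in> A" using chart_inv_chart chart_in[of a c] by simp
next
  assume "x \<in> chart_image c \<and> chart_inv c x \<in> A"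
  then show "x \<in> snd c ` A" using chart_chart_inv[of x c] by (metis image_eqI)
qed

lemma continuous_on_chart_inv:
  "continuous_map (top_of_set (chart_image c)) (mtop M) (chart_inv c)"
  unfolding continuous_map_def
proof (intro conjI allI impI)
  show "chart_inv c \<in> topspace (top_of_set (chart_image c)) \<rightarrow> mpoints M"
    using chart_inv_in[of _ c] chart_subset by (simp add: Pi_iff subset_iff)
  fix T assume T: "openin (mtop M) T"
  have "{x \<in> topspace (top_of_set (chart_image c)). chart_inv c x \<in> T} = snd c ` (fst c \<inter> T)"
    using chart_image_mem_iff[of "fst c \<inter> T"] chart_inv_in[of _ c] by auto
  then show "openin (top_of_set (chart_image c)) {x \<in> topspace (top_of_set (chart_image c)). chart_inv c x \<in> T}"
    using open_chart_img[OF T] by (auto simp: chart_image_def intro: open_subset)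
qed

end

lemma charts_at_nonempty:
  assumes "smooth_atlas M" "p \<in> mpoints M"
  obtains c where "c \<in> charts_at M p" "c \<in> atlas M" "p \<in> fst c"
  using assms unfolding smooth_atlas_def charts_at_def by blast

lemma open_transition:
  assumes "smooth_atlas M" "c \<in> atlas M" "d \<in> atlas M"
  shows "open (snd c ` (fst c \<inter> fst d))"
  using assms open_chart_img chart_openin by blast

lemma smooth_transition:
  assumes "smooth_atlas M" "c \<in> atlas M" "d \<in> atlas M"
  shows "smooth_on (\<lambda>x. snd d (chart_inv c x)) (snd c ` (fst c \<inter> fst d))"
  using assms by (auto simp: smooth_atlas_def comp_def)

text \<open>The domain is quantified away so that maps can be composed, combined and glued point by
  point. Since \<open>smooth_map_on\<close> includes openness and continuity, the predicate also
  places \<open>p\<close> and \<open>f p\<close> in the two manifolds.\<close>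

definition smooth_at ::
  "('a, 'e::euclidean_space) manifold \<Rightarrow> ('b, 'f::euclidean_space) manifold \<Rightarrow> ('a \<Rightarrow> 'b) \<Rightarrow> 'a \<Rightarrow> bool"
  where "smooth_at M N f p \<longleftrightarrow> (\<exists>W. p \<in> W \<and> smooth_map_on M W N f)"

lemma smooth_at_mem: "smooth_at M N f p \<Longrightarrow> p \<in> mpoints M \<and> f p \<in> mpoints N"
proof -
  assume "smooth_at M N f p"
  then obtain W where W: "p \<in> W" "openin (mtop M) W" "continuous_map (subtopology (mtop M) W) (mtop N) f"
    unfolding smooth_at_def smooth_map_on_def by blast
  then have "p \<in> topspace (subtopology (mtop M) W)"
    using openin_subset by (fastforce simp: topspace_subtopology)
  then show ?thesis using W(3) by (auto simp: continuous_map_def)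
qed

lemma smooth_at_continuous:
  assumes "smooth_at M N f p" "openin (mtop N) T" "f p \<in> T"
  obtains W where "openin (mtop M) W" "p \<in> W" "\<And>q. q \<in> W \<Longrightarrow> f q \<in> T"
proof -
  obtain W where W: "p \<in> W" "openin (mtop M) W" "continuous_map (subtopology (mtop M) W) (mtop N) f"
    using assms(1) unfolding smooth_at_def smooth_map_on_def by blast
  have "openin (subtopology (mtop M) W) {q \<in> topspace (subtopology (mtop M) W). f q \<in> T}"
    using W(3) assms(2) by (simp add: continuous_map_def)
  then have "openin (mtop M) {q \<in> topspace (subtopology (mtop M) W). f q \<in> T}"
    using W(2) openin_trans_full by blast
  moreover have "p \<in> topspace (subtopology (mtop M) W)"
    using W openin_subset by (fastforce simp: topspace_subtopology)
  ultimately show thesis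
    using that[of "{q \<in> topspace (subtopology (mtop M) W). f q \<in> T}"] assms(3) by blast
qed

text \<open>Smooth transitions carry the one coordinate expression to all other pairs of charts, and
  its continuity gives that of \<open>f\<close> for the manifold topologies. From here on a single
  convenient pair of charts is enough.\<close>

lemma smooth_atI:
  assumes M: "smooth_atlas M" and N: "smooth_atlas N"
    and c: "c \<in> atlas M" "p \<in> fst c" and d: "d \<in> atlas N"
    and X: "open X" "snd c p \<in> X" "X \<subseteq> chart_image c"
    and f: "\<And>x. x \<in> X \<Longrightarrow> f (chart_inv c x) \<in> fst d"
    and sm: "smooth_on (\<lambda>x. snd d (f (chart_inv c x))) X"
  shows "smooth_at M N f p"
proof -
  define W where "W = {q \<in> fst c. snd c q \<in> X}"
  have W: "openin (mtop M) W"
    unfolding W_def by (rule openin_chart_preimage[OF M c(1) X(1)])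
  have Wsub: "W \<subseteq> fst c" by (auto simp: W_def)
  have inv: "chart_inv c (snd c q) = q" if "q \<in> fst c" for q
    by (rule chart_inv_chart[OF M c(1) that])
  have fW: "f q \<in> fst d" if "q \<in> W" for q
    using f[of "snd c q"] that inv[of q] by (auto simp: W_def)
  have top: "topspace (subtopology (mtop M) W) = W"
    using W openin_subset by (fastforce simp: topspace_subtopology)
  have pre: "openin (mtop M) {q \<in> W. f q \<in> T}" if T: "openin (mtop N) T" for T
  proof -
    have o: "open (snd d ` (fst d \<inter> T))" using open_chart_img[OF N d T] .
    have "open {x \<in> X. snd d (f (chart_inv c x)) \<in> snd d ` (fst d \<inter> T)}"
      using continuous_openin_preimage_gen[OF smooth_on_continuous[OF sm] o] X(1)
      by (simp add: openin_open_eq vimage_def Int_def)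
    then have "openin (mtop M) {q \<in> fst c. snd c q \<in> {x \<in> X. snd d (f (chart_inv c x)) \<in> snd d ` (fst d \<inter> T)}}"
      by (rule openin_chart_preimage[OF M c(1)])
    also have "\<dots> = {q \<in> W. f q \<in> T}"
    proof -
      have "snd d (f q) \<in> snd d ` (fst d \<inter> T) \<longleftrightarrow> f q \<in> T" if "q \<in> W" for q
        using fW[OF that] inj_on_chart[OF N d] by (auto dest: inj_onD)
      then have "q \<in> W \<and> snd d (f q) \<in> snd d ` (fst d \<inter> T) \<longleftrightarrow> q \<in> W \<and> f q \<in> T" for q
        by blast
      then have "{q \<in> W. snd d (f q) \<in> snd d ` (fst d \<inter> T)} = {q \<in> W. f q \<in> T}" by blast
      moreover have "{q \<in> fst c. snd c q \<in> {x \<in> X. snd d (f (chart_inv c x)) \<in> snd d ` (fst d \<inter> T)}}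
          = {q \<in> W. snd d (f q) \<in> snd d ` (fst d \<inter> T)}"
        using inv unfolding W_def by auto
      ultimately show ?thesis by simp
    qed
    finally show ?thesis .
  qed
  have cont: "continuous_map (subtopology (mtop M) W) (mtop N) f"
    unfolding continuous_map_def top
    using pre fW chart_subset[OF N d] W by (auto simp: openin_open_subtopology)
  have "smooth_on (map_in_charts c' d' f) (snd c' ` {q \<in> fst c' \<inter> W. f q \<in> fst d'})"
    if c': "c' \<in> atlas M" and d': "d' \<in> atlas N" for c' d'
  proof -
    define S where "S = snd c' ` {q \<in> fst c' \<inter> W. f q \<in> fst d'}"
    have "S = snd c' ` (fst c' \<inter> {q \<in> W. f q \<in> fst d'})" by (auto simp: S_def)
    then have oS: "open S" using open_chart_img[OF M c' pre[OF chart_openin[OF N d']]] by simp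
    have S: "chart_inv c' x \<in> fst c' \<and> chart_inv c' x \<in> W \<and> f (chart_inv c' x) \<in> fst d'" if "x \<in> S" for x
      using that chart_inv_chart[OF M c'] by (auto simp: S_def)
    have "smooth_on (\<lambda>x. snd c (chart_inv c' x)) S"
      by (rule smooth_on_subset[OF smooth_transition[OF M c' c(1)]]) (use Wsub in \<open>auto simp: S_def\<close>)
    then have 1: "smooth_on (\<lambda>x. snd d (f (chart_inv c (snd c (chart_inv c' x))))) S"
      using S by (intro smooth_on_compose[OF oS X(1) _ _ sm]) (auto simp: W_def)
    have "smooth_on (\<lambda>x. snd d (f (chart_inv c' x))) S"
    proof (rule smooth_on_cong[OF oS _ 1])
      fix x assume "x \<in> S"
      then have "chart_inv c' x \<in> fst c" using S Wsub by blast
      then show "snd d (f (chart_inv c (snd c (chart_inv c' x)))) = snd d (f (chart_inv c' x))"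
        by (simp add: inv)
    qed
    then have 2: "smooth_on (\<lambda>x. snd d' (chart_inv d (snd d (f (chart_inv c' x))))) S"
      using S fW by (intro smooth_on_compose[OF oS open_transition[OF N d d'] _ _ smooth_transition[OF N d d']]) auto
    have "smooth_on (\<lambda>x. snd d' (f (chart_inv c' x))) S"
      by (rule smooth_on_cong[OF oS _ 2]) (use S fW chart_inv_chart[OF N d] in auto)
    then show ?thesis by (simp add: S_def map_in_charts_def comp_def)
  qed
  then have "smooth_map_on M W N f"
    using W cont by (simp add: smooth_map_on_def)
  moreover have "p \<in> W" using c X by (simp add: W_def)
  ultimately show ?thesis unfolding smooth_at_def by blast
qed

lemma smooth_atD:
  assumes M: "smooth_atlas M" and N: "smooth_atlas N" and f: "smooth_at M N f p"
    and c: "c \<in> atlas M" "p \<in> fst c" and d: "d \<in> atlas N" "f p \<in> fst d"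
  obtains X where "open X" "snd c p \<in> X" "X \<subseteq> chart_image c"
    "\<And>x. x \<in> X \<Longrightarrow> f (chart_inv c x) \<in> fst d" "smooth_on (\<lambda>x. snd d (f (chart_inv c x))) X"
proof -
  obtain W where W: "p \<in> W" "openin (mtop M) W" "continuous_map (subtopology (mtop M) W) (mtop N) f"
    "smooth_on (map_in_charts c d f) (snd c ` {q \<in> fst c \<inter> W. f q \<in> fst d})"
    using f c d unfolding smooth_at_def smooth_map_on_def by blast
  have top: "topspace (subtopology (mtop M) W) = W"
    using W(2) openin_subset by (fastforce simp: topspace_subtopology)
  have "openin (subtopology (mtop M) W) {q \<in> W. f q \<in> fst d}"
    using W(3) chart_openin[OF N d(1)] unfolding continuous_map_def top by blast
  then have o: "openin (mtop M) {q \<in> W. f q \<in> fst d}"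
    using W(2) openin_trans_full by blast
  define X where "X = snd c ` {q \<in> fst c \<inter> W. f q \<in> fst d}"
  have "X = snd c ` (fst c \<inter> {q \<in> W. f q \<in> fst d})" by (auto simp: X_def)
  then have "open X" using open_chart_img[OF M c(1) o] by simp
  moreover have "f (chart_inv c x) \<in> fst d" if "x \<in> X" for x
    using that chart_inv_chart[OF M c(1)] by (auto simp: X_def)
  ultimately show thesis
    using W c d by (intro that[of X]) (auto simp: X_def chart_image_def map_in_charts_def comp_def)
qed

lemma smooth_at_charts:
  assumes "smooth_atlas M" "smooth_atlas N" "smooth_at M N f p"
  obtains c d where "c \<in> atlas M" "p \<in> fst c" "d \<in> atlas N" "f p \<in> fst d"
  using assms charts_at_nonempty smooth_at_mem by metis

lemma smooth_at_cong:
  assumes M: "smooth_atlas M" and N: "smooth_atlas N" and f: "smooth_at M N f p"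
    and W: "openin (mtop M) W" "p \<in> W" "\<And>q. q \<in> W \<Longrightarrow> f q = g q"
  shows "smooth_at M N g p"
proof -
  obtain c d where c: "c \<in> atlas M" "p \<in> fst c" and d: "d \<in> atlas N" "f p \<in> fst d"
    using smooth_at_charts[OF M N f] .
  obtain X where X: "open X" "snd c p \<in> X" "X \<subseteq> chart_image c"
    "\<And>x. x \<in> X \<Longrightarrow> f (chart_inv c x) \<in> fst d" "smooth_on (\<lambda>x. snd d (f (chart_inv c x))) X"
    using smooth_atD[OF M N f c d] by blast
  let ?X = "X \<inter> snd c ` (fst c \<inter> W)"
  have o: "open ?X" using X(1) open_chart_img[OF M c(1) W(1)] by blast
  have eq: "f (chart_inv c x) = g (chart_inv c x)" if "x \<in> ?X" for x
    using that W(3) chart_inv_chart[OF M c(1)] by auto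
  show ?thesis
  proof (rule smooth_atI[OF M N c d(1) o])
    show "snd c p \<in> ?X" using X c W by auto
    show "?X \<subseteq> chart_image c" using X by auto
    show "g (chart_inv c x) \<in> fst d" if "x \<in> ?X" for x
      using eq[OF that] X(4)[of x] that by auto
    show "smooth_on (\<lambda>x. snd d (g (chart_inv c x))) ?X"
      by (rule smooth_on_cong[OF o _ smooth_on_subset[OF X(5)]]) (use eq in auto)
  qed
qed

lemma smooth_map_onI:
  assumes M: "smooth_atlas M" and N: "smooth_atlas N"
    and W: "openin (mtop M) W" and f: "\<And>p. p \<in> W \<Longrightarrow> smooth_at M N f p"
  shows "smooth_map_on M W N f"
proof -
  have top: "topspace (subtopology (mtop M) W) = W"
    using W openin_subset by (fastforce simp: topspace_subtopology)
  have "openin (mtop M) {q \<in> W. f q \<in> T}" if T: "openin (mtop N) T" for T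
  proof (subst openin_subopen, intro ballI)
    fix q assume "q \<in> {q \<in> W. f q \<in> T}"
    then obtain V where "openin (mtop M) V" "q \<in> V" "\<And>q. q \<in> V \<Longrightarrow> f q \<in> T" "q \<in> W"
      using smooth_at_continuous[OF f T] by blast
    then show "\<exists>V. openin (mtop M) V \<and> q \<in> V \<and> V \<subseteq> {q \<in> W. f q \<in> T}"
      using W by (intro exI[of _ "V \<inter> W"]) auto
  qed
  then have cont: "continuous_map (subtopology (mtop M) W) (mtop N) f"
    unfolding continuous_map_def top
    using W smooth_at_mem[OF f] by (auto simp: openin_open_subtopology)
  have "smooth_on (map_in_charts c d f) (snd c ` {p \<in> fst c \<inter> W. f p \<in> fst d})"
    if c: "c \<in> atlas M" and d: "d \<in> atlas N" for c d
  proof (rule smooth_on_local)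
    fix x assume "x \<in> snd c ` {p \<in> fst c \<inter> W. f p \<in> fst d}"
    then obtain p where p: "x = snd c p" "p \<in> fst c" "p \<in> W" "f p \<in> fst d" by blast
    show "\<exists>T. open T \<and> x \<in> T \<and> smooth_on (map_in_charts c d f) T"
      using smooth_atD[OF M N f[OF p(3)] c p(2) d p(4)] p(1) unfolding map_in_charts_def comp_def by metis
  qed
  with W cont show ?thesis by (simp add: smooth_map_on_def)
qed

lemma smooth_at_compose:
  assumes M: "smooth_atlas M" and N: "smooth_atlas N" and P: "smooth_atlas P"
    and f: "smooth_at M N f p" and g: "smooth_at N P g (f p)"
  shows "smooth_at M P (\<lambda>q. g (f q)) p"
proof -
  obtain c d where c: "c \<in> atlas M" "p \<in> fst c" and d: "d \<in> atlas N" "f p \<in> fst d"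
    using smooth_at_charts[OF M N f] .
  obtain e where e: "e \<in> atlas P" "g (f p) \<in> fst e" using charts_at_nonempty[OF P] smooth_at_mem[OF g] by metis
  obtain X where X: "open X" "snd c p \<in> X" "X \<subseteq> chart_image c"
    "\<And>x. x \<in> X \<Longrightarrow> f (chart_inv c x) \<in> fst d" "smooth_on (\<lambda>x. snd d (f (chart_inv c x))) X"
    using smooth_atD[OF M N f c d] by blast
  obtain Y where Y: "open Y" "snd d (f p) \<in> Y" "Y \<subseteq> chart_image d"
    "\<And>y. y \<in> Y \<Longrightarrow> g (chart_inv d y) \<in> fst e" "smooth_on (\<lambda>y. snd e (g (chart_inv d y))) Y"
    using smooth_atD[OF N P g d e] by blast
  define X' where "X' = {x \<in> X. snd d (f (chart_inv c x)) \<in> Y}"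
  have o: "open X'"
    using continuous_openin_preimage_gen[OF smooth_on_continuous[OF X(5)] Y(1)] X(1)
    by (simp add: openin_open_eq vimage_def Int_def X'_def)
  have inv: "chart_inv d (snd d (f (chart_inv c x))) = f (chart_inv c x)" if "x \<in> X'" for x
    using that X(4) by (auto simp: X'_def intro!: chart_inv_chart[OF N d(1)])
  show ?thesis
  proof (rule smooth_atI[OF M P c e(1) o])
    show "snd c p \<in> X'" using X(2) Y(2) chart_inv_chart[OF M c] by (simp add: X'_def)
    show "X' \<subseteq> chart_image c" using X(3) by (auto simp: X'_def)
    show "g (f (chart_inv c x)) \<in> fst e" if "x \<in> X'" for x
      using Y(4)[of "snd d (f (chart_inv c x))"] inv[OF that] that by (simp add: X'_def)
    have "smooth_on (\<lambda>x. snd d (f (chart_inv c x))) X'"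
      by (rule smooth_on_subset[OF X(5)]) (auto simp: X'_def)
    then have "smooth_on (\<lambda>x. snd e (g (chart_inv d (snd d (f (chart_inv c x)))))) X'"
      by (intro smooth_on_compose[OF o Y(1) _ _ Y(5)]) (auto simp: X'_def)
    then show "smooth_on (\<lambda>x. snd e (g (f (chart_inv c x)))) X'"
      by (rule smooth_on_cong[OF o, rotated]) (simp add: inv)
  qed
qed

subsection \<open>Euclidean spaces as manifolds\<close>

text \<open>With Euclidean space as a one-chart manifold, real functions, coordinate maps and their
  inverses all fall under \<open>smooth_at\<close> and its composition rule.\<close>

definition euclid :: "('e, 'e::euclidean_space) manifold" where
  "euclid = \<lparr>mtop = euclidean, atlas = {(UNIV, id)}\<rparr>"

lemma euclid_simps [simp]: "mtop euclid = euclidean" "atlas euclid = {(UNIV, id)}"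
  by (simp_all add: euclid_def)

lemma chart_inv_UNIV_id [simp]: "chart_inv (UNIV, id) = id"
  by (simp add: chart_inv_def inv_id)

lemma smooth_atlas_euclid [simp]: "smooth_atlas euclid"
  by (auto simp: smooth_atlas_def chart_image_def comp_def smooth_on_id)

lemma smooth_at_euclidI:
  assumes "smooth_atlas N" "open X" "x \<in> X" "d \<in> atlas N" "\<And>x. x \<in> X \<Longrightarrow> f x \<in> fst d"
    "smooth_on (\<lambda>x. snd d (f x)) X"
  shows "smooth_at euclid N f x"
  by (rule smooth_atI[OF smooth_atlas_euclid assms(1) _ _ assms(4) assms(2)])
    (use assms in \<open>auto simp: chart_image_def\<close>)

lemma smooth_at_euclid_euclid:
  "smooth_at euclid euclid f x \<longleftrightarrow> (\<exists>X. open X \<and> x \<in> X \<and> smooth_on f X)"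
proof
  assume "smooth_at euclid euclid f x"
  then obtain X where "open X" "x \<in> X" "smooth_on f X"
    by (rule smooth_atD[OF smooth_atlas_euclid smooth_atlas_euclid, of f x "(UNIV, id)" "(UNIV, id)"]) auto
  then show "\<exists>X. open X \<and> x \<in> X \<and> smooth_on f X" by blast
next
  assume "\<exists>X. open X \<and> x \<in> X \<and> smooth_on f X"
  then show "smooth_at euclid euclid f x"
    using smooth_at_euclidI[OF smooth_atlas_euclid, of _ x "(UNIV, id)" f] by auto
qed

lemma smooth_at_euclid_chartI:
  assumes M: "smooth_atlas M" and c: "c \<in> atlas M" "p \<in> fst c"
    and X: "open X" "snd c p \<in> X" "X \<subseteq> chart_image c" "smooth_on (\<lambda>x. f (chart_inv c x)) X"
  shows "smooth_at M euclid f p"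
  by (rule smooth_atI[OF M smooth_atlas_euclid c, of "(UNIV, id)" X]) (use X in auto)

lemma smooth_at_euclid_chartD:
  assumes M: "smooth_atlas M" and f: "smooth_at M euclid f p" and c: "c \<in> atlas M" "p \<in> fst c"
  obtains X where "open X" "snd c p \<in> X" "X \<subseteq> chart_image c" "smooth_on (\<lambda>x. f (chart_inv c x)) X"
  using smooth_atD[OF M smooth_atlas_euclid f c, of "(UNIV, id)"] by auto

lemma smooth_at_chart:
  assumes M: "smooth_atlas M" and c: "c \<in> atlas M" "p \<in> fst c"
  shows "smooth_at M euclid (snd c) p"
  by (rule smooth_at_euclid_chartI[OF M c open_chart_image[OF M c(1)]])
    (use c in \<open>auto simp: chart_in intro!: smooth_on_cong[OF open_chart_image[OF M c(1)] _ smooth_on_id[OF open_chart_image[OF M c(1)]]]\<close>)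

lemma smooth_at_chart_inv:
  assumes M: "smooth_atlas M" and c: "c \<in> atlas M" "x \<in> chart_image c"
  shows "smooth_at euclid M (chart_inv c) x"
  by (rule smooth_at_euclidI[OF M open_chart_image[OF M c(1)] c(2) c(1)])
    (use c in \<open>auto simp: chart_inv_in intro!: smooth_on_cong[OF open_chart_image[OF M c(1)] _ smooth_on_id[OF open_chart_image[OF M c(1)]]]\<close>)

lemma smooth_at_compose_euclid:
  assumes M: "smooth_atlas M" and f: "smooth_at M euclid f p"
    and h: "smooth_on h X" "open X" "f p \<in> X"
  shows "smooth_at M euclid (\<lambda>q. h (f q)) p"
  by (rule smooth_at_compose[OF M smooth_atlas_euclid smooth_atlas_euclid f])
    (use h smooth_at_euclid_euclid in blast)

lemma smooth_at_ident:
  assumes M: "smooth_atlas M" and p: "p \<in> mpoints M"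
  shows "smooth_at M M (\<lambda>q. q) p"
proof -
  obtain c where c: "c \<in> atlas M" "p \<in> fst c" using charts_at_nonempty[OF M p] by metis
  note o = open_chart_image[OF M c(1)]
  show ?thesis
    by (rule smooth_atI[OF M M c c(1) o])
      (use c in \<open>auto simp: chart_in chart_inv_in intro!: smooth_on_cong[OF o _ smooth_on_id[OF o]]\<close>)
qed

lemma smooth_at_const:
  assumes M: "smooth_atlas M" and N: "smooth_atlas N" and p: "p \<in> mpoints M" and a: "a \<in> mpoints N"
  shows "smooth_at M N (\<lambda>q. a) p"
proof -
  obtain c where c: "c \<in> atlas M" "p \<in> fst c" using charts_at_nonempty[OF M p] by metis
  obtain d where d: "d \<in> atlas N" "a \<in> fst d" using charts_at_nonempty[OF N a] by metis
  note o = open_chart_image[OF M c(1)]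
  show ?thesis
    by (rule smooth_atI[OF M N c d(1) o]) (use c d o in \<open>auto simp: chart_in intro: smooth_on_const\<close>)
qed

lemma smooth_at_euclid_Pair:
  assumes M: "smooth_atlas M" and f: "smooth_at M euclid f p" and g: "smooth_at M euclid g p"
  shows "smooth_at M euclid (\<lambda>q. (f q, g q)) p"
proof -
  obtain c where c: "c \<in> atlas M" "p \<in> fst c" using charts_at_nonempty[OF M] smooth_at_mem[OF f] by metis
  obtain X where X: "open X" "snd c p \<in> X" "X \<subseteq> chart_image c" "smooth_on (\<lambda>x. f (chart_inv c x)) X"
    using smooth_at_euclid_chartD[OF M f c] by blast
  obtain Y where Y: "open Y" "snd c p \<in> Y" "Y \<subseteq> chart_image c" "smooth_on (\<lambda>x. g (chart_inv c x)) Y"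
    using smooth_at_euclid_chartD[OF M g c] by blast
  show ?thesis
    by (rule smooth_at_euclid_chartI[OF M c, of "X \<inter> Y"])
      (use X Y in \<open>auto intro!: smooth_on_Pair intro: smooth_on_subset\<close>)
qed

context
  fixes M :: "('a, 'e::euclidean_space) manifold" and p :: 'a
  assumes M: "smooth_atlas M"
begin

lemma smooth_at_linear:
  "bounded_linear L \<Longrightarrow> smooth_at M euclid f p \<Longrightarrow> smooth_at M euclid (\<lambda>q. L (f q)) p"
  by (rule smooth_at_compose_euclid[OF M _ smooth_on_linear[OF open_UNIV]]) auto

lemma smooth_at_bilinear:
  assumes B: "bounded_bilinear B" and f: "smooth_at M euclid f p" and g: "smooth_at M euclid g p"
  shows "smooth_at M euclid (\<lambda>q. B (f q) (g q)) p"
proof -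
  have "smooth_on (\<lambda>z. B (fst z) (snd z)) UNIV"
    unfolding smooth_on_def
    by (intro allI Ck_on_bilinear[OF _ B] Ck_on_linear open_UNIV bounded_linear_fst bounded_linear_snd)
  then show ?thesis
    using smooth_at_compose_euclid[OF M smooth_at_euclid_Pair[OF M f g]] by force
qed

lemma smooth_at_add:
  assumes "smooth_at M euclid f p" and "smooth_at M euclid g p"
  shows "smooth_at M euclid (\<lambda>q. f q + g q) p"
  using smooth_at_linear[OF bounded_linear_add[OF bounded_linear_fst bounded_linear_snd]
      smooth_at_euclid_Pair[OF M assms]] by simp

lemma smooth_at_diff:
  assumes "smooth_at M euclid f p" and "smooth_at M euclid g p"
  shows "smooth_at M euclid (\<lambda>q. f q - g q) p"
  using smooth_at_linear[OF bounded_linear_sub[OF bounded_linear_fst bounded_linear_snd]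
      smooth_at_euclid_Pair[OF M assms]] by simp

lemmas smooth_at_scaleR = smooth_at_bilinear[OF bounded_bilinear_scaleR]
lemmas smooth_at_mult = smooth_at_bilinear[OF bounded_bilinear_mult]

lemma smooth_at_sum:
  assumes "p \<in> mpoints M" "\<And>i. i \<in> I \<Longrightarrow> smooth_at M euclid (f i) p"
  shows "smooth_at M euclid (\<lambda>q. \<Sum>i\<in>I. f i q) p"
  using assms(2)
  by (induction I rule: infinite_finite_induct)
    (auto intro: smooth_at_add smooth_at_const[OF M smooth_atlas_euclid assms(1)])

lemma smooth_at_divide:
  assumes "smooth_at M euclid f p" "smooth_at M euclid g p" "g p \<noteq> (0::real)"
  shows "smooth_at M euclid (\<lambda>q. f q / g q) p"
proof -
  have "smooth_at M euclid (\<lambda>q. inverse (g q)) p"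
    by (rule smooth_at_compose_euclid[OF M assms(2) smooth_on_inverse_real]) (use assms(3) in auto)
  from smooth_at_mult[OF assms(1) this] show ?thesis by (simp add: divide_inverse)
qed

end

subsection \<open>Products\<close>

lemma chart_image_prod: "chart_image (fst c \<times> fst d, map_prod (snd c) (snd d)) = chart_image c \<times> chart_image d"
  by (auto simp: chart_image_def)

lemma chart_inv_prod:
  assumes M: "smooth_atlas M" and N: "smooth_atlas N" and c: "c \<in> atlas M" and d: "d \<in> atlas N"
    and "x \<in> chart_image c" "y \<in> chart_image d"
  shows "chart_inv (fst c \<times> fst d, map_prod (snd c) (snd d)) (x, y) = (chart_inv c x, chart_inv d y)"
proof -
  have "inj_on (map_prod (snd c) (snd d)) (fst c \<times> fst d)"
    using inj_on_chart[OF M c] inj_on_chart[OF N d] by (auto intro: map_prod_inj_on)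
  moreover have "map_prod (snd c) (snd d) (chart_inv c x, chart_inv d y) = (x, y)"
    using assms by simp
  ultimately show ?thesis
    using assms unfolding chart_inv_def[of "(_, _)"]
    by (intro inv_into_f_eq) (auto simp: chart_inv_in)
qed

lemma smooth_atlas_prod:
  assumes M: "smooth_atlas M" and N: "smooth_atlas N"
  shows "smooth_atlas (prod_manifold M N)"
proof -
  let ?ch = "\<lambda>c d. (fst c \<times> fst d, map_prod (snd c) (snd d))"
  let ?P = "prod_manifold M N"
  have top: "mtop ?P = prod_topology (mtop M) (mtop N)"
    and atl: "atlas ?P = {?ch c d | c d. c \<in> atlas M \<and> d \<in> atlas N}"
    by (simp_all add: prod_manifold_def)
  have "(\<Union>c\<in>atlas M. fst c) = mpoints M" "(\<Union>c\<in>atlas N. fst c) = mpoints N"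
    using M N by (auto simp: smooth_atlas_def)
  moreover have "(\<Union>c\<in>atlas ?P. fst c) = (\<Union>c\<in>atlas M. fst c) \<times> (\<Union>c\<in>atlas N. fst c)"
  proof (intro subset_antisym subsetI)
    fix z assume "z \<in> (\<Union>c\<in>atlas ?P. fst c)"
    then obtain c d where "c \<in> atlas M" "d \<in> atlas N" "z \<in> fst c \<times> fst d" unfolding atl by force
    then show "z \<in> (\<Union>c\<in>atlas M. fst c) \<times> (\<Union>c\<in>atlas N. fst c)" by (cases z) blast
  next
    fix z assume "z \<in> (\<Union>c\<in>atlas M. fst c) \<times> (\<Union>c\<in>atlas N. fst c)"
    then obtain c d where cd: "c \<in> atlas M" "d \<in> atlas N" "z \<in> fst c \<times> fst d" by (cases z) blast
    then have "?ch c d \<in> atlas ?P" unfolding atl by blast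
    with cd(3) show "z \<in> (\<Union>c\<in>atlas ?P. fst c)" by (metis UN_I fst_conv)
  qed
  ultimately have cover: "(\<Union>c\<in>atlas ?P. fst c) = mpoints ?P"
    unfolding top by simp
  have charts: "openin (mtop ?P) (fst e) \<and> open (chart_image e) \<and>
        homeomorphic_map (subtopology (mtop ?P) (fst e)) (top_of_set (chart_image e)) (snd e)"
    if "e \<in> atlas ?P" for e
  proof -
    obtain c d where e: "e = ?ch c d" and c: "c \<in> atlas M" and d: "d \<in> atlas N"
      using \<open>e \<in> atlas ?P\<close> atl by auto
    obtain f' g' where "homeomorphic_maps (subtopology (mtop M) (fst c)) (top_of_set (chart_image c)) (snd c) f'"
      "homeomorphic_maps (subtopology (mtop N) (fst d)) (top_of_set (chart_image d)) (snd d) g'"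
      using chart_homeo[OF M c] chart_homeo[OF N d] homeomorphic_map_maps by metis
    then have "homeomorphic_maps (prod_topology (subtopology (mtop M) (fst c)) (subtopology (mtop N) (fst d)))
       (prod_topology (top_of_set (chart_image c)) (top_of_set (chart_image d)))
       (\<lambda>(x, y). (snd c x, snd d y)) (\<lambda>(x, y). (f' x, g' y))"
      using homeomorphic_maps_prod by blast
    then have "homeomorphic_map (prod_topology (subtopology (mtop M) (fst c)) (subtopology (mtop N) (fst d)))
       (prod_topology (top_of_set (chart_image c)) (top_of_set (chart_image d))) (map_prod (snd c) (snd d))"
      using homeomorphic_map_maps unfolding map_prod_def by blast
    then show ?thesis
      using chart_openin[OF M c] chart_openin[OF N d] open_chart_image[OF M c] open_chart_image[OF N d]
      unfolding e chart_image_prod top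
      by (simp add: openin_prod_Times_iff open_Times subtopology_Times)
  qed
  have trans: "smooth_on (snd e' \<circ> chart_inv e) (snd e ` (fst e \<inter> fst e'))"
    if e: "e \<in> atlas ?P" and e': "e' \<in> atlas ?P" for e e'
  proof -
    obtain c d where e: "e = ?ch c d" and c: "c \<in> atlas M" and d: "d \<in> atlas N"
      using \<open>e \<in> atlas ?P\<close> atl by auto
    obtain c' d' where e': "e' = ?ch c' d'" and c': "c' \<in> atlas M" and d': "d' \<in> atlas N"
      using \<open>e' \<in> atlas ?P\<close> atl by auto
    let ?S = "snd c ` (fst c \<inter> fst c')" and ?T = "snd d ` (fst d \<inter> fst d')"
    have S: "snd e ` (fst e \<inter> fst e') = ?S \<times> ?T"
      unfolding e e' by (auto simp: image_iff)
    have oS: "open ?S" "open ?T" using open_transition[OF M c c'] open_transition[OF N d d'] .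
    have o: "open (?S \<times> ?T)" using oS by (simp add: open_Times)
    have 1: "smooth_on (\<lambda>z. snd c' (chart_inv c (fst z))) (?S \<times> ?T)"
      by (rule smooth_on_compose[OF o oS(1) _ smooth_on_linear[OF o bounded_linear_fst] smooth_transition[OF M c c']]) auto
    have 2: "smooth_on (\<lambda>z. snd d' (chart_inv d (snd z))) (?S \<times> ?T)"
      by (rule smooth_on_compose[OF o oS(2) _ smooth_on_linear[OF o bounded_linear_snd] smooth_transition[OF N d d']]) auto
    show ?thesis
      unfolding S
    proof (rule smooth_on_cong[OF o _ smooth_on_Pair[OF o 1 2]])
      fix z assume "z \<in> ?S \<times> ?T"
      then have "fst z \<in> chart_image c" "snd z \<in> chart_image d"
        by (auto simp: chart_image_def)
      then show "(snd c' (chart_inv c (fst z)), snd d' (chart_inv d (snd z))) = (snd e' \<circ> chart_inv e) z"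
        using chart_inv_prod[OF M N c d] unfolding e e' by (cases z) simp
    qed
  qed
  show ?thesis unfolding smooth_atlas_def using cover charts trans by blast
qed

lemma mpoints_prod [simp]: "mpoints (prod_manifold M N) = mpoints M \<times> mpoints N"
  by (simp add: prod_manifold_def)

lemma prod_chart_atlas:
  "c \<in> atlas M \<Longrightarrow> d \<in> atlas N \<Longrightarrow> (fst c \<times> fst d, map_prod (snd c) (snd d)) \<in> atlas (prod_manifold M N)"
  unfolding prod_manifold_def by (simp del: split_paired_Ex) blast

lemma smooth_at_Pair:
  assumes M: "smooth_atlas M" and N: "smooth_atlas N" and P: "smooth_atlas P"
    and f: "smooth_at M N f p" and g: "smooth_at M P g p"
  shows "smooth_at M (prod_manifold N P) (\<lambda>q. (f q, g q)) p"
proof -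
  obtain c d where c: "c \<in> atlas M" "p \<in> fst c" and d: "d \<in> atlas N" "f p \<in> fst d"
    using smooth_at_charts[OF M N f] .
  obtain e where e: "e \<in> atlas P" "g p \<in> fst e" using charts_at_nonempty[OF P] smooth_at_mem[OF g] by metis
  obtain X where X: "open X" "snd c p \<in> X" "X \<subseteq> chart_image c"
    "\<And>x. x \<in> X \<Longrightarrow> f (chart_inv c x) \<in> fst d" "smooth_on (\<lambda>x. snd d (f (chart_inv c x))) X"
    using smooth_atD[OF M N f c d] by blast
  obtain Y where Y: "open Y" "snd c p \<in> Y" "Y \<subseteq> chart_image c"
    "\<And>x. x \<in> Y \<Longrightarrow> g (chart_inv c x) \<in> fst e" "smooth_on (\<lambda>x. snd e (g (chart_inv c x))) Y"
    using smooth_atD[OF M P g c e] by blast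
  show ?thesis
    by (rule smooth_atI[OF M smooth_atlas_prod[OF N P] c prod_chart_atlas[OF d(1) e(1)], of "X \<inter> Y"])
      (use X Y in \<open>auto intro!: smooth_on_Pair intro: smooth_on_subset\<close>)
qed

lemma smooth_at_fst_snd:
  assumes M: "smooth_atlas M" and N: "smooth_atlas N" and z: "z \<in> mpoints M \<times> mpoints N"
  shows "smooth_at (prod_manifold M N) M fst z" "smooth_at (prod_manifold M N) N snd z"
proof -
  obtain c where c: "c \<in> atlas M" "fst z \<in> fst c" using charts_at_nonempty[OF M] z by (metis mem_Times_iff)
  obtain d where d: "d \<in> atlas N" "snd z \<in> fst d" using charts_at_nonempty[OF N] z by (metis mem_Times_iff)
  let ?e = "(fst c \<times> fst d, map_prod (snd c) (snd d))"
  let ?X = "chart_image c \<times> chart_image d"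
  have o: "open ?X" using open_chart_image[OF M c(1)] open_chart_image[OF N d(1)] by (rule open_Times)
  have inv: "chart_inv ?e (x, y) = (chart_inv c x, chart_inv d y)" if "(x, y) \<in> ?X" for x y
    using that chart_inv_prod[OF M N c(1) d(1)] by auto
  have zX: "snd ?e z \<in> ?X" using c d by (cases z) (auto simp: chart_in)
  have ze: "z \<in> fst ?e" using c d by (cases z) auto
  have sub: "?X \<subseteq> chart_image ?e" by (simp add: chart_image_prod)
  note P = smooth_atlas_prod[OF M N] and e = prod_chart_atlas[OF c(1) d(1)]
  show "smooth_at (prod_manifold M N) M fst z"
  proof (rule smooth_atI[OF P M e ze c(1) o zX sub])
    show "fst (chart_inv ?e x) \<in> fst c" if "x \<in> ?X" for x
      using that inv by (cases x) (auto simp: chart_inv_in)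
    show "smooth_on (\<lambda>x. snd c (fst (chart_inv ?e x))) ?X"
      by (rule smooth_on_cong[OF o _ smooth_on_linear[OF o bounded_linear_fst]]) (use inv in auto)
  qed
  show "smooth_at (prod_manifold M N) N snd z"
  proof (rule smooth_atI[OF P N e ze d(1) o zX sub])
    show "snd (chart_inv ?e x) \<in> fst d" if "x \<in> ?X" for x
      using that inv by (cases x) (auto simp: chart_inv_in)
    show "smooth_on (\<lambda>x. snd d (snd (chart_inv ?e x))) ?X"
      by (rule smooth_on_cong[OF o _ smooth_on_linear[OF o bounded_linear_snd]]) (use inv in auto)
  qed
qed

subsection \<open>Bump functions on manifolds\<close>

text \<open>The two sets are recorded with the function: a construction cut off by \<open>h\<close>
  acts in full on \<open>V\<close> and is trivial off \<open>K\<close>, and that region is open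
  because \<open>K\<close> is closed.\<close>

definition bump_at ::
  "('a, 'e::euclidean_space) manifold \<Rightarrow> 'a set \<Rightarrow> 'a \<Rightarrow> ('a \<Rightarrow> real) \<Rightarrow> 'a set \<Rightarrow> 'a set \<Rightarrow> bool" where
  "bump_at M U p h K V \<longleftrightarrow> closedin (mtop M) K \<and> K \<subseteq> U \<and> openin (mtop M) V \<and> p \<in> V \<and> V \<subseteq> K \<and>
    (\<forall>q\<in>mpoints M. smooth_at M euclid h q) \<and> (\<forall>q. 0 \<le> h q) \<and> (\<forall>q\<in>V. h q = 1) \<and> (\<forall>q. q \<notin> K \<longrightarrow> h q = 0)"

text \<open>A Euclidean bump is pulled back by a chart and extended by zero. The pullback lives on
  the compact set \<open>K\<close>, which is closed in \<open>M\<close> by the Hausdorff property;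
  so the chart domain and the complement of \<open>K\<close> are open sets covering
  \<open>M\<close>, and on each of them smoothness is clear.\<close>

lemma manifold_bump:
  assumes M: "smooth_atlas M" and H: "Hausdorff_space (mtop M)"
    and U: "openin (mtop M) U" "p \<in> U"
  obtains \<phi> K V where "bump_at M U p \<phi> K V"
proof -
  obtain c where c: "c \<in> atlas M" "p \<in> fst c"
    using charts_at_nonempty[OF M, of p] openin_subset[OF U(1)] U(2) by blast
  have o: "open (snd c ` (fst c \<inter> U))" by (rule open_chart_img[OF M c(1) U(1)])
  obtain R where R: "R > 0" "cball (snd c p) R \<subseteq> snd c ` (fst c \<inter> U)"
    using o c U open_contains_cball by blast
  define r where "r = R / 2"
  have r: "r > 0" "cball (snd c p) (2 * r) \<subseteq> snd c ` (fst c \<inter> U)" using R by (auto simp: r_def)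
  then have img: "cball (snd c p) (2 * r) \<subseteq> chart_image c" by (auto simp: chart_image_def)
  obtain h :: "_ \<Rightarrow> real" where h: "smooth_on h UNIV" "\<And>x. 0 \<le> h x"
    "\<And>x. x \<in> ball (snd c p) r \<Longrightarrow> h x = 1" "\<And>x. x \<notin> cball (snd c p) (2 * r) \<Longrightarrow> h x = 0"
    using smooth_bump[OF r(1)] by blast
  define \<phi> where "\<phi> q = (if q \<in> fst c then h (snd c q) else 0)" for q
  define K where "K = chart_inv c ` cball (snd c p) (2 * r)"
  define V where "V = {q \<in> fst c. snd c q \<in> ball (snd c p) r}"
  have "compactin (top_of_set (chart_image c)) (cball (snd c p) (2 * r))"
    using img by (simp add: compactin_subtopology)
  then have "compactin (mtop M) K"
    unfolding K_def by (rule image_compactin[OF _ continuous_on_chart_inv[OF M c(1)]])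
  then have K: "closedin (mtop M) K" by (rule compactin_imp_closedin[OF H])
  have Kiff: "q \<in> K \<longleftrightarrow> q \<in> fst c \<and> snd c q \<in> cball (snd c p) (2 * r)" for q
  proof
    assume "q \<in> K"
    then obtain x where x: "q = chart_inv c x" "x \<in> cball (snd c p) (2 * r)" unfolding K_def by blast
    then have "x \<in> chart_image c" using img by blast
    then show "q \<in> fst c \<and> snd c q \<in> cball (snd c p) (2 * r)" using x chart_inv_in[of x c] by simp
  next
    assume "q \<in> fst c \<and> snd c q \<in> cball (snd c p) (2 * r)"
    then show "q \<in> K" using chart_inv_chart[OF M c(1), of q] unfolding K_def by (metis image_eqI)
  qed
  have zero: "\<phi> q = 0" if "q \<notin> K" for q
    using that h(4) by (auto simp: \<phi>_def Kiff)
  have smooth: "smooth_at M euclid \<phi> q" if q: "q \<in> mpoints M" for q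
  proof (cases "q \<in> fst c")
    case True
    have "smooth_at M euclid (\<lambda>q. h (snd c q)) q"
      by (rule smooth_at_compose_euclid[OF M smooth_at_chart[OF M c(1) True] h(1)]) auto
    then show ?thesis
      by (rule smooth_at_cong[OF M smooth_atlas_euclid _ chart_openin[OF M c(1)] True]) (simp add: \<phi>_def)
  next
    case False
    have "smooth_at M euclid (\<lambda>q. 0::real) q"
      by (rule smooth_at_const[OF M smooth_atlas_euclid q]) auto
    moreover have "openin (mtop M) (mpoints M - K)" using K by blast
    ultimately show ?thesis
      by (rule smooth_at_cong[OF M smooth_atlas_euclid]) (use q False zero Kiff in auto)
  qed
  show thesis
  proof (rule that[of \<phi> K V], unfold bump_at_def, intro conjI ballI allI impI K smooth zero)
    show "K \<subseteq> U"
    proof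
      fix q assume q: "q \<in> K"
      then have "snd c q \<in> snd c ` (fst c \<inter> U)" using r(2) Kiff by blast
      then show "q \<in> U" using inj_on_chart[OF M c(1)] q Kiff by (auto dest: inj_onD)
    qed
    show "openin (mtop M) V" unfolding V_def by (rule openin_chart_preimage[OF M c(1)]) auto
    show "p \<in> V" using c r by (simp add: V_def)
    show "V \<subseteq> K" using r(1) by (auto simp: V_def Kiff)
    show "0 \<le> \<phi> q" for q by (simp add: \<phi>_def h)
    show "\<phi> q = 1" if "q \<in> V" for q using that h(3) by (auto simp: V_def \<phi>_def)
  qed
qed

section \<open>Derivatives in charts and submersions\<close>

abbreviation chart_deriv ::
  "('a, 'e::euclidean_space) chart \<Rightarrow> ('b, 'f::euclidean_space) chart \<Rightarrow> ('a \<Rightarrow> 'b) \<Rightarrow> 'a \<Rightarrow> 'e \<Rightarrow> 'f" where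
  "chart_deriv c d f p \<equiv> frechet_derivative (map_in_charts c d f) (at (snd c p))"

lemma smooth_at_has_derivative:
  assumes "smooth_atlas M" "smooth_atlas N" "smooth_at M N f p" "c \<in> charts_at M p" "d \<in> charts_at N (f p)"
  shows "(map_in_charts c d f has_derivative chart_deriv c d f p) (at (snd c p))"
proof -
  have c: "c \<in> atlas M" "p \<in> fst c" and d: "d \<in> atlas N" "f p \<in> fst d"
    using assms(4,5) by (auto simp: charts_at_iff)
  obtain X where X: "snd c p \<in> X" "smooth_on (\<lambda>x. snd d (f (chart_inv c x))) X"
    using smooth_atD[OF assms(1-3) c d] by metis
  show ?thesis
    using smooth_on_has_derivative[OF X(2,1)] unfolding map_in_charts_def comp_def .
qed

text \<open>With one map the identity this also governs changes of charts, since
  \<open>coord_change_deriv\<close> is the coordinate derivative of the identity.\<close>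

lemma map_in_charts_chain:
  assumes M: "smooth_atlas M" and N: "smooth_atlas N" and P: "smooth_atlas P"
    and f: "smooth_at M N f p" and g: "smooth_at N P g (f p)"
    and c: "c \<in> charts_at M p" and d: "d \<in> charts_at N (f p)" and e: "e \<in> charts_at P (g (f p))"
  shows "chart_deriv c e (\<lambda>q. g (f q)) p v = chart_deriv d e g (f p) (chart_deriv c d f p v)"
proof -
  let ?f = "map_in_charts c d f" and ?g = "map_in_charts d e g" and ?x = "snd c p"
  have c': "c \<in> atlas M" "p \<in> fst c" and d': "d \<in> atlas N" "f p \<in> fst d"
    using c d by (auto simp: charts_at_iff)
  have fx: "?f ?x = snd d (f p)"
    using chart_inv_chart[OF M c'] by (simp add: map_in_charts_def)
  have "(?g has_derivative frechet_derivative ?g (at (?f ?x))) (at (?f ?x))"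
    using smooth_at_has_derivative[OF N P g d e] unfolding fx .
  from has_derivative_compose[OF smooth_at_has_derivative[OF M N f c d] this]
  have "((\<lambda>x. ?g (?f x)) has_derivative (\<lambda>v. frechet_derivative ?g (at (snd d (f p))) (frechet_derivative ?f (at ?x) v))) (at ?x)"
    unfolding fx .
  note der = this
  obtain X where X: "open X" "?x \<in> X" "\<And>x. x \<in> X \<Longrightarrow> f (chart_inv c x) \<in> fst d"
    using smooth_atD[OF M N f c' d'] by metis
  have "(map_in_charts c e (\<lambda>q. g (f q)) has_derivative
      (\<lambda>v. frechet_derivative ?g (at (snd d (f p))) (frechet_derivative ?f (at ?x) v))) (at ?x)"
    by (rule has_derivative_transform_within_open[OF der X(1,2)])
      (simp add: map_in_charts_def chart_inv_chart[OF N d'(1)] X(3))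
  from frechet_derivative_at[OF this] show ?thesis by (rule fun_cong[symmetric])
qed

lemma map_in_charts_ident: "map_in_charts c d (\<lambda>q. q) = snd d \<circ> chart_inv c"
  by (auto simp: map_in_charts_def)

lemma coord_change_deriv_eq:
  "coord_change_deriv c d p = chart_deriv c d (\<lambda>q. q) p"
  by (simp add: map_in_charts_ident coord_change_deriv_def)

section \<open>Tangent vectors in coordinates\<close>

context
  fixes M :: "('a, 'e::euclidean_space) manifold" and p
  assumes M: "smooth_atlas M" and p: "p \<in> mpoints M"
begin

lemma coord_change_deriv_self:
  assumes c: "c \<in> charts_at M p"
  shows "coord_change_deriv c c p = (\<lambda>v. v)"
proof -
  have c': "c \<in> atlas M" "p \<in> fst c" using c by (auto simp: charts_at_iff)
  have "((\<lambda>x. x) has_derivative (\<lambda>v. v)) (at (snd c p))" by simp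
  then have "(map_in_charts c c (\<lambda>q. q) has_derivative (\<lambda>v. v)) (at (snd c p))"
    by (rule has_derivative_transform_within_open[OF _ open_chart_image[OF M c'(1)] chart_in[OF c'(2)]])
      (simp add: map_in_charts_ident)
  then show ?thesis unfolding coord_change_deriv_eq by (metis frechet_derivative_at)
qed

lemma coord_change_deriv_trans:
  assumes "c \<in> charts_at M p" "d \<in> charts_at M p" "e \<in> charts_at M p"
  shows "coord_change_deriv c e p v = coord_change_deriv d e p (coord_change_deriv c d p v)"
  unfolding coord_change_deriv_eq
  using map_in_charts_chain[OF M M M, of "\<lambda>q. q" p "\<lambda>q. q"] assms smooth_at_ident[OF M p] by blast

lemma linear_coord_change_deriv:
  assumes "c \<in> charts_at M p" "d \<in> charts_at M p"
  shows "linear (coord_change_deriv c d p)"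
  unfolding coord_change_deriv_eq
  using smooth_at_has_derivative[OF M M smooth_at_ident[OF M p] assms] has_derivative_linear by blast

lemma tangent_of_coords_in:
  assumes "c \<in> charts_at M p"
  shows "tangent_of_coords M c p w \<in> tangent_space M p"
  unfolding tangent_space_def tangent_of_coords_def
  by (simp add: coord_change_deriv_trans[OF assms, symmetric])

lemma tangent_of_coords_self:
  assumes "c \<in> charts_at M p"
  shows "tangent_of_coords M c p w c = w"
  using assms coord_change_deriv_self[OF assms] by (simp add: tangent_of_coords_def)

lemma tangent_of_coords_eq:
  assumes "c \<in> charts_at M p" "v \<in> tangent_space M p"
  shows "tangent_of_coords M c p (v c) = v"
proof
  fix d
  have "v d = coord_change_deriv c d p (v c)" if "d \<in> charts_at M p"
    using assms that unfolding tangent_space_def by blast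
  moreover have "v d = 0" if "d \<notin> charts_at M p"
    using assms that unfolding tangent_space_def by blast
  ultimately show "tangent_of_coords M c p (v c) d = v d"
    unfolding tangent_of_coords_def by presburger
qed

lemma tangent_of_coords_change:
  assumes "c \<in> charts_at M p" "d \<in> charts_at M p"
  shows "tangent_of_coords M d p (coord_change_deriv c d p w) = tangent_of_coords M c p w"
  unfolding tangent_of_coords_def by (intro ext) (simp add: coord_change_deriv_trans[OF assms, symmetric])

lemma tangent_of_coords_linear:
  assumes "c \<in> charts_at M p"
  shows "tangent_of_coords M c p (a *\<^sub>R u + b *\<^sub>R w) =
    (\<lambda>d. a *\<^sub>R tangent_of_coords M c p u d + b *\<^sub>R tangent_of_coords M c p w d)"
  unfolding tangent_of_coords_def
  by (intro ext) (simp add: linear_add[OF linear_coord_change_deriv[OF assms]]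
      linear_scale[OF linear_coord_change_deriv[OF assms]])

end

text \<open>Surjectivity is demanded of coordinate derivatives, where Euclidean linear algebra is at
  hand; \<open>submersionI\<close> translates it into tangent spaces.\<close>

definition regular_at ::
  "('a, 'e::euclidean_space) manifold \<Rightarrow> ('b, 'f::euclidean_space) manifold \<Rightarrow> ('a \<Rightarrow> 'b) \<Rightarrow> 'a \<Rightarrow> bool"
  where "regular_at M N f p \<longleftrightarrow> smooth_at M N f p \<and>
    (\<forall>c\<in>charts_at M p. \<forall>d\<in>charts_at N (f p). surj (chart_deriv c d f p))"

text \<open>Other charts alter the derivative by coordinate changes on both sides, and these are
  invertible.\<close>

lemma regular_atI:
  assumes M: "smooth_atlas M" and N: "smooth_atlas N" and f: "smooth_at M N f p"
    and c: "c \<in> charts_at M p" and d: "d \<in> charts_at N (f p)"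
    and surj: "surj (chart_deriv c d f p)"
  shows "regular_at M N f p"
  unfolding regular_at_def
proof (intro conjI ballI f)
  fix c' d' assume c': "c' \<in> charts_at M p" and d': "d' \<in> charts_at N (f p)"
  have p: "p \<in> mpoints M" "f p \<in> mpoints N" using smooth_at_mem[OF f] by auto
  note idM = smooth_at_ident[OF M p(1)] and idN = smooth_at_ident[OF N p(2)]
  show "surj (chart_deriv c' d' f p)"
    unfolding surj_def
  proof
    fix u
    define u' where "u' = coord_change_deriv d' d (f p) u"
    obtain w where w: "chart_deriv c d f p w = u'"
      using surj by (metis surjD)
    have "chart_deriv c' d' f p (coord_change_deriv c c' p w) =
        chart_deriv c d' f p w"
      using map_in_charts_chain[OF M M N idM f c c' d', of w] by (simp add: coord_change_deriv_eq)
    also have "\<dots> = coord_change_deriv d d' (f p) u'"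
      using map_in_charts_chain[OF M N N f idN c d d', of w] w by (simp add: coord_change_deriv_eq)
    also have "\<dots> = u"
      unfolding u'_def using coord_change_deriv_trans[OF N p(2) d' d d', of u] coord_change_deriv_self[OF N p(2) d']
      by simp
    finally show "\<exists>w. u = chart_deriv c' d' f p w"
      by metis
  qed
qed

lemma submersionI:
  assumes M: "smooth_atlas M" and N: "smooth_atlas N" and f: "\<And>p. p \<in> mpoints M \<Longrightarrow> regular_at M N f p"
  shows "submersion M N f"
  unfolding submersion_def
proof (intro conjI ballI)
  show "smooth_map M N f"
    using f by (intro smooth_map_onI[OF M N]) (auto simp: regular_at_def)
next
  fix p assume pM: "p \<in> mpoints M"
  have sf: "smooth_at M N f p" using f[OF pM] by (simp add: regular_at_def)
  have pN: "f p \<in> mpoints N" using smooth_at_mem[OF sf] by simp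
  note idN = smooth_at_ident[OF N pN]
  \<comment> \<open>This is literally the chart that \<open>differential\<close> chooses, so no
    independence of the choice has to be shown.\<close>
  define c where "c = (SOME c. c \<in> charts_at M p)"
  have c: "c \<in> charts_at M p"
    unfolding c_def using charts_at_nonempty[OF M pM] by (metis someI_ex)
  have diff: "differential M N f p v = (\<lambda>d. if d \<in> charts_at N (f p)
      then chart_deriv c d f p (v c) else 0)" for v
    unfolding differential_def c_def Let_def by (rule refl)
  have chain: "chart_deriv c d' f p w =
      coord_change_deriv d d' (f p) (chart_deriv c d f p w)"
    if "d \<in> charts_at N (f p)" "d' \<in> charts_at N (f p)" for d d' w
    using map_in_charts_chain[OF M N N sf idN c that, of w] by (simp add: coord_change_deriv_eq)
  show "differential M N f p ` tangent_space M p = tangent_space N (f p)"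
  proof (intro subset_antisym subsetI)
    fix u assume "u \<in> differential M N f p ` tangent_space M p"
    then show "u \<in> tangent_space N (f p)"
    proof -
      obtain v where v: "u = differential M N f p v"
        using \<open>u \<in> differential M N f p ` tangent_space M p\<close> by blast
      show ?thesis
        unfolding tangent_space_def
      proof (rule CollectI, intro conjI ballI allI impI)
        show "u d' = coord_change_deriv d d' (f p) (u d)"
          if "d \<in> charts_at N (f p)" "d' \<in> charts_at N (f p)" for d d'
          using chain[OF that, of "v c"] that by (simp add: v diff)
        show "u d = 0" if "d \<notin> charts_at N (f p)" for d
          using that by (simp add: v diff)
      qed
    qed
  next
    fix u assume u: "u \<in> tangent_space N (f p)"
    obtain d where d: "d \<in> charts_at N (f p)" using charts_at_nonempty[OF N pN] by metis
    have "surj (chart_deriv c d f p)"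
      using f[OF pM] c d by (simp add: regular_at_def)
    then obtain w where w: "chart_deriv c d f p w = u d"
      by (metis surjD)
    have "differential M N f p (tangent_of_coords M c p w) d' = u d'" for d'
    proof (cases "d' \<in> charts_at N (f p)")
      case True
      have "u d' = coord_change_deriv d d' (f p) (u d)"
        using u d True unfolding tangent_space_def by blast
      then show ?thesis
        using chain[OF d True, of w] w True by (simp add: diff tangent_of_coords_self[OF M pM c])
    next
      case False
      then have "u d' = 0" using u unfolding tangent_space_def by blast
      with False show ?thesis by (simp add: diff)
    qed
    then show "u \<in> differential M N f p ` tangent_space M p"
      using tangent_of_coords_in[OF M pM c] by (metis ext image_eqI)
  qed
qed

section \<open>Submersions of compact manifolds are locally trivial\<close>

lemma compactin_finite_cover:
  assumes "compactin X F" "\<And>q. q \<in> F \<Longrightarrow> openin X (A q) \<and> q \<in> A q"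
  obtains I where "finite I" "I \<subseteq> F" "F \<subseteq> (\<Union>q\<in>I. A q)"
proof -
  have "F \<subseteq> \<Union>(A ` F)" "\<forall>U\<in>A ` F. openin X U" using assms(2) by auto
  then obtain \<F> where "finite \<F>" "\<F> \<subseteq> A ` F" "F \<subseteq> \<Union>\<F>"
    using assms(1) unfolding compactin_def by meson
  moreover from this obtain I where "I \<subseteq> F" "finite I" "\<F> = A ` I"
    by (meson finite_subset_image)
  ultimately show thesis using that by blast
qed

lemma openin_smooth_preimage:
  assumes "openin (mtop M) W" "\<And>p. p \<in> W \<Longrightarrow> smooth_at M N f p" "openin (mtop N) T"
  shows "openin (mtop M) {p \<in> W. f p \<in> T}"
proof (subst openin_subopen, intro ballI)
  fix q assume "q \<in> {q \<in> W. f q \<in> T}"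
  then have q: "q \<in> W" "f q \<in> T" by auto
  obtain V where "openin (mtop M) V" "q \<in> V" "\<And>q. q \<in> V \<Longrightarrow> f q \<in> T"
    using smooth_at_continuous[OF assms(2)[OF q(1)] assms(3) q(2)] by blast
  then show "\<exists>V. openin (mtop M) V \<and> q \<in> V \<and> V \<subseteq> {q \<in> W. f q \<in> T}"
    using assms(1) q by (intro exI[of _ "V \<inter> W"]) auto
qed

lemma smooth_on_smooth_at:
  assumes "\<And>x. x \<in> S \<Longrightarrow> smooth_at euclid euclid f x"
  shows "smooth_on f S"
  using assms smooth_at_euclid_euclid smooth_on_local by metis

lemma smooth_on_imp_smooth_at:
  "open S \<Longrightarrow> smooth_on f S \<Longrightarrow> x \<in> S \<Longrightarrow> smooth_at euclid euclid f x"
  using smooth_at_euclid_euclid by blast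

text \<open>Adapted coordinates \<open>\<kappa>\<close>, with inverse \<open>\<kappa>i\<close>, in which a submersion becomes a linear map
  with a linear section \<open>S\<close>. This avoids splitting off a complement of the kernel, for which there
  is no type.\<close>

definition adapted_coords ::
  "('a, real^'n) manifold \<Rightarrow> ('a \<Rightarrow> 'b) \<Rightarrow> ('b, real^'k) chart \<Rightarrow> 'a set \<Rightarrow> (real^'n) set \<Rightarrow>
    ('a \<Rightarrow> real^'n) \<Rightarrow> (real^'n \<Rightarrow> 'a) \<Rightarrow> (real^'n \<Rightarrow> real^'k) \<Rightarrow> (real^'k \<Rightarrow> real^'n) \<Rightarrow> bool" where
  "adapted_coords M f d U Y \<kappa> \<kappa>i L S \<longleftrightarrow> openin (mtop M) U \<and> open Y \<and>
    (\<forall>q\<in>U. \<kappa> q \<in> Y \<and> \<kappa>i (\<kappa> q) = q \<and> smooth_at M euclid \<kappa> q \<and> f q \<in> fst d \<and> snd d (f q) = L (\<kappa> q)) \<and>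
    (\<forall>y\<in>Y. \<kappa>i y \<in> U \<and> \<kappa> (\<kappa>i y) = y \<and> smooth_at euclid M \<kappa>i y) \<and>
    bounded_linear L \<and> bounded_linear S \<and> (\<forall>v. L (S v) = v)"

lemma adapted_coordsD:
  assumes "adapted_coords M f d U Y \<kappa> \<kappa>i L S"
  shows "openin (mtop M) U" "open Y"
    "\<And>q. q \<in> U \<Longrightarrow> \<kappa> q \<in> Y \<and> \<kappa>i (\<kappa> q) = q \<and> smooth_at M euclid \<kappa> q \<and> f q \<in> fst d \<and> snd d (f q) = L (\<kappa> q)"
    "\<And>y. y \<in> Y \<Longrightarrow> \<kappa>i y \<in> U \<and> \<kappa> (\<kappa>i y) = y \<and> smooth_at euclid M \<kappa>i y"
    "bounded_linear L" "bounded_linear S" "\<And>v. L (S v) = v"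
  using assms unfolding adapted_coords_def by blast+

lemma straighten:
  fixes M :: "('a, real^'n) manifold" and N :: "('b, real^'k) manifold"
  assumes M: "smooth_atlas M" and N: "smooth_atlas N" and reg: "regular_at M N f p"
    and d: "d \<in> charts_at N (f p)"
  obtains U Y \<kappa> \<kappa>i L S where "adapted_coords M f d U Y \<kappa> \<kappa>i L S" "p \<in> U"
proof -
  have f: "smooth_at M N f p" using reg by (simp add: regular_at_def)
  obtain c where c: "c \<in> charts_at M p" "c \<in> atlas M" "p \<in> fst c"
    using charts_at_nonempty[OF M] smooth_at_mem[OF f] by metis
  have d': "d \<in> atlas N" "f p \<in> fst d" using d by (auto simp: charts_at_iff)
  obtain X where X: "open X" "snd c p \<in> X" "X \<subseteq> chart_image c"
    "\<And>x. x \<in> X \<Longrightarrow> f (chart_inv c x) \<in> fst d" "smooth_on (\<lambda>x. snd d (f (chart_inv c x))) X"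
    using smooth_atD[OF M N f c(2,3) d'] by blast
  define g where "g = map_in_charts c d f"
  define L where "L = frechet_derivative g (at (snd c p))"
  have gsm: "smooth_on g X" using X(5) by (simp add: g_def map_in_charts_def comp_def)
  have Lder: "(g has_derivative L) (at (snd c p))"
    unfolding L_def g_def by (rule smooth_at_has_derivative[OF M N f c(1) d])
  have linL: "linear L" using Lder has_derivative_linear by blast
  have "surj L" using reg c d by (simp add: regular_at_def L_def g_def)
  then obtain S where S: "linear S" "L \<circ> S = id"
    using linear_surjective_right_inverse[OF linL] by blast
  have LS: "L (S v) = v" for v using S(2) by (metis comp_apply id_apply)
  have blL: "bounded_linear L" and blS: "bounded_linear S"
    using linL S(1) by (simp_all add: linear_conv_bounded_linear)
  \<comment> \<open>The image of \<open>S\<close> receives the nonlinear value of \<open>g\<close>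
    in place of its linear part. As \<open>L\<close> undoes \<open>S\<close>, this gives
    \<open>L (\<Psi> x) = g x\<close>; and since \<open>g\<close> has derivative \<open>L\<close> at
    the point, \<open>\<Psi>\<close> has derivative the identity there and is a local coordinate
    change.\<close>
  define \<Psi> where "\<Psi> x = x - S (L x) + S (g x)" for x
  have \<Psi>: "smooth_on \<Psi> X"
    unfolding \<Psi>_def using X(1) gsm
    by (intro smooth_on_add smooth_on_diff smooth_on_id smooth_on_bounded_linear[OF _ blS] smooth_on_linear[OF _ blL])
  have "(\<Psi> has_derivative (\<lambda>w. w - S (L w) + S (L w))) (at (snd c p))"
    unfolding \<Psi>_def
    by (intro has_derivative_add has_derivative_diff has_derivative_ident
        bounded_linear.has_derivative[OF blS] bounded_linear.has_derivative[OF blL] Lder)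
  then have "frechet_derivative \<Psi> (at (snd c p)) = (\<lambda>w. w)"
    using frechet_derivative_at by fastforce
  then have inj: "inj (frechet_derivative \<Psi> (at (snd c p)))" by (simp add: inj_def)
  obtain X' Y h where X': "open X'" "snd c p \<in> X'" "X' \<subseteq> X" "open Y" "\<Psi> ` X' = Y" "h ` Y = X'"
    "\<And>x. x \<in> X' \<Longrightarrow> h (\<Psi> x) = x" "\<And>y. y \<in> Y \<Longrightarrow> \<Psi> (h y) = y" "smooth_on h Y"
    using smooth_inverse_function[OF X(1) \<Psi> X(2) inj] by metis
  have L\<Psi>: "L (\<Psi> x) = g x" for x
    using linL by (simp add: \<Psi>_def linear_add linear_diff LS)
  define U where "U = {q \<in> fst c. snd c q \<in> X'}"
  define \<kappa> where "\<kappa> q = \<Psi> (snd c q)" for q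
  define \<kappa>i where "\<kappa>i y = chart_inv c (h y)" for y
  have inv: "chart_inv c (snd c q) = q" if "q \<in> fst c" for q
    using chart_inv_chart[OF M c(2) that] .
  show thesis
  proof (rule that[of U Y \<kappa> \<kappa>i L S], unfold adapted_coords_def, intro conjI ballI allI)
    show "openin (mtop M) U" unfolding U_def by (rule openin_chart_preimage[OF M c(2) X'(1)])
    show "p \<in> U" using c X' by (simp add: U_def)
    fix q assume "q \<in> U"
    then have q: "q \<in> fst c" "snd c q \<in> X'" by (auto simp: U_def)
    show "\<kappa> q \<in> Y" "\<kappa>i (\<kappa> q) = q" using q X'(5,7) inv by (auto simp: \<kappa>_def \<kappa>i_def)
    show "f q \<in> fst d" using X(4)[of "snd c q"] q X'(3) inv by auto
    show "snd d (f q) = L (\<kappa> q)" using q inv by (simp add: \<kappa>_def L\<Psi> g_def map_in_charts_def)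
    show "smooth_at M euclid \<kappa> q"
      unfolding \<kappa>_def
      by (rule smooth_at_compose_euclid[OF M smooth_at_chart[OF M c(2) q(1)] \<Psi> X(1)]) (use q X' in auto)
  next
    fix y assume y: "y \<in> Y"
    have hy: "h y \<in> X'" "h y \<in> chart_image c" using y X'(3,6) X(3) by auto
    show "\<kappa>i y \<in> U" using hy chart_inv_in[OF hy(2)] by (simp add: U_def \<kappa>i_def)
    show "\<kappa> (\<kappa>i y) = y" using hy y X'(8) by (simp add: \<kappa>_def \<kappa>i_def)
    show "smooth_at euclid M \<kappa>i y"
      unfolding \<kappa>i_def
      by (rule smooth_at_compose[OF smooth_atlas_euclid smooth_atlas_euclid M])
        (use smooth_on_imp_smooth_at[OF X'(4,9) y] smooth_at_chart_inv[OF M c(2) hy(2)] in auto)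
  qed (use X' blL blS LS in auto)
qed

text \<open>The local state of affairs at a point \<open>q0\<close> of the fiber \<open>F\<close>:
  the pair \<open>(f, R)\<close> is injective on \<open>P\<close>, and \<open>g\<close> inverts it
  over \<open>T\<close> and the part of \<open>F\<close> in \<open>Q\<close>. The closed set
  \<open>K\<close> between \<open>Q\<close> and \<open>P\<close> serves the patching: the condition
  that \<open>R p\<close> avoids \<open>K\<close> is open.\<close>

definition trivialization_data ::
  "('a, real^'n) manifold \<Rightarrow> ('b, real^'k) manifold \<Rightarrow> ('a \<Rightarrow> 'b) \<Rightarrow> 'b \<Rightarrow> ('a \<Rightarrow> 'a) \<Rightarrow> 'a set \<Rightarrow> 'a set \<Rightarrow> 'a \<Rightarrow>
    'a set \<Rightarrow> 'a set \<Rightarrow> 'b set \<Rightarrow> 'a set \<Rightarrow> ('b \<times> 'a \<Rightarrow> 'a) \<Rightarrow> bool" where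
  "trivialization_data M N f b R W F q0 P K T Q g \<longleftrightarrow>
    openin (mtop M) P \<and> closedin (mtop M) K \<and> openin (mtop N) T \<and> b \<in> T \<and>
    openin (mtop M) Q \<and> q0 \<in> Q \<and> Q \<subseteq> K \<and> K \<subseteq> P \<and>
    (\<forall>p\<in>P. \<forall>p'\<in>P. f p = f p' \<longrightarrow> R p = R p' \<longrightarrow> p = p') \<and>
    (\<forall>z\<in>T. \<forall>q\<in>Q. smooth_at (prod_manifold N M) M g (z, q)) \<and>
    (\<forall>z\<in>T. \<forall>q\<in>Q \<inter> F. g (z, q) \<in> W \<and> f (g (z, q)) = z \<and> R (g (z, q)) = q)"

section \<open>The neighbourhood of a single fiber\<close>

context
  fixes M :: "('a, real^'n) manifold" and N :: "('b, real^'k) manifold" and f :: "'a \<Rightarrow> 'b" and b :: 'b and d F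
  assumes M: "smooth_atlas M" and N: "smooth_atlas N"
    and HM: "Hausdorff_space (mtop M)"
    and reg: "\<And>p. p \<in> mpoints M \<Longrightarrow> regular_at M N f p"
    and d: "d \<in> charts_at N b"
  defines "F \<equiv> {p \<in> mpoints M. f p = b}"
begin

lemma fiber_mem: "q \<in> F \<Longrightarrow> q \<in> mpoints M" "q \<in> F \<Longrightarrow> f q = b"
  by (auto simp: F_def)

lemma fiber_chart_eq: "f q \<in> fst d \<Longrightarrow> snd d (f q) = snd d z \<Longrightarrow> z \<in> fst d \<Longrightarrow> f q = z"
  using inj_on_chart[OF N, of d] d by (auto simp: charts_at_iff dest: inj_onD)

lemma fiber_adapted:
  assumes "q \<in> F"
  obtains U Y \<kappa> \<kappa>i L S where "adapted_coords M f d U Y \<kappa> \<kappa>i L S" "q \<in> U"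
  using straighten[OF M N reg] fiber_mem[OF assms] d by metis

text \<open>Near \<open>q\<close> the map moves along the section \<open>S\<close> onto the fiber; a bump function turns it into
  a map that is defined on a neighbourhood of the whole fiber.\<close>

lemma collapse:
  assumes q: "q \<in> F"
  shows "\<exists>W \<phi> A. openin (mtop M) W \<and> F \<subseteq> W \<and> openin (mtop M) A \<and> q \<in> A \<and> A \<subseteq> W \<and>
    (\<forall>p\<in>W. smooth_at M M \<phi> p) \<and> (\<forall>p\<in>F. \<phi> p = p) \<and> (\<forall>p\<in>A. \<phi> p \<in> F)"
proof -
  define v0 where "v0 = snd d b"
  have fq: "f q = b" and dN: "d \<in> atlas N" "b \<in> fst d" using fiber_mem[OF q] d by (auto simp: charts_at_iff)
  obtain U Y \<kappa> \<kappa>i L S where ac: "adapted_coords M f d U Y \<kappa> \<kappa>i L S" and qU: "q \<in> U"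
    by (rule fiber_adapted[OF q])
  note U = adapted_coordsD(1)[OF ac] qU adapted_coordsD(2)[OF ac]
    and \<kappa> = adapted_coordsD(3)[OF ac] and \<kappa>i = adapted_coordsD(4)[OF ac] and LS = adapted_coordsD(5-7)[OF ac]
  obtain h K V where "bump_at M U q h K V" using manifold_bump[OF M HM U(1,2)] by blast
  then have K: "closedin (mtop M) K" "K \<subseteq> U" "openin (mtop M) V" "q \<in> V" "V \<subseteq> K"
    and h: "\<And>q. q \<in> mpoints M \<Longrightarrow> smooth_at M euclid h q" "\<And>q. q \<in> V \<Longrightarrow> h q = 1" "\<And>q. q \<notin> K \<Longrightarrow> h q = 0"
    unfolding bump_at_def by blast+
  \<comment> \<open>The displacement \<open>S (L (\<kappa> p) - v0)\<close> is what separates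
    \<open>p\<close> from the level \<open>L = v0\<close> of the fiber. It vanishes on the fiber, so
    fiber points stay fixed; where the cutoff \<open>h\<close> is 1, removing it lands exactly on
    the level.\<close>
  define m where "m p = \<kappa> p - h p *\<^sub>R S (L (\<kappa> p) - v0)" for p
  define \<phi> where "\<phi> p = (if p \<in> U then \<kappa>i (m p) else p)" for p
  have UM: "U \<subseteq> mpoints M" using U(1) openin_subset by blast
  have m: "smooth_at M euclid m p" if "p \<in> U" for p
  proof -
    have "p \<in> mpoints M" using that UM by blast
    then show ?thesis
      unfolding m_def using \<kappa>[OF that] h(1)
      by (intro smooth_at_diff[OF M] smooth_at_scaleR[OF M] smooth_at_linear[OF M LS(2)] smooth_at_linear[OF M LS(1)]
          smooth_at_const[OF M smooth_atlas_euclid]) auto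
  qed
  define W1 where "W1 = {p \<in> U. m p \<in> Y}"
  have W1: "openin (mtop M) W1"
    unfolding W1_def using openin_smooth_preimage[OF U(1) m, of Y] U(3) by simp
  have \<phi>1: "smooth_at M M \<phi> p" if "p \<in> W1" for p
  proof -
    have p: "p \<in> U" "m p \<in> Y" using that by (auto simp: W1_def)
    have "smooth_at M M (\<lambda>p. \<kappa>i (m p)) p"
      using smooth_at_compose[OF M smooth_atlas_euclid M m[OF p(1)]] \<kappa>i[OF p(2)] by blast
    then show ?thesis
      by (rule smooth_at_cong[OF M M _ U(1) p(1)]) (simp add: \<phi>_def)
  qed
  have out: "\<phi> p = p" if "p \<notin> K" for p
    using that \<kappa>[of p] h(3) by (auto simp: \<phi>_def m_def)
  have \<phi>2: "smooth_at M M \<phi> p" if "p \<in> mpoints M - K" for p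
  proof -
    have "openin (mtop M) (mpoints M - K)" using K(1) by blast
    then show ?thesis
      using that out by (intro smooth_at_cong[OF M M smooth_at_ident[OF M]]) auto
  qed
  have m_fix: "m p = \<kappa> p" if "p \<in> U" "f p = b" for p
    using \<kappa>[OF that(1)] that(2) linear_0[OF bounded_linear.linear[OF LS(2)]] by (simp add: m_def v0_def)
  \<comment> \<open>Smoothness is known while \<open>m\<close> stays in the coordinate range
    \<open>Y\<close>, and off \<open>K\<close>, where the move is the identity. Both regions
    together contain the fiber, although \<open>U\<close> covers only part of it.\<close>
  let ?W = "W1 \<union> (mpoints M - K)" and ?A = "{p \<in> V. m p \<in> Y}"
  have r1: "openin (mtop M) ?W" using W1 K(1) by blast
  have r2: "F \<subseteq> ?W"
  proof
    fix p assume p: "p \<in> F"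
    show "p \<in> ?W"
    proof (cases "p \<in> U")
      case True
      then show ?thesis using m_fix \<kappa> fiber_mem p by (simp add: W1_def)
    next
      case False
      then show ?thesis using fiber_mem p K(2) by blast
    qed
  qed
  have A_eq: "?A = V \<inter> W1" using K by (auto simp: W1_def)
  then have r3: "openin (mtop M) ?A" using openin_Int[OF K(3) W1] by simp
  have r4: "q \<in> ?A" using K(4) m_fix[OF U(2) fq] \<kappa>[OF U(2)] by simp
  have r5: "?A \<subseteq> ?W" using A_eq by blast
  have r6: "smooth_at M M \<phi> p" if "p \<in> ?W" for p using that \<phi>1 \<phi>2 by blast
  have r7: "\<phi> p = p" if "p \<in> F" for p
    using that m_fix \<kappa> fiber_mem by (auto simp: \<phi>_def)
  have r8: "\<phi> p \<in> F" if p: "p \<in> ?A" for p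
  proof -
    have pU: "p \<in> U" "m p \<in> Y" "h p = 1" using p K h(2) by auto
    have L: "linear L" using LS(1) bounded_linear.linear by blast
    have eq: "\<phi> p = \<kappa>i (m p)" using pU by (simp add: \<phi>_def)
    have "\<phi> p \<in> U" "\<kappa> (\<phi> p) = m p" using \<kappa>i[OF pU(2)] eq by auto
    then have "f (\<phi> p) \<in> fst d" "snd d (f (\<phi> p)) = L (m p)" using \<kappa> by auto
    moreover have "L (m p) = snd d b"
      using pU(3) by (simp add: m_def linear_diff[OF L] LS(3) v0_def)
    ultimately have "f (\<phi> p) = b" using fiber_chart_eq dN(2) by simp
    then show ?thesis using \<open>\<phi> p \<in> U\<close> UM by (auto simp: F_def)
  qed
  show ?thesis
    by (intro exI[of _ ?W] exI[of _ \<phi>] exI[of _ ?A] conjI ballI r1 r2 r3 r4 r5 r6 r7 r8)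
qed

text \<open>Each local move collapses only its own open set \<open>A q\<close> and fixes all points
  of \<open>F\<close>. Composed one after another, later moves therefore never spoil what earlier
  ones have achieved; \<open>B\<close> in the induction collects the points already sent into
  \<open>F\<close>.\<close>

lemma smooth_retraction:
  assumes comp: "compactin (mtop M) F"
  obtains W R where "openin (mtop M) W" "F \<subseteq> W" "\<And>p. p \<in> W \<Longrightarrow> smooth_at M M R p"
    "\<And>p. p \<in> W \<Longrightarrow> R p \<in> F" "\<And>p. p \<in> F \<Longrightarrow> R p = p"
proof -
  obtain Wc \<phi> A where c: "\<And>q. q \<in> F \<Longrightarrow> openin (mtop M) (Wc q) \<and> F \<subseteq> Wc q \<and> openin (mtop M) (A q) \<and> q \<in> A q \<and> A q \<subseteq> Wc q \<and>
    (\<forall>p\<in>Wc q. smooth_at M M (\<phi> q) p) \<and> (\<forall>p\<in>F. \<phi> q p = p) \<and> (\<forall>p\<in>A q. \<phi> q p \<in> F)"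
    using collapse by metis
  obtain I where I: "finite I" "I \<subseteq> F" "F \<subseteq> (\<Union>q\<in>I. A q)"
    using compactin_finite_cover[OF comp, of A] c by blast
  have "\<exists>W R B. openin (mtop M) W \<and> F \<subseteq> W \<and> openin (mtop M) B \<and> B \<subseteq> W \<and> F \<inter> (\<Union>q\<in>I. A q) \<subseteq> B \<and>
    (\<forall>p\<in>W. smooth_at M M R p) \<and> (\<forall>p\<in>F. R p = p) \<and> (\<forall>p\<in>B. R p \<in> F)"
    using I(1,2)
  proof (induction I)
    case empty
    show ?case
      by (rule exI[of _ "mpoints M"], rule exI[of _ "\<lambda>p. p"], rule exI[of _ "{}"])
        (use fiber_mem smooth_at_ident[OF M] in auto)
  next
    case (insert q I)
    then obtain W R B where IH: "openin (mtop M) W" "F \<subseteq> W" "openin (mtop M) B" "B \<subseteq> W" "F \<inter> (\<Union>q\<in>I. A q) \<subseteq> B"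
      and IH': "\<forall>p\<in>W. smooth_at M M R p" "\<forall>p\<in>F. R p = p" "\<forall>p\<in>B. R p \<in> F"
      by auto
    note IH = IH IH'[rule_format]
    have qF: "q \<in> F" using insert.prems by simp
    note cq = c[OF qF]
    \<comment> \<open>The domain shrinks so that the next move is defined at \<open>R p\<close>;
      since \<open>R\<close> fixes \<open>F\<close>, the fiber remains inside. For the same reason
      \<open>?B\<close> gains all points of \<open>F\<close> lying in \<open>A q\<close>.\<close>
    let ?W = "{p \<in> W. R p \<in> Wc q}" and ?B = "B \<union> {p \<in> W. R p \<in> A q}"
    have 1: "openin (mtop M) ?W" "openin (mtop M) ?B"
      using openin_smooth_preimage[OF IH(1) IH(6)] cq IH(3) by blast+
    have 2: "F \<subseteq> ?W" "?B \<subseteq> ?W" "F \<inter> (\<Union>q\<in>insert q I. A q) \<subseteq> ?B"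
      using IH cq by auto
    have 3: "smooth_at M M (\<lambda>p. \<phi> q (R p)) p" if "p \<in> ?W" for p
    proof (rule smooth_at_compose[OF M M M, of R p "\<phi> q"])
      show "smooth_at M M R p" using IH(6) that by blast
      show "smooth_at M M (\<phi> q) (R p)" using cq that by blast
    qed
    have 4: "\<phi> q (R p) = p" if "p \<in> F" for p
      using cq IH(7)[OF that] that by metis
    have 5: "\<phi> q (R p) \<in> F" if "p \<in> ?B" for p
    proof (cases "p \<in> B")
      case True
      then have "R p \<in> F" by (rule IH(8))
      then show ?thesis using cq by metis
    next
      case False
      then show ?thesis using cq that by blast
    qed
    show ?case
      by (intro exI[of _ ?W] exI[of _ "\<lambda>p. \<phi> q (R p)"] exI[of _ ?B] conjI ballI 1 2 3 4 5)
  qed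
  then obtain W R B where WB: "openin (mtop M) B" "B \<subseteq> W" "F \<inter> (\<Union>q\<in>I. A q) \<subseteq> B"
    and R: "\<forall>p\<in>W. smooth_at M M R p" "\<forall>p\<in>F. R p = p" "\<forall>p\<in>B. R p \<in> F"
    by (elim exE conjE) (rule that)
  show thesis
    by (rule that[of B R]) (use WB R I(3) in auto)
qed

text \<open>The pair \<open>(f, R)\<close> is a local diffeomorphism at each point of the fiber, where \<open>R\<close> is the
  retraction: in adapted coordinates the map \<open>H\<close> below combines both components.\<close>

lemma local_trivialization:
  assumes W: "openin (mtop M) W" "F \<subseteq> W" "\<And>p. p \<in> W \<Longrightarrow> smooth_at M M R p"
    and R: "\<And>p. p \<in> W \<Longrightarrow> R p \<in> F" "\<And>p. p \<in> F \<Longrightarrow> R p = p"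
    and q0: "q0 \<in> F"
  shows "\<exists>P K T Q g. trivialization_data M N f b R W F q0 P K T Q g"
proof -
  define v0 where "v0 = snd d b"
  have fq: "f q0 = b" and dN: "d \<in> atlas N" "b \<in> fst d" using fiber_mem[OF q0] d by (auto simp: charts_at_iff)
  obtain U Y \<kappa> \<kappa>i L S where ac: "adapted_coords M f d U Y \<kappa> \<kappa>i L S" and qU: "q0 \<in> U"
    by (rule fiber_adapted[OF q0])
  note U = adapted_coordsD(1)[OF ac] qU adapted_coordsD(2)[OF ac]
    and \<kappa> = adapted_coordsD(3)[OF ac] and \<kappa>i = adapted_coordsD(4)[OF ac] and LS = adapted_coordsD(5-7)[OF ac]
  have linL: "linear L" and linS: "linear S" using LS bounded_linear.linear by blast+
  have R\<kappa>i: "smooth_at euclid M (\<lambda>y. R (\<kappa>i y)) y" if "y \<in> Y" "\<kappa>i y \<in> W" for y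
    using smooth_at_compose[OF smooth_atlas_euclid M M] \<kappa>i[OF that(1)] W(3)[OF that(2)] by blast
  have oY0: "open {y \<in> Y. \<kappa>i y \<in> W}"
    using openin_smooth_preimage[of euclid Y M \<kappa>i W] U(3) \<kappa>i W(1) by simp
  define Y1 where "Y1 = {y \<in> {y \<in> Y. \<kappa>i y \<in> W}. R (\<kappa>i y) \<in> U}"
  have Y1: "open Y1"
    unfolding Y1_def using openin_smooth_preimage[of euclid "{y \<in> Y. \<kappa>i y \<in> W}" M "\<lambda>y. R (\<kappa>i y)" U] oY0 R\<kappa>i U(1)
    by simp
  define \<psi> where "\<psi> y = \<kappa> (R (\<kappa>i y))" for y
  \<comment> \<open>The coordinate form of \<open>(f, R)\<close> with both components packed into
    one vector: \<open>\<psi>\<close> stays on the level \<open>L = v0\<close>, so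
    \<open>L (H y)\<close> recovers the value of \<open>f\<close>, and subtracting its contribution
    recovers \<open>R\<close>. Source and target have equal dimension, as the inverse function
    theorem requires.\<close>
  define H where "H y = \<psi> y + S (L y - v0)" for y
  have \<psi>sm: "smooth_on \<psi> Y1"
  proof (rule smooth_on_smooth_at)
    fix y assume "y \<in> Y1"
    then have "smooth_at euclid M (\<lambda>y. R (\<kappa>i y)) y" "smooth_at M euclid \<kappa> (R (\<kappa>i y))"
      using R\<kappa>i \<kappa> by (auto simp: Y1_def)
    then show "smooth_at euclid euclid \<psi> y"
      unfolding \<psi>_def using smooth_at_compose[OF smooth_atlas_euclid M smooth_atlas_euclid] by blast
  qed
  have Hsm: "smooth_on H Y1"
    unfolding H_def
    by (intro smooth_on_add[OF Y1] \<psi>sm smooth_on_bounded_linear[OF Y1 LS(2)] smooth_on_diff[OF Y1]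
        smooth_on_linear[OF Y1 LS(1)] smooth_on_const[OF Y1])
  have L\<psi>: "L (\<psi> y) = v0" if "y \<in> Y1" for y
  proof -
    have "R (\<kappa>i y) \<in> U" "R (\<kappa>i y) \<in> F" using that R by (auto simp: Y1_def)
    then have "snd d b = L (\<psi> y)" using \<kappa>[of "R (\<kappa>i y)"] fiber_mem(2) by (simp add: \<psi>_def)
    then show ?thesis by (simp add: v0_def)
  qed
  have fixF: "\<psi> y = y" if "y \<in> Y" "L y = v0" for y
  proof -
    have k: "\<kappa>i y \<in> U" "\<kappa> (\<kappa>i y) = y" using \<kappa>i[OF that(1)] by auto
    then have "f (\<kappa>i y) \<in> fst d" "snd d (f (\<kappa>i y)) = snd d b" using \<kappa>[of "\<kappa>i y"] that(2) by (auto simp: v0_def)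
    then have "f (\<kappa>i y) = b" using fiber_chart_eq dN(2) by blast
    moreover have "\<kappa>i y \<in> mpoints M" using k(1) U(1) openin_subset by blast
    ultimately have "\<kappa>i y \<in> F" by (simp add: F_def)
    then show ?thesis using R(2) k by (simp add: \<psi>_def)
  qed
  define y0 where "y0 = \<kappa> q0"
  have Ly0: "L y0 = v0" using \<kappa>[OF U(2)] fq by (simp add: y0_def v0_def)
  have y0: "y0 \<in> Y1"
    using \<kappa>[OF U(2)] q0 W(2) R(2)[OF q0] U(2) by (auto simp: Y1_def y0_def)
  have Y1Y: "Y1 \<subseteq> Y" by (auto simp: Y1_def)
  define T where "T = frechet_derivative \<psi> (at y0)"
  have T: "(\<psi> has_derivative T) (at y0)"
    unfolding T_def by (rule smooth_on_has_derivative[OF \<psi>sm y0])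
  \<comment> \<open>\<open>R\<close> has values in the fiber, where \<open>L\<close> of the
    coordinates is constantly \<open>v0\<close>; so the derivative of \<open>\<psi>\<close> maps
    into the kernel of \<open>L\<close>.\<close>
  have LT: "L (T w) = 0" for w
  proof -
    have "((\<lambda>y. L (\<psi> y)) has_derivative (\<lambda>w. L (T w))) (at y0)"
      by (rule bounded_linear.has_derivative[OF LS(1) T])
    moreover have "((\<lambda>y. L (\<psi> y)) has_derivative (\<lambda>w. 0)) (at y0)"
      by (rule has_derivative_transform_within_open[OF has_derivative_const[of v0] Y1 y0]) (simp add: L\<psi>)
    ultimately show ?thesis using has_derivative_unique by metis
  qed
  \<comment> \<open>Points of \<open>Y\<close> with \<open>L y = v0\<close> lie on the fiber and are
    fixed by the retraction. Together with \<open>LT\<close> this makes \<open>T\<close> a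
    projection onto the kernel of \<open>L\<close>, so that adding \<open>S (L w)\<close> gives an
    injective map.\<close>
  have Tker: "T w = w" if Lw: "L w = 0" for w
  proof -
    have line: "((\<lambda>t::real. y0 + t *\<^sub>R w) has_derivative (\<lambda>t. t *\<^sub>R w)) (at 0)"
      by (auto intro!: derivative_eq_intros)
    have "((\<lambda>t. \<psi> (y0 + t *\<^sub>R w)) has_derivative (\<lambda>t. T (t *\<^sub>R w))) (at 0)"
      using has_derivative_compose[OF line, of \<psi> T] T by simp
    moreover have "((\<lambda>t. \<psi> (y0 + t *\<^sub>R w)) has_derivative (\<lambda>t. t *\<^sub>R w)) (at 0)"
    proof (rule has_derivative_transform_within_open[OF line])
      show "open ((\<lambda>t::real. y0 + t *\<^sub>R w) -` Y1)"
        by (rule open_vimage[OF Y1]) (intro continuous_intros)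
      show "0 \<in> (\<lambda>t::real. y0 + t *\<^sub>R w) -` Y1" using y0 by simp
      show "y0 + t *\<^sub>R w = \<psi> (y0 + t *\<^sub>R w)" if "t \<in> (\<lambda>t::real. y0 + t *\<^sub>R w) -` Y1" for t
        using fixF[of "y0 + t *\<^sub>R w"] that Y1Y Lw Ly0 by (auto simp: linear_add[OF linL] linear_scale[OF linL])
    qed
    ultimately have "(\<lambda>t. T (t *\<^sub>R w)) = (\<lambda>t. t *\<^sub>R w)" by (rule has_derivative_unique)
    then show ?thesis by (metis scaleR_one)
  qed
  have derH: "(H has_derivative (\<lambda>w. T w + S (L w))) (at y0)"
  proof -
    have "(H has_derivative (\<lambda>w. T w + S (L w - 0))) (at y0)"
      unfolding H_def
      by (intro has_derivative_add T bounded_linear.has_derivative[OF LS(2)] has_derivative_diff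
          bounded_linear_imp_has_derivative[OF LS(1)] has_derivative_const)
    then show ?thesis by simp
  qed
  have eqH: "frechet_derivative H (at y0) = (\<lambda>w. T w + S (L w))"
    using frechet_derivative_at[OF derH] by simp
  have inj: "inj (frechet_derivative H (at y0))"
  proof -
    have "w = 0" if "T w + S (L w) = 0" for w
    proof -
      have "L (T w + S (L w)) = 0" using that linear_0[OF linL] by simp
      then have "L w = 0" by (simp add: linear_add[OF linL] LT LS(3))
      then show ?thesis using that Tker linear_0[OF linS] by simp
    qed
    moreover have "linear (\<lambda>w. T w + S (L w))" using derH has_derivative_linear by blast
    ultimately show ?thesis unfolding eqH using linear_injective_0 by blast
  qed
  obtain Y2 Z G where Y2: "open Y2" "y0 \<in> Y2" "Y2 \<subseteq> Y1" "open Z" "H ` Y2 = Z" "G ` Z = Y2"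
    "\<And>y. y \<in> Y2 \<Longrightarrow> G (H y) = y" "\<And>z. z \<in> Z \<Longrightarrow> H (G z) = z" "smooth_on G Z"
    using smooth_inverse_function[OF Y1 Hsm y0 inj] by metis
  define P where "P = {p \<in> U. \<kappa> p \<in> Y2}"
  have P: "openin (mtop M) P"
    unfolding P_def using openin_smooth_preimage[of M U euclid \<kappa> Y2] U(1) \<kappa> Y2(1) by simp
  have injP: "p = p'" if pp: "p \<in> P" "p' \<in> P" "f p = f p'" "R p = R p'" for p p'
  proof -
    have *: "p \<in> U" "p' \<in> U" "\<kappa> p \<in> Y2" "\<kappa> p' \<in> Y2" using pp by (auto simp: P_def)
    have "H (\<kappa> p) = H (\<kappa> p')"
      using \<kappa>[OF *(1)] \<kappa>[OF *(2)] pp(3,4) by (simp add: H_def \<psi>_def)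
    then have "\<kappa> p = \<kappa> p'" using Y2(7) * by metis
    then show ?thesis using \<kappa> * by metis
  qed
  \<comment> \<open>The coordinates \<open>y\<close> of the point over \<open>z\<close> that
    retracts to \<open>q\<close> must satisfy \<open>H y = m (z, q)\<close>, because
    \<open>\<psi> y\<close> is \<open>\<kappa> q\<close> and \<open>L y\<close> is
    \<open>snd d z\<close>. Hence \<open>g\<close> applies \<open>G\<close> to
    \<open>m\<close>.\<close>
  define m where "m x = \<kappa> (snd x) + S (snd d (fst x) - v0)" for x
  define g where "g x = \<kappa>i (G (m x))" for x
  let ?NM = "prod_manifold N M"
  note NM = smooth_atlas_prod[OF N M]
  have dsub: "openin (mtop N) (fst d)" using chart_openin[OF N dN(1)] .
  have oD: "openin (mtop ?NM) (fst d \<times> U)"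
    using dsub U(1) by (simp add: prod_manifold_def openin_prod_Times_iff)
  have msm: "smooth_at ?NM euclid m x" if "x \<in> fst d \<times> U" for x
  proof -
    have x: "x \<in> mpoints N \<times> mpoints M" "fst x \<in> fst d" "snd x \<in> U"
      using that oD openin_subset[OF oD] by auto
    have 1: "smooth_at ?NM euclid (\<lambda>x. \<kappa> (snd x)) x"
      using smooth_at_compose[OF NM M smooth_atlas_euclid smooth_at_fst_snd(2)[OF N M x(1)]] \<kappa>[OF x(3)] by blast
    have 2: "smooth_at ?NM euclid (\<lambda>x. snd d (fst x)) x"
      using smooth_at_compose[OF NM N smooth_atlas_euclid smooth_at_fst_snd(1)[OF N M x(1)] smooth_at_chart[OF N dN(1) x(2)]] .
    show ?thesis
      unfolding m_def using x(1)
      by (intro smooth_at_add[OF NM] smooth_at_linear[OF NM LS(2)] smooth_at_diff[OF NM] 1 2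
          smooth_at_const[OF NM smooth_atlas_euclid]) auto
  qed
  have oD': "openin (mtop ?NM) {x \<in> fst d \<times> U. m x \<in> Z}"
    using openin_smooth_preimage[of ?NM "fst d \<times> U" euclid m Z] oD msm Y2(4) by simp
  have "m (b, q0) = H y0"
    using fixF[of y0] y0 Y1Y Ly0 linear_0[OF linS] by (auto simp: m_def H_def y0_def v0_def)
  then have "(b, q0) \<in> {x \<in> fst d \<times> U. m x \<in> Z}" using Y2 dN(2) U(2) by auto
  then obtain T' Q' where TQ: "openin (mtop N) T'" "openin (mtop M) Q'" "b \<in> T'" "q0 \<in> Q'"
    "T' \<times> Q' \<subseteq> {x \<in> fst d \<times> U. m x \<in> Z}"
  proof -
    have "openin (prod_topology (mtop N) (mtop M)) {x \<in> fst d \<times> U. m x \<in> Z}"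
      using oD' by (simp add: prod_manifold_def)
    from this[unfolded openin_prod_topology_alt, rule_format, OF \<open>(b, q0) \<in> _\<close>]
    show thesis by (elim exE conjE) (rule that)
  qed
  have gsm: "smooth_at ?NM M g x" if "x \<in> T' \<times> Q'" for x
  proof -
    have x: "x \<in> fst d \<times> U" "m x \<in> Z" using that TQ by auto
    then have Gm: "G (m x) \<in> Y" using Y2 Y1Y by blast
    have "smooth_at ?NM euclid (\<lambda>x. G (m x)) x"
      by (rule smooth_at_compose_euclid[OF NM msm[OF x(1)] Y2(9,4) x(2)])
    then show ?thesis
      unfolding g_def using smooth_at_compose[OF NM smooth_atlas_euclid M] \<kappa>i[OF Gm] by blast
  qed
  have ginv: "g (z, q) \<in> W \<and> f (g (z, q)) = z \<and> R (g (z, q)) = q" if z: "z \<in> T'" and q: "q \<in> Q'" "q \<in> F" for z q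
  proof -
    have zq: "z \<in> fst d" "q \<in> U" "m (z, q) \<in> Z" using z q TQ(5) by auto
    define y where "y = G (m (z, q))"
    have y: "y \<in> Y2" "y \<in> Y1" "y \<in> Y" using zq Y2 Y1Y by (auto simp: y_def)
    have Hy: "H y = m (z, q)" using Y2(8) zq by (simp add: y_def)
    have kq: "L (\<kappa> q) = v0" using \<kappa>[OF zq(2)] fiber_mem q(2) by (simp add: v0_def)
    have "L (H y) = L (m (z, q))" using Hy by simp
    then have Ly: "L y = snd d z"
      by (simp add: H_def m_def linear_add[OF linL] L\<psi>[OF y(2)] LS(3) kq)
    have ky: "\<kappa>i y \<in> U" "\<kappa> (\<kappa>i y) = y" using \<kappa>i[OF y(3)] by auto
    then have "f (\<kappa>i y) \<in> fst d" "snd d (f (\<kappa>i y)) = snd d z" using \<kappa>[of "\<kappa>i y"] Ly by auto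
    then have fz: "f (\<kappa>i y) = z" using fiber_chart_eq zq by blast
    have "\<psi> y = \<kappa> q" using Hy Ly by (simp add: H_def m_def)
    moreover have "R (\<kappa>i y) \<in> U" "\<kappa>i y \<in> W" using y(2) by (auto simp: Y1_def)
    ultimately have "R (\<kappa>i y) = q" using \<kappa> zq(2) by (metis \<psi>_def)
    with fz \<open>\<kappa>i y \<in> W\<close> show ?thesis by (simp add: g_def y_def)
  qed
  have q0P: "q0 \<in> P" using U(2) Y2(2) by (simp add: P_def y0_def)
  have "openin (mtop M) (P \<inter> Q')" "q0 \<in> P \<inter> Q'" using P TQ q0P by auto
  \<comment> \<open>This supplies nested neighbourhoods \<open>V \<subseteq> K\<close> of
    \<open>q0\<close> with \<open>K\<close> closed in \<open>M\<close>.\<close>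
  from manifold_bump[OF M HM this] obtain h K V where "bump_at M (P \<inter> Q') q0 h K V" by blast
  then have K: "closedin (mtop M) K" "K \<subseteq> P \<inter> Q'" "openin (mtop M) V" "q0 \<in> V" "V \<subseteq> K"
    unfolding bump_at_def by blast+
  have KP: "K \<subseteq> P" and VQ: "V \<subseteq> Q'" using K by auto
  show ?thesis
    unfolding trivialization_data_def
    by (intro exI[of _ P] exI[of _ K] exI[of _ T'] exI[of _ V] exI[of _ g] conjI ballI impI P K(1,3,4,5) KP TQ(1,3))
      (use injP gsm ginv VQ in auto)
qed

section \<open>From local inverses to a trivialization\<close>

lemma fiber_compact:
  assumes comp: "compact_space (mtop M)" and HN: "Hausdorff_space (mtop N)"
  shows "compactin (mtop M) F"
proof -
  have "b \<in> mpoints N" using d chart_subset[OF N, of d] by (auto simp: charts_at_iff)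
  then have "openin (mtop N) (mpoints N - {b})"
    using HN by (simp add: closedin_Hausdorff_sing_eq openin_diff)
  then have "openin (mtop M) {p \<in> mpoints M. f p \<in> mpoints N - {b}}"
    using reg by (intro openin_smooth_preimage[of M "mpoints M" N]) (auto simp: regular_at_def)
  moreover have "f p \<in> mpoints N" if "p \<in> mpoints M" for p
    using smooth_at_mem[of M N f p] reg[OF that] by (simp add: regular_at_def)
  then have "{p \<in> mpoints M. f p \<in> mpoints N - {b}} = mpoints M - F" by (auto simp: F_def)
  ultimately have "closedin (mtop M) F"
    by (simp add: closedin_def) (auto simp: F_def)
  then show ?thesis using comp closedin_compact_space by blast
qed

text \<open>Injectivity of \<open>(f, R)\<close> is known only on each \<open>P i\<close>, and two
  distant points might share their image. For points close enough to the fiber, membership in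
  \<open>P i\<close> can be read off from \<open>R p\<close>, which forces both into the same
  \<open>P i\<close>. Compactness of \<open>M\<close> then finds a neighbourhood of \<open>b\<close>
  whose whole preimage is that close.\<close>

lemma locally_trivial_at:
  assumes comp: "compact_space (mtop M)" and HN: "Hausdorff_space (mtop N)"
  shows "\<exists>V h. openin (mtop N) V \<and> b \<in> V \<and>
        diffeo_between M {p \<in> mpoints M. f p \<in> V} (prod_manifold N M) (V \<times> F) h \<and>
        (\<forall>p\<in>mpoints M. f p \<in> V \<longrightarrow> fst (h p) = f p)"
proof -
  have bN: "b \<in> mpoints N" using d chart_subset[OF N, of d] by (auto simp: charts_at_iff)
  have fsm: "smooth_at M N f p" if "p \<in> mpoints M" for p using reg[OF that] by (simp add: regular_at_def)
  obtain W R where W: "openin (mtop M) W" "F \<subseteq> W" "\<And>p. p \<in> W \<Longrightarrow> smooth_at M M R p"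
    and R: "\<And>p. p \<in> W \<Longrightarrow> R p \<in> F" "\<And>p. p \<in> F \<Longrightarrow> R p = p"
    using smooth_retraction[OF fiber_compact[OF comp HN]] by metis
  have WM: "W \<subseteq> mpoints M" using W(1) openin_subset by blast
  obtain P K T Q g where good: "\<And>q0. q0 \<in> F \<Longrightarrow> trivialization_data M N f b R W F q0 (P q0) (K q0) (T q0) (Q q0) (g q0)"
    using local_trivialization[OF W R] by metis
  note loc = good[unfolded trivialization_data_def]
  obtain I where I: "finite I" "I \<subseteq> F" "F \<subseteq> (\<Union>q\<in>I. Q q)"
    using compactin_finite_cover[OF fiber_compact[OF comp HN], of Q] loc by blast
  \<comment> \<open>For \<open>p\<close> in \<open>W\<close> this says: if \<open>R p\<close> lies
    in \<open>K i\<close>, then \<open>p\<close> lies in \<open>P i\<close>. The set is open since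
    \<open>K i\<close> is closed, and contains the fiber since \<open>R\<close> is the identity
    there and \<open>K i \<subseteq> P i\<close>.\<close>
  define Op where "Op i = {p \<in> W. R p \<in> mpoints M - K i} \<union> (W \<inter> P i)" for i
  define V0 where "V0 = W \<inter> (\<Inter>i\<in>I. Op i)"
  have Op: "openin (mtop M) (Op i)" if "i \<in> I" for i
  proof -
    have "openin (mtop M) (mpoints M - K i)" "openin (mtop M) (P i)" using loc I(2) that by blast+
    then show ?thesis
      unfolding Op_def using openin_smooth_preimage[OF W(1) W(3)] W(1) by blast
  qed
  have V0: "openin (mtop M) V0"
    unfolding V0_def using I(1) Op W(1)
    by (cases "I = {}") (auto intro!: openin_Int openin_INT2)
  have FV0: "F \<subseteq> V0"
  proof
    fix p assume p: "p \<in> F"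
    have "p \<in> Op i" if "i \<in> I" for i
    proof -
      have "K i \<subseteq> P i" using loc[of i] I(2) that by blast
      then show ?thesis using W(2) R(2)[OF p] p fiber_mem(1)[OF p] unfolding Op_def by auto
    qed
    then show "p \<in> V0" using W(2) p by (auto simp: V0_def)
  qed
  \<comment> \<open>The values taken away from \<open>V0\<close> form a compact, hence closed, set
    that misses \<open>b\<close>. Over its complement all preimages lie in
    \<open>V0\<close>.\<close>
  define C where "C = f ` (mpoints M - V0)"
  have "compactin (mtop M) (mpoints M - V0)"
    using V0 comp by (simp add: closedin_compact_space closedin_diff)
  moreover have "continuous_map (mtop M) (mtop N) f"
    using smooth_map_onI[OF M N openin_topspace fsm] by (simp add: smooth_map_on_def)
  ultimately have C: "closedin (mtop N) C"
    unfolding C_def using compactin_imp_closedin[OF HN] image_compactin by blast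
  have bC: "b \<notin> C" using FV0 by (auto simp: C_def F_def)
  define V where "V = (mpoints N - C) \<inter> (\<Inter>i\<in>I. T i)"
  have "openin (mtop N) (T i)" "b \<in> T i" if "i \<in> I" for i using loc that I(2) by blast+
  then have V: "openin (mtop N) V" "b \<in> V"
    unfolding V_def using I(1) C bC bN
    by (cases "I = {}"; auto intro!: openin_Int openin_INT2)+
  define D where "D = {p \<in> mpoints M. f p \<in> V}"
  define h where "h p = (f p, R p)" for p
  have DV0: "D \<subseteq> V0" by (auto simp: D_def V_def C_def)
  have DW: "D \<subseteq> W" using DV0 by (auto simp: V0_def)
  have injh: "inj_on h D"
  proof (rule inj_onI)
    fix p p' assume pp: "p \<in> D" "p' \<in> D" "h p = h p'"
    have eq: "f p = f p'" "R p = R p'" using pp(3) by (auto simp: h_def)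
    have "R p \<in> F" using R DW pp by blast
    then obtain i where i: "i \<in> I" "R p \<in> Q i" using I(3) by blast
    have "Q i \<subseteq> K i" using loc[of i] I(2) i(1) by blast
    then have Ki: "R p \<in> K i" "R p' \<in> K i" using i(2) eq(2) by auto
    have "p \<in> Op i" "p' \<in> Op i" using pp DV0 i by (auto simp: V0_def)
    then have "p \<in> P i" "p' \<in> P i" using Ki by (auto simp: Op_def)
    then show "p = p'" using loc[of i] i I(2) eq by blast
  qed
  have hinto: "h ` D \<subseteq> V \<times> F" using R DW by (auto simp: h_def D_def)
  have ginv: "g i (z, q) \<in> D \<and> h (g i (z, q)) = (z, q)" if "i \<in> I" "z \<in> V" "q \<in> Q i" "q \<in> F" for i z q
  proof -
    have "z \<in> T i" using that by (auto simp: V_def)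
    then have "g i (z, q) \<in> W \<and> f (g i (z, q)) = z \<and> R (g i (z, q)) = q" using loc[of i] I(2) that by blast
    then show ?thesis using WM that by (auto simp: D_def h_def)
  qed
  have bij: "bij_betw h D (V \<times> F)"
    unfolding bij_betw_def
  proof (intro conjI injh subset_antisym hinto subsetI)
    fix x assume x: "x \<in> V \<times> F"
    then obtain i where "i \<in> I" "snd x \<in> Q i" using I(3) by auto
    then show "x \<in> h ` D" using ginv[of i "fst x" "snd x"] x by (metis image_eqI mem_Times_iff prod.collapse)
  qed
  have sm1: "smooth_between M D (prod_manifold N M) (V \<times> F) h"
    unfolding smooth_between_def
  proof (intro conjI ballI hinto)
    fix p assume p: "p \<in> D"
    have "smooth_at M (prod_manifold N M) h p"
      unfolding h_def using p DW by (intro smooth_at_Pair[OF M N M fsm W(3)]) (auto simp: D_def)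
    then show "\<exists>W g. p \<in> W \<and> smooth_map_on M W (prod_manifold N M) g \<and> (\<forall>q\<in>D \<inter> W. g q = h q)"
      unfolding smooth_at_def by blast
  qed
  have sm2: "smooth_between (prod_manifold N M) (V \<times> F) M D (inv_into D h)"
    unfolding smooth_between_def
  proof (intro conjI ballI)
    show "inv_into D h ` (V \<times> F) \<subseteq> D"
      using bij by (metis bij_betw_def inv_into_image_cancel subset_refl)
    fix x assume x: "x \<in> V \<times> F"
    then obtain i where i: "i \<in> I" "snd x \<in> Q i" using I(3) by auto
    have "openin (mtop (prod_manifold N M)) (T i \<times> Q i)"
      using loc[of i] i I(2) by (auto simp: prod_manifold_def openin_prod_Times_iff)
    then have "smooth_map_on (prod_manifold N M) (T i \<times> Q i) M (g i)"
      by (rule smooth_map_onI[OF smooth_atlas_prod[OF N M] M]) (use loc[of i] i I(2) in auto)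
    moreover have "x \<in> T i \<times> Q i" using x i by (auto simp: V_def mem_Times_iff)
    moreover have "g i y = inv_into D h y" if "y \<in> (V \<times> F) \<inter> (T i \<times> Q i)" for y
      using ginv[of i "fst y" "snd y"] that i(1) inv_into_f_f[OF injh, of "g i y"] by auto
    ultimately show "\<exists>W' g'. x \<in> W' \<and> smooth_map_on (prod_manifold N M) W' M g' \<and> (\<forall>y\<in>(V \<times> F) \<inter> W'. g' y = inv_into D h y)"
      by (intro exI[of _ "T i \<times> Q i"] exI[of _ "g i"] conjI ballI)
  qed
  show ?thesis
    using V bij sm1 sm2 by (intro exI[of _ V] exI[of _ h]) (auto simp: diffeo_between_def D_def h_def)
qed

end

theorem ehresmann_compact:
  fixes M :: "('a, real^'n) manifold" and N :: "('b, real^'k) manifold"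
  assumes M: "smooth_atlas M" and N: "smooth_atlas N"
    and HM: "Hausdorff_space (mtop M)" and HN: "Hausdorff_space (mtop N)" and comp: "compact_space (mtop M)"
    and reg: "\<And>p. p \<in> mpoints M \<Longrightarrow> regular_at M N f p"
  shows "locally_trivial M N f"
  unfolding locally_trivial_def
proof
  fix b assume "b \<in> mpoints N"
  then obtain d where "d \<in> charts_at N b" using charts_at_nonempty[OF N] by metis
  from locally_trivial_at[OF M N HM reg this comp HN]
  show "\<exists>V h. openin (mtop N) V \<and> b \<in> V \<and>
        diffeo_between M {p \<in> mpoints M. f p \<in> V} (prod_manifold N M) (V \<times> {p \<in> mpoints M. f p = b}) h \<and>
        (\<forall>p\<in>mpoints M. f p \<in> V \<longrightarrow> fst (h p) = f p)"
    by blast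
qed

section \<open>The torus\<close>

definition torus_chart :: "real^'k \<Rightarrow> (complex^'k, real^'k) chart" where
  "torus_chart t = ({z. \<forall>i. z $ i \<in> fst (circle_chart (t $ i))}, \<lambda>z. \<chi> i. snd (circle_chart (t $ i)) (z $ i))"

text \<open>The universal covering of the torus. The inverses of the charts are its restrictions to
  the boxes \<open>torus_box t\<close>.\<close>

definition torus_exp :: "real^'k \<Rightarrow> complex^'k" where
  "torus_exp x = (\<chi> i. cis (x $ i))"

lemma mtop_torus: "mtop torus = top_of_set {z. \<forall>i. norm (z $ i) = 1}"
  by (simp add: torus_def circle_def)

lemma mpoints_torus: "mpoints torus = {z. \<forall>i. norm (z $ i) = 1}"
  by (simp add: mtop_torus)

lemma atlas_torus: "atlas (torus :: (complex^'k, real^'k) manifold) = range torus_chart"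
proof -
  have "(\<forall>i. c i \<in> range circle_chart) \<longleftrightarrow> (\<exists>t :: real^'k. c = (\<lambda>i. circle_chart (t $ i)))" for c
  proof
    assume "\<forall>i. c i \<in> range circle_chart"
    then have "\<forall>i. \<exists>s. c i = circle_chart s" by blast
    then obtain s where "c = (\<lambda>i. circle_chart (s i))" by metis
    then show "\<exists>t :: real^'k. c = (\<lambda>i. circle_chart (t $ i))" by (intro exI[of _ "\<chi> i. s i"]) simp
  qed auto
  then show ?thesis
    unfolding torus_def circle_def manifold.simps full_SetCompr_eq[symmetric] torus_chart_def
    by (simp only:) (fastforce simp del: split_paired_Ex)
qed

lemma circle_chart_right:
  assumes "norm z = 1" "z \<noteq> - cis t"
  shows "\<bar>Arg (z / cis t)\<bar> < pi" "cis (t + Arg (z / cis t)) = z" "z / cis t \<notin> \<real>\<^sub>\<le>\<^sub>0"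
proof -
  let ?w = "z / cis t"
  have n: "norm ?w = 1" using assms by (simp add: norm_divide)
  then have w0: "?w \<noteq> 0" by auto
  have "sgn ?w = ?w" using n by (simp add: sgn_div_norm)
  then have c: "cis (Arg ?w) = ?w" using cis_Arg[OF w0] by simp
  \<comment> \<open>Division by \<open>cis t\<close> rotates the omitted point to -1, the only point
    of the unit circle where \<open>Arg\<close> equals \<open>pi\<close> and is
    discontinuous.\<close>
  have "?w \<noteq> - 1" using assms(2) by (auto simp: divide_eq_eq)
  then have "Arg ?w \<noteq> pi" using c cis_pi by metis
  then show "\<bar>Arg ?w\<bar> < pi" using Arg_bounded[of ?w] by (simp add: abs_less_iff)
  show "cis (t + Arg ?w) = z" by (simp add: cis_mult[symmetric] c)
  show "?w \<notin> \<real>\<^sub>\<le>\<^sub>0"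
  proof
    assume "?w \<in> \<real>\<^sub>\<le>\<^sub>0"
    then obtain r where "?w = complex_of_real r" "r \<le> 0" by (auto elim: nonpos_Reals_cases)
    then show False using n \<open>?w \<noteq> - 1\<close> by auto
  qed
qed

lemma circle_chart_left:
  assumes "\<bar>x - t\<bar> < pi"
  shows "Arg (cis x / cis t) = x - t" "cis x \<noteq> - cis t"
proof -
  show 1: "Arg (cis x / cis t) = x - t"
    using assms by (simp add: cis_divide cis_Arg_unique sgn_div_norm)
  show "cis x \<noteq> - cis t"
  proof
    assume "cis x = - cis t"
    then have "cis x / cis t = cis pi" by (simp add: divide_eq_eq)
    then have "x - t = pi" using 1 Arg_cis[of pi] by simp
    then show False using assms by simp
  qed
qed

definition torus_box :: "real^'k \<Rightarrow> (real^'k) set" where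
  "torus_box t = {x. \<forall>i. \<bar>x $ i - t $ i\<bar> < pi}"

lemma open_torus_box: "open (torus_box t)"
proof -
  have "torus_box t = (\<Inter>i. {x. \<bar>x $ i - t $ i\<bar> < pi})" by (auto simp: torus_box_def)
  moreover have "open {x. \<bar>x $ i - t $ i\<bar> < pi}" for i
    by (intro open_Collect_less continuous_intros)
  ultimately show ?thesis by auto
qed

lemma fst_torus_chart: "fst (torus_chart t) = {z. \<forall>i. norm (z $ i) = 1 \<and> z $ i \<noteq> - cis (t $ i)}"
  by (auto simp: torus_chart_def circle_chart_def)

lemma snd_torus_chart: "snd (torus_chart t) z = (\<chi> i. t $ i + Arg (z $ i / cis (t $ i)))"
  by (simp add: torus_chart_def circle_chart_def)

lemma torus_chart_right:
  assumes "z \<in> fst (torus_chart t)"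
  shows "snd (torus_chart t) z \<in> torus_box t" "torus_exp (snd (torus_chart t) z) = z"
  using assms circle_chart_right
  by (auto simp: fst_torus_chart snd_torus_chart torus_box_def torus_exp_def vec_eq_iff)

lemma torus_chart_left:
  assumes "x \<in> torus_box t"
  shows "torus_exp x \<in> fst (torus_chart t)" "snd (torus_chart t) (torus_exp x) = x"
  using assms circle_chart_left
  by (auto simp: fst_torus_chart snd_torus_chart torus_box_def torus_exp_def vec_eq_iff)

lemma chart_image_torus: "chart_image (torus_chart t) = torus_box t"
  using torus_chart_right torus_chart_left unfolding chart_image_def by force

lemma chart_inv_torus:
  assumes "x \<in> torus_box t"
  shows "chart_inv (torus_chart t) x = torus_exp x"
  unfolding chart_inv_def
proof (rule inv_into_f_eq)
  show "inj_on (snd (torus_chart t)) (fst (torus_chart t))"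
    by (rule inj_on_inverseI[where g=torus_exp]) (rule torus_chart_right)
qed (use torus_chart_left[OF assms] in auto)

text \<open>The chart value and \<open>x0\<close> are two angles of the same point, so they differ
  by a period \<open>c\<close> of the covering; adding \<open>c\<close> is a lift that stays valid
  nearby. In charts the covering is thus a translation: transitions are smooth, and a lift to the
  covering has the same derivative as the map.\<close>

lemma torus_exp_chart:
  assumes "torus_exp x0 \<in> fst (torus_chart t)"
  obtains X c where "open X" "x0 \<in> X"
    "\<And>x. x \<in> X \<Longrightarrow> torus_exp x \<in> fst (torus_chart t) \<and> snd (torus_chart t) (torus_exp x) = x + c"
proof -
  define c where "c = snd (torus_chart t) (torus_exp x0) - x0"
  have "torus_exp (x0 + c) = torus_exp x0"
    using torus_chart_right(2)[OF assms] by (simp add: c_def)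
  then have "cis (x0 $ i + c $ i) = cis (x0 $ i)" for i
    by (simp add: torus_exp_def vec_eq_iff)
  then have "cis (c $ i) = 1" for i
    by (metis cis_mult cis_neq_zero mult_cancel_left1 mult.commute)
  then have per: "torus_exp (x + c) = torus_exp x" for x
    by (simp add: torus_exp_def vec_eq_iff cis_mult[symmetric])
  let ?X = "(\<lambda>x. x + c) -` torus_box t"
  show thesis
  proof (rule that[of ?X c])
    show "open ?X" by (rule open_vimage[OF open_torus_box]) (intro continuous_intros)
    show "x0 \<in> ?X" using torus_chart_right(1)[OF assms] by (simp add: c_def)
    show "torus_exp x \<in> fst (torus_chart t) \<and> snd (torus_chart t) (torus_exp x) = x + c" if "x \<in> ?X" for x
      using torus_chart_left[of "x + c" t] that by (simp add: per)
  qed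
qed

lemma continuous_on_torus_exp: "continuous_on A torus_exp"
  unfolding torus_exp_def by (intro continuous_on_vec_lambda continuous_intros)

lemma smooth_atlas_torus: "smooth_atlas (torus :: (complex^'k, real^'k) manifold)"
proof -
  let ?T = "torus :: (complex^'k, real^'k) manifold"
  have charts: "openin (mtop ?T) (fst c) \<and> open (chart_image c) \<and>
        homeomorphic_map (subtopology (mtop ?T) (fst c)) (top_of_set (chart_image c)) (snd c)"
    if c: "c \<in> atlas ?T" for c
  proof -
    obtain t where t: "c = torus_chart t" using c unfolding atlas_torus by blast
    let ?F = "fst (torus_chart t)"
    have "?F = {z. \<forall>i. norm (z $ i) = 1} \<inter> (\<Inter>i. {z. z $ i \<noteq> - cis (t $ i)})"
      by (auto simp: fst_torus_chart)
    moreover have "open {z :: complex^'k. z $ i \<noteq> - cis (t $ i)}" for i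
      by (intro open_Collect_neq continuous_intros)
    ultimately have o: "openin (mtop ?T) ?F"
      unfolding mtop_torus by (metis (no_types, lifting) finite open_INT openin_open_Int)
    have sub: "subtopology (mtop ?T) ?F = top_of_set ?F"
      unfolding mtop_torus subtopology_subtopology by (rule arg_cong[where f="subtopology euclidean"]) (auto simp: fst_torus_chart)
    have cont: "continuous_on ?F (snd (torus_chart t))"
      unfolding snd_torus_chart
    proof (intro continuous_on_vec_lambda continuous_on_add continuous_on_const)
      fix i
      have "continuous_on ?F (\<lambda>z. z $ i / cis (t $ i))" by (intro continuous_intros) auto
      moreover have "(\<lambda>z. z $ i / cis (t $ i)) ` ?F \<subseteq> - \<real>\<^sub>\<le>\<^sub>0"
        using circle_chart_right(3) by (auto simp: fst_torus_chart)
      moreover have "continuous_on (- \<real>\<^sub>\<le>\<^sub>0) Arg"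
        by (auto intro!: continuous_at_imp_continuous_on continuous_at_Arg)
      ultimately show "continuous_on ?F (\<lambda>z. Arg (z $ i / cis (t $ i)))"
        using continuous_on_compose2 by blast
    qed
    have "homeomorphic_maps (top_of_set ?F) (top_of_set (torus_box t)) (snd (torus_chart t)) torus_exp"
      unfolding homeomorphic_maps_def
      using cont continuous_on_torus_exp torus_chart_right[of _ t] torus_chart_left[of _ t] by auto
    then show ?thesis
      using o sub open_torus_box unfolding t chart_image_torus homeomorphic_map_maps by auto
  qed
  have cover: "(\<Union>c\<in>atlas ?T. fst c) = mpoints ?T"
  proof
    show "(\<Union>c\<in>atlas ?T. fst c) \<subseteq> mpoints ?T"
      using charts openin_subset by blast
    show "mpoints ?T \<subseteq> (\<Union>c\<in>atlas ?T. fst c)"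
    proof
      fix z assume z: "z \<in> mpoints ?T"
      define t :: "real^'k" where "t = (\<chi> i. Arg (z $ i))"
      have "cis (t $ i) = z $ i" for i
      proof -
        have n: "norm (z $ i) = 1" using z by (simp add: mpoints_torus)
        then have "z $ i \<noteq> 0" by (metis norm_zero zero_neq_one)
        then show ?thesis using cis_Arg[of "z $ i"] n by (simp add: t_def sgn_div_norm)
      qed
      then have "torus_exp t = z" by (simp add: torus_exp_def vec_eq_iff)
      moreover have "t \<in> torus_box t" by (simp add: torus_box_def)
      ultimately have "z \<in> fst (torus_chart t)" using torus_chart_left(1) by metis
      then show "z \<in> (\<Union>c\<in>atlas ?T. fst c)" unfolding atlas_torus by blast
    qed
  qed
  have trans: "smooth_on (snd d \<circ> chart_inv c) (snd c ` (fst c \<inter> fst d))"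
    if c: "c \<in> atlas ?T" and d: "d \<in> atlas ?T" for c d
  proof (rule smooth_on_local)
    obtain s t where st: "c = torus_chart s" "d = torus_chart t" using c d unfolding atlas_torus by blast
    fix x assume "x \<in> snd c ` (fst c \<inter> fst d)"
    then obtain z where z: "x = snd (torus_chart s) z" "z \<in> fst (torus_chart s)" "z \<in> fst (torus_chart t)"
      using st by blast
    have x: "x \<in> torus_box s" "torus_exp x = z" using torus_chart_right[OF z(2)] z(1) by auto
    then have "torus_exp x \<in> fst (torus_chart t)" using z by simp
    then obtain X a where X: "open X" "x \<in> X"
      "\<And>y. y \<in> X \<Longrightarrow> torus_exp y \<in> fst (torus_chart t) \<and> snd (torus_chart t) (torus_exp y) = y + a"
      using torus_exp_chart by blast
    have o: "open (X \<inter> torus_box s)" using X(1) open_torus_box by blast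
    have "smooth_on (snd d \<circ> chart_inv c) (X \<inter> torus_box s)"
      by (rule smooth_on_cong[OF o _ smooth_on_add[OF o smooth_on_id[OF o] smooth_on_const[OF o, of a]]])
        (use X(3) in \<open>auto simp: st chart_inv_torus\<close>)
    then show "\<exists>T. open T \<and> x \<in> T \<and> smooth_on (snd d \<circ> chart_inv c) T"
      using o X(2) x(1) by blast
  qed
  show ?thesis unfolding smooth_atlas_def using cover charts trans by blast
qed

lemma torus_exp_in_torus: "torus_exp x \<in> mpoints torus"
  by (simp add: mpoints_torus torus_exp_def)

lemma smooth_at_torus_exp: "smooth_at euclid torus torus_exp x"
proof -
  obtain d where d: "d \<in> atlas torus" "torus_exp x \<in> fst d"
    using charts_at_nonempty[OF smooth_atlas_torus torus_exp_in_torus] by metis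
  then obtain t where t: "d = torus_chart t" unfolding atlas_torus by blast
  obtain X a where X: "open X" "x \<in> X"
    "\<And>y. y \<in> X \<Longrightarrow> torus_exp y \<in> fst (torus_chart t) \<and> snd (torus_chart t) (torus_exp y) = y + a"
    using torus_exp_chart d(2) t by blast
  show ?thesis
    by (rule smooth_at_euclidI[OF smooth_atlas_torus X(1,2) d(1)])
      (use X(3) smooth_on_cong[OF X(1) _ smooth_on_add[OF X(1) smooth_on_id[OF X(1)] smooth_on_const[OF X(1), of a]]]
       in \<open>auto simp: t\<close>)
qed

lemma Hausdorff_torus: "Hausdorff_space (mtop torus)"
  unfolding mtop_torus by (simp add: Hausdorff_space_subtopology)

lemma connected_torus: "connected_space (mtop (torus :: (complex^'k, real^'k) manifold))"
proof -
  have "torus_exp ` UNIV = {z :: complex^'k. \<forall>i. norm (z $ i) = 1}"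
  proof (intro subset_antisym subsetI)
    fix z :: "complex^'k" assume z: "z \<in> {z. \<forall>i. norm (z $ i) = 1}"
    have "z = torus_exp (\<chi> i. Arg (z $ i))"
      unfolding torus_exp_def vec_eq_iff
    proof
      fix i
      have "norm (z $ i) = 1" using z by simp
      moreover from this have "z $ i \<noteq> 0" by (metis norm_zero zero_neq_one)
      ultimately show "z $ i = (\<chi> i. cis ((\<chi> i. Arg (z $ i)) $ i)) $ i"
        using cis_Arg[of "z $ i"] by (simp add: sgn_div_norm)
    qed
    then show "z \<in> range torus_exp" by blast
  qed (auto simp: torus_exp_def)
  then have "connected {z :: complex^'k. \<forall>i. norm (z $ i) = 1}"
    using connected_continuous_image[OF continuous_on_torus_exp connected_UNIV] by metis
  then show ?thesis unfolding mtop_torus by (simp add: connected_space_subtopology connectedin_iff_connected)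
qed

text \<open>Torus charts only add a constant to the local lift \<open>g\<close>, so surjectivity may
  be checked on the derivative of \<open>g\<close>, where all coordinates are real
  functions.\<close>

lemma regular_at_torus:
  fixes M :: "('a, 'e::euclidean_space) manifold" and g :: "'a \<Rightarrow> real^'k"
  assumes M: "smooth_atlas M" and W: "openin (mtop M) W" "p \<in> W" "\<And>q. q \<in> W \<Longrightarrow> f q = torus_exp (g q)"
    and g: "smooth_at M euclid g p" and c: "c \<in> charts_at M p"
    and der: "((\<lambda>x. g (chart_inv c x)) has_derivative D) (at (snd c p))" and surj: "surj D"
  shows "regular_at M torus f p"
proof -
  have c': "c \<in> atlas M" "p \<in> fst c" using c by (auto simp: charts_at_iff)
  have sm: "smooth_at M torus f p"
    by (rule smooth_at_cong[OF M smooth_atlas_torus _ W(1,2), of "\<lambda>q. torus_exp (g q)"])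
      (use W(3) in \<open>auto intro: smooth_at_compose[OF M smooth_atlas_euclid smooth_atlas_torus g smooth_at_torus_exp]\<close>)
  obtain d where d: "d \<in> charts_at torus (f p)"
    using charts_at_nonempty[OF smooth_atlas_torus] smooth_at_mem[OF sm] by metis
  then obtain t where t: "d = torus_chart t" "torus_exp (g p) \<in> fst (torus_chart t)"
    using W by (auto simp: charts_at_iff atlas_torus)
  obtain X a where X: "open X" "g p \<in> X"
    "\<And>y. y \<in> X \<Longrightarrow> torus_exp y \<in> fst (torus_chart t) \<and> snd (torus_chart t) (torus_exp y) = y + a"
    using torus_exp_chart[OF t(2)] by blast
  obtain W' where W': "openin (mtop M) W'" "p \<in> W'" "\<And>q. q \<in> W' \<Longrightarrow> g q \<in> X"
    using smooth_at_continuous[OF g, of X] X by auto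
  have o: "open (snd c ` (fst c \<inter> (W \<inter> W')))"
    by (rule open_chart_img[OF M c'(1)]) (use W W' in auto)
  have "((\<lambda>x. g (chart_inv c x) + a) has_derivative D) (at (snd c p))"
    using has_derivative_add[OF der has_derivative_const[of a]] by simp
  then have "(map_in_charts c d f has_derivative D) (at (snd c p))"
  proof (rule has_derivative_transform_within_open[OF _ o])
    show "snd c p \<in> snd c ` (fst c \<inter> (W \<inter> W'))" using c' W W' by auto
    fix x assume "x \<in> snd c ` (fst c \<inter> (W \<inter> W'))"
    then have "chart_inv c x \<in> W" "chart_inv c x \<in> W'" using chart_inv_chart[OF M c'(1)] by auto
    then show "g (chart_inv c x) + a = map_in_charts c d f x"
      using W(3) W'(3) X(3) by (simp add: map_in_charts_def t(1))
  qed
  then have "frechet_derivative (map_in_charts c d f) (at (snd c p)) = D"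
    using frechet_derivative_at by metis
  then show ?thesis
    using regular_atI[OF M smooth_atlas_torus sm c d] surj by simp
qed

section \<open>Primitives of closed forms\<close>

text \<open>The derivative is prescribed in every chart around the point, so primitives built in
  different charts can be compared in a common one.\<close>

definition primitive_on ::
  "('a, 'e::euclidean_space) manifold \<Rightarrow> ('a, 'e) form1 \<Rightarrow> 'a set \<Rightarrow> ('a \<Rightarrow> real) \<Rightarrow> bool" where
  "primitive_on M \<beta> U F \<longleftrightarrow> openin (mtop M) U \<and>
    (\<forall>p\<in>U. smooth_at M euclid F p \<and> (\<forall>c\<in>charts_at M p.
      ((\<lambda>x. F (chart_inv c x)) has_derivative (\<lambda>w. \<beta> p (tangent_of_coords M c p w))) (at (snd c p))))"

lemma primitive_on_subset:
  "primitive_on M \<beta> U F \<Longrightarrow> openin (mtop M) U' \<Longrightarrow> U' \<subseteq> U \<Longrightarrow> primitive_on M \<beta> U' F"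
  unfolding primitive_on_def by blast

lemma linear_form_in_chart:
  assumes M: "smooth_atlas M" and \<beta>: "smooth_form1 M \<beta>" and c: "c \<in> atlas M" "x \<in> chart_image c"
  shows "linear (\<lambda>w. form_in_chart M \<beta> c w x)"
proof -
  let ?q = "chart_inv c x"
  have c': "c \<in> charts_at M ?q" using c chart_inv_in[of x c] by (simp add: charts_at_iff)
  have q: "?q \<in> mpoints M" using c chart_inv_in[of x c] chart_subset[OF M c(1)] by blast
  have "form_in_chart M \<beta> c (a *\<^sub>R u + b *\<^sub>R w) x = a * form_in_chart M \<beta> c u x + b * form_in_chart M \<beta> c w x" for a b u w
    using \<beta> q tangent_of_coords_in[OF M q c'] unfolding smooth_form1_def form_in_chart_def
      tangent_of_coords_linear[OF M q c'] by blast
  from this[of 1 _ 1] this[of _ _ 0 0] show ?thesis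
    by (intro linearI) simp_all
qed

lemma form_in_chart_at:
  assumes "smooth_atlas M" "c \<in> charts_at M p"
  shows "form_in_chart M \<beta> c w (snd c p) = \<beta> p (tangent_of_coords M c p w)"
  using assms chart_inv_chart[OF assms(1), of c p] by (simp add: form_in_chart_def charts_at_iff)

text \<open>On a coordinate ball this is the Poincare lemma. The chain rule along a coordinate
  change turns the derivative into the one required in any other chart, because both coordinate
  vectors describe the same tangent vector.\<close>

lemma primitive_exists:
  assumes M: "smooth_atlas M" and \<beta>: "closed_form1 M \<beta>" and p: "p \<in> mpoints M"
  obtains U F where "p \<in> U" "primitive_on M \<beta> U F"
proof -
  obtain c where c: "c \<in> atlas M" "p \<in> fst c" using charts_at_nonempty[OF M p] by metis
  obtain r where r: "r > 0" "ball (snd c p) r \<subseteq> chart_image c"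
    using open_chart_image[OF M c(1)] chart_in[OF c(2)] open_contains_ball by blast
  define B where "B = ball (snd c p) r"
  define \<omega> where "\<omega> w x = form_in_chart M \<beta> c w x" for w x
  have sf: "smooth_form1 M \<beta>" using \<beta> by (simp add: closed_form1_def)
  have B: "open B" "convex B" "snd c p \<in> B" "B \<subseteq> chart_image c" using r by (auto simp: B_def)
  have 1: "smooth_on (\<omega> w) B" for w
  proof -
    have "smooth_on (form_in_chart M \<beta> c w) (chart_image c)"
      using sf c(1) unfolding smooth_form1_def by blast
    then show ?thesis unfolding \<omega>_def using B(4) by (rule smooth_on_subset)
  qed
  have 2: "linear (\<lambda>w. \<omega> w x)" if "x \<in> B" for x
    unfolding \<omega>_def using linear_form_in_chart[OF M sf c(1)] that B(4) by blast
  have 3: "frechet_derivative (\<omega> v) (at x) u = frechet_derivative (\<omega> u) (at x) v" if "x \<in> B" for x u v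
  proof -
    have "ext_deriv_in_chart M \<beta> c x u v = 0"
      using \<beta> c(1) that B(4) unfolding closed_form1_def by blast
    then show ?thesis unfolding ext_deriv_in_chart_def \<omega>_def by simp
  qed
  obtain F0 where F0: "smooth_on F0 B" "\<And>x. x \<in> B \<Longrightarrow> (F0 has_derivative (\<lambda>w. \<omega> w x)) (at x)"
    using poincare_lemma[OF B(1-3) 1 2 3] by metis
  define F where "F q = F0 (snd c q)" for q
  define U where "U = {q \<in> fst c. snd c q \<in> B}"
  have "primitive_on M \<beta> U F"
    unfolding primitive_on_def
  proof (intro conjI ballI)
    show "openin (mtop M) U" unfolding U_def by (rule openin_chart_preimage[OF M c(1) B(1)])
    fix q assume "q \<in> U"
    then have q: "q \<in> fst c" "snd c q \<in> B" by (auto simp: U_def)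
    then have qM: "q \<in> mpoints M" and cq: "c \<in> charts_at M q"
      using chart_subset[OF M c(1)] c(1) by (auto simp: charts_at_iff)
    show "smooth_at M euclid F q"
      unfolding F_def by (rule smooth_at_compose_euclid[OF M smooth_at_chart[OF M c(1) q(1)] F0(1) B(1) q(2)])
    fix c' assume c': "c' \<in> charts_at M q"
    let ?t = "map_in_charts c' c (\<lambda>q. q)"
    have tx: "?t (snd c' q) = snd c q"
      using c' chart_inv_chart[OF M, of c' q] by (simp add: map_in_charts_def charts_at_iff)
    have "(?t has_derivative coord_change_deriv c' c q) (at (snd c' q))"
      unfolding coord_change_deriv_eq
      using smooth_at_has_derivative[OF M M smooth_at_ident[OF M qM] c' cq] .
    moreover have "(F0 has_derivative (\<lambda>w. \<omega> w (snd c q))) (at (?t (snd c' q)))"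
      using F0(2)[OF q(2)] by (simp add: tx)
    ultimately have "((\<lambda>x. F0 (?t x)) has_derivative (\<lambda>w. \<omega> (coord_change_deriv c' c q w) (snd c q))) (at (snd c' q))"
      by (rule has_derivative_compose)
    moreover have "\<omega> (coord_change_deriv c' c q w) (snd c q) = \<beta> q (tangent_of_coords M c' q w)" for w
      unfolding \<omega>_def form_in_chart_at[OF M cq] tangent_of_coords_change[OF M qM c' cq] ..
    ultimately show "((\<lambda>x. F (chart_inv c' x)) has_derivative (\<lambda>w. \<beta> q (tangent_of_coords M c' q w))) (at (snd c' q))"
      by (simp add: F_def map_in_charts_def)
  qed
  moreover have "p \<in> U" using c B by (simp add: U_def)
  ultimately show thesis using that by blast
qed

lemma primitive_diff_locally_constant:
  assumes M: "smooth_atlas M" and F: "primitive_on M \<beta> U F" and F': "primitive_on M \<beta> U' F'"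
    and p: "p \<in> U" "p \<in> U'"
  obtains W where "openin (mtop M) W" "p \<in> W" "W \<subseteq> U \<inter> U'" "\<And>q. q \<in> W \<Longrightarrow> F q - F' q = F p - F' p"
proof -
  have oU: "openin (mtop M) (U \<inter> U')" using F F' by (auto simp: primitive_on_def)
  then have "p \<in> mpoints M" using p openin_subset by blast
  then obtain c where c: "c \<in> atlas M" "p \<in> fst c" using charts_at_nonempty[OF M] by metis
  have "open (snd c ` (fst c \<inter> (U \<inter> U')))" by (rule open_chart_img[OF M c(1) oU])
  then obtain r where r: "r > 0" "ball (snd c p) r \<subseteq> snd c ` (fst c \<inter> (U \<inter> U'))"
    using c p open_contains_ball by blast
  let ?g = "\<lambda>x. F (chart_inv c x) - F' (chart_inv c x)"
  have "\<exists>k. \<forall>x\<in>ball (snd c p) r. ?g x = k"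
  proof (rule has_derivative_zero_constant[OF convex_ball])
    fix x assume "x \<in> ball (snd c p) r"
    then obtain q where q: "x = snd c q" "q \<in> fst c" "q \<in> U" "q \<in> U'" using r by blast
    have cq: "c \<in> charts_at M q" using c q by (simp add: charts_at_iff)
    have "((\<lambda>x. F (chart_inv c x)) has_derivative (\<lambda>w. \<beta> q (tangent_of_coords M c q w))) (at x)"
      "((\<lambda>x. F' (chart_inv c x)) has_derivative (\<lambda>w. \<beta> q (tangent_of_coords M c q w))) (at x)"
      using F F' q cq unfolding primitive_on_def by blast+
    from has_derivative_diff[OF this] show "(?g has_derivative (\<lambda>h. 0)) (at x within ball (snd c p) r)"
      by (simp add: has_derivative_at_withinI)
  qed
  then obtain k where k: "\<And>x. x \<in> ball (snd c p) r \<Longrightarrow> ?g x = k" by blast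
  define W where "W = {q \<in> fst c. snd c q \<in> ball (snd c p) r}"
  have Wk: "F q - F' q = k" if "q \<in> W" for q
    using k[of "snd c q"] that chart_inv_chart[OF M c(1), of q] by (simp add: W_def)
  show thesis
  proof (rule that[of W])
    show "openin (mtop M) W" unfolding W_def by (rule openin_chart_preimage[OF M c(1)]) simp
    show pW: "p \<in> W" using c r by (simp add: W_def)
    show "W \<subseteq> U \<inter> U'"
    proof
      fix q assume q: "q \<in> W"
      then obtain q' where "snd c q = snd c q'" "q' \<in> fst c" "q' \<in> U \<inter> U'" using r by (auto simp: W_def)
      then show "q \<in> U \<inter> U'" using q inj_on_chart[OF M c(1)] by (auto simp: W_def dest: inj_onD)
    qed
    show "F q - F' q = F p - F' p" if "q \<in> W" for q using Wk that pW by simp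
  qed
qed

text \<open>The difference is locally constant, and a compact set is covered by finitely many
  neighbourhoods on which it is constant. On the open overlap itself there may be infinitely many
  values.\<close>

lemma primitive_diff_finite:
  assumes M: "smooth_atlas M" and F: "primitive_on M \<beta> U F" and F': "primitive_on M \<beta> U' F'"
    and C: "compactin (mtop M) C" "C \<subseteq> U \<inter> U'"
  shows "finite ((\<lambda>q. F q - F' q) ` C)"
proof -
  have "\<exists>W. openin (mtop M) W \<and> p \<in> W \<and> (\<forall>q\<in>W. F q - F' q = F p - F' p)" if "p \<in> C" for p
    using primitive_diff_locally_constant[OF M F F', of p] that C(2) by (metis IntD1 IntD2 subsetD)
  then obtain W where W: "\<And>p. p \<in> C \<Longrightarrow> openin (mtop M) (W p) \<and> p \<in> W p \<and> (\<forall>q\<in>W p. F q - F' q = F p - F' p)"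
    by metis
  obtain I where I: "finite I" "I \<subseteq> C" "C \<subseteq> (\<Union>p\<in>I. W p)"
    using compactin_finite_cover[OF C(1), of W] W by blast
  have "(\<lambda>q. F q - F' q) ` C \<subseteq> (\<lambda>q. F q - F' q) ` I"
  proof
    fix s assume "s \<in> (\<lambda>q. F q - F' q) ` C"
    then obtain q where q: "q \<in> C" "s = F q - F' q" by blast
    then obtain p where p: "p \<in> I" "q \<in> W p" using I(3) by blast
    then have "s = F p - F' p" using q W[of p] I(2) by blast
    then show "s \<in> (\<lambda>q. F q - F' q) ` I" using p(1) by blast
  qed
  then show ?thesis using I(1) finite_surj by blast
qed

section \<open>Smooth partitions of unity\<close>

definition partition_of_unity ::
  "('a, 'e::euclidean_space) manifold \<Rightarrow> 'a set \<Rightarrow> ('a \<Rightarrow> 'a set) \<Rightarrow> ('a \<Rightarrow> 'a set) \<Rightarrow> ('a \<Rightarrow> 'a \<Rightarrow> real) \<Rightarrow> bool" where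
  "partition_of_unity M J K V \<rho> \<longleftrightarrow> finite J \<and> J \<subseteq> mpoints M \<and> mpoints M = (\<Union>j\<in>J. V j) \<and>
    (\<forall>j\<in>J. closedin (mtop M) (K j) \<and> openin (mtop M) (V j) \<and> V j \<subseteq> K j) \<and>
    (\<forall>j\<in>J. \<forall>q\<in>mpoints M. smooth_at M euclid (\<rho> j) q) \<and>
    (\<forall>j\<in>J. \<forall>q. q \<notin> K j \<longrightarrow> \<rho> j q = 0) \<and>
    (\<forall>q\<in>mpoints M. (\<Sum>j\<in>J. \<rho> j q) = 1)"

text \<open>Finitely many bumps are divided by their sum. The sum is positive because each point
  lies in some \<open>V j\<close>, where one bump equals 1 and the others are nonnegative.\<close>

lemma partition_of_unity_exists:
  assumes M: "smooth_atlas M" and H: "Hausdorff_space (mtop M)" and comp: "compact_space (mtop M)"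
    and U: "\<And>p. p \<in> mpoints M \<Longrightarrow> openin (mtop M) (U p) \<and> p \<in> U p"
  obtains J K V \<rho> where "partition_of_unity M J K V \<rho>" "\<And>j. j \<in> J \<Longrightarrow> K j \<subseteq> U j"
proof -
  have "\<exists>h K V. bump_at M (U p) p h K V" if "p \<in> mpoints M" for p
    using manifold_bump[OF M H, of "U p" p] U[OF that] by blast
  then obtain h K V where bump: "\<And>p. p \<in> mpoints M \<Longrightarrow> bump_at M (U p) p (h p) (K p) (V p)" by metis
  note g = bump[unfolded bump_at_def]
  have "openin (mtop M) (V q) \<and> q \<in> V q" if "q \<in> mpoints M" for q using g[OF that] by blast
  then obtain J where J: "finite J" "J \<subseteq> mpoints M" "mpoints M \<subseteq> (\<Union>j\<in>J. V j)"
    using compactin_finite_cover[of "mtop M" "mpoints M" V] comp unfolding compact_space_def by metis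
  have VM: "V j \<subseteq> mpoints M" if "j \<in> J" for j
  proof -
    have "openin (mtop M) (V j)" using g[of j] J(2) that by blast
    then show ?thesis by (rule openin_subset)
  qed
  define s where "s q = (\<Sum>j\<in>J. h j q)" for q
  have spos: "s q > 0" if q: "q \<in> mpoints M" for q
  proof -
    obtain j where j: "j \<in> J" "q \<in> V j" using J(3) q by blast
    then have "h j q = 1" using g[of j] J(2) by blast
    moreover have "h j q \<le> s q"
      unfolding s_def using J(1,2) j(1) g by (intro member_le_sum) blast+
    ultimately show ?thesis by simp
  qed
  have hs: "smooth_at M euclid (h j) q" if "j \<in> J" "q \<in> mpoints M" for j q
    using g[of j] J(2) that by blast
  have ssm: "smooth_at M euclid s q" if "q \<in> mpoints M" for q
    unfolding s_def by (rule smooth_at_sum[OF M that]) (rule hs[OF _ that])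
  define \<rho> where "\<rho> j q = h j q / s q" for j q
  have "partition_of_unity M J K V \<rho>"
    unfolding partition_of_unity_def
  proof (intro conjI ballI allI impI J(1,2))
    show "mpoints M = (\<Union>j\<in>J. V j)" using J(3) VM by blast
  next
    fix j assume j: "j \<in> J"
    show "closedin (mtop M) (K j)" "openin (mtop M) (V j)" "V j \<subseteq> K j" using g[of j] j J(2) by blast+
    show "\<rho> j q = 0" if "q \<notin> K j" for q using g[of j] j J(2) that by (auto simp: \<rho>_def)
    show "smooth_at M euclid (\<rho> j) q" if q: "q \<in> mpoints M" for q
    proof -
      have "s q \<noteq> 0" using spos[OF q] by simp
      then show ?thesis unfolding \<rho>_def by (rule smooth_at_divide[OF M hs[OF j q] ssm[OF q]])
    qed
  next
    fix q assume q: "q \<in> mpoints M"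
    have "(\<Sum>j\<in>J. \<rho> j q) = (\<Sum>j\<in>J. h j q) / s q" unfolding \<rho>_def by (rule sum_divide_distrib[symmetric])
    also have "\<dots> = s q / s q" by (simp add: s_def)
    finally show "(\<Sum>j\<in>J. \<rho> j q) = 1" using spos[OF q] by simp
  qed
  moreover have "K j \<subseteq> U j" if "j \<in> J" for j using g[of j] J(2) that by blast
  ultimately show thesis using that by blast
qed

subsection \<open>Making the periods integral\<close>

text \<open>For primitives \<open>F i\<close> of a form, the \<open>G i\<close> are real lifts over
  \<open>V i\<close> of a single map to the circle. Near each point the derivative of
  \<open>G i\<close> is 2 pi times the sum of \<open>D\<close> times the form and a small
  combination of the differentials of the \<open>\<rho> j\<close>. The coefficients \<open>k\<close>
  are constant near the point, so they are not differentiated.\<close>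

definition circle_potential ::
  "('a, 'e::euclidean_space) manifold \<Rightarrow> 'a set \<Rightarrow> ('a \<Rightarrow> 'a set) \<Rightarrow> ('a \<Rightarrow> 'a \<Rightarrow> real) \<Rightarrow> ('a \<Rightarrow> 'a \<Rightarrow> real) \<Rightarrow>
    real \<Rightarrow> real \<Rightarrow> ('a \<Rightarrow> 'a \<Rightarrow> real) \<Rightarrow> bool" where
  "circle_potential M J V \<rho> F \<epsilon> D G \<longleftrightarrow> D \<ge> 1 \<and>
    (\<forall>i\<in>J. \<forall>l\<in>J. \<forall>p\<in>V i \<inter> V l. cis (G i p) = cis (G l p)) \<and>
    (\<forall>i\<in>J. \<forall>p\<in>V i. \<exists>k W. (\<forall>j\<in>J. \<bar>k j\<bar> \<le> \<epsilon>) \<and> openin (mtop M) W \<and> p \<in> W \<and>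
      (\<forall>q\<in>W. G i q = 2 * pi * (D * F i q + (\<Sum>j\<in>J. k j * \<rho> j q))))"

text \<open>The rounding errors \<open>\<delta>\<close> below satisfy the cocycle condition because an integer of absolute value
  below 1 vanishes, so no basis of the group of periods is needed.\<close>

lemma integral_periods:
  fixes M :: "('a, 'e::euclidean_space) manifold"
  assumes M: "smooth_atlas M" and comp: "compact_space (mtop M)"
    and pou: "partition_of_unity M J K V \<rho>"
    and F: "\<And>j. j \<in> J \<Longrightarrow> primitive_on M \<beta> (U j) (F j)" and KU: "\<And>j. j \<in> J \<Longrightarrow> K j \<subseteq> U j"
    and \<epsilon>: "\<epsilon> > 0"
  shows "\<exists>D G. circle_potential M J V \<rho> F \<epsilon> D G"
proof -
  have J: "finite J" and cov: "mpoints M = (\<Union>j\<in>J. V j)"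
    and KV: "\<And>j. j \<in> J \<Longrightarrow> closedin (mtop M) (K j) \<and> openin (mtop M) (V j) \<and> V j \<subseteq> K j"
    and \<rho>0: "\<And>j q. j \<in> J \<Longrightarrow> q \<notin> K j \<Longrightarrow> \<rho> j q = 0"
    and \<rho>1: "\<And>q. q \<in> mpoints M \<Longrightarrow> (\<Sum>j\<in>J. \<rho> j q) = 1"
    using pou unfolding partition_of_unity_def by blast+
  \<comment> \<open>All constants by which primitives differ over the closed pieces; compactness of
    \<open>K i \<inter> K l\<close> makes this set finite.\<close>
  define S where "S = (\<Union>i\<in>J. \<Union>l\<in>J. (\<lambda>q. F i q - F l q) ` (K i \<inter> K l))"
  have "finite ((\<lambda>q. F i q - F l q) ` (K i \<inter> K l))" if "i \<in> J" "l \<in> J" for i l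
  proof (rule primitive_diff_finite[OF M F[OF that(1)] F[OF that(2)]])
    show "compactin (mtop M) (K i \<inter> K l)"
      using KV that comp by (simp add: closedin_compact_space closedin_Int)
  qed (use KU that in blast)
  then have "finite S" unfolding S_def using J by blast
  then obtain n :: nat and \<theta> where \<theta>: "S = \<theta> ` {i. i < n}"
    using finite_imp_nat_seg_image_inj_on by metis
  \<comment> \<open>The bound \<open>\<epsilon>\<close> limits the perturbation of the form; 1/8
    leaves room for three rounding errors to add up to less than 1 in the cocycle identity.\<close>
  obtain N :: nat where N: "inverse (of_nat (Suc N)) < min \<epsilon> (1/8)"
    using reals_Archimedean[of "min \<epsilon> (1/8)"] \<epsilon> by auto
  obtain q m where q: "0 < q" and qm: "\<And>i. i < n \<Longrightarrow> \<bar>of_int q * \<theta> i - of_int (m i)\<bar> < 1 / real (Suc N)"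
    by (rule Dirichlet_approx_simult[of "Suc N" n \<theta>]) auto
  define D where "D = real_of_int q"
  have D: "D \<ge> 1" using q by (simp add: D_def)
  define \<delta> where "\<delta> x = of_int (round x) - x" for x :: real
  have \<delta>S: "\<bar>\<delta> (D * s)\<bar> < min \<epsilon> (1/8)" if s: "s \<in> S" for s
  proof -
    obtain i where i: "i < n" "s = \<theta> i" using s \<theta> by blast
    have "\<bar>\<delta> (D * s)\<bar> \<le> \<bar>D * s - of_int (m i)\<bar>"
      unfolding \<delta>_def using round_diff_minimal[of "D * s" "m i"] by (simp add: abs_minus_commute)
    also have "\<dots> < 1 / real (Suc N)" using qm[OF i(1)] by (simp add: D_def i(2))
    also have "\<dots> < min \<epsilon> (1/8)" using N by (simp add: inverse_eq_divide)
    finally show ?thesis .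
  qed
  have Smem: "F i p - F l p \<in> S" if "i \<in> J" "l \<in> J" "p \<in> K i" "p \<in> K l" for i l p
    using that unfolding S_def by blast
  have cocycle: "\<delta> (D * (F i p - F j p)) - \<delta> (D * (F l p - F j p)) = \<delta> (D * (F i p - F l p))"
    if "i \<in> J" "l \<in> J" "j \<in> J" "p \<in> K i" "p \<in> K l" "p \<in> K j" for i l j p
  proof -
    let ?a = "D * (F i p - F j p)" and ?b = "D * (F l p - F j p)" and ?c = "D * (F i p - F l p)"
    have "\<bar>\<delta> ?a\<bar> < 1/8" "\<bar>\<delta> ?b\<bar> < 1/8" "\<bar>\<delta> ?c\<bar> < 1/8"
      using \<delta>S Smem that by (metis min_less_iff_conj)+
    then have "\<bar>\<delta> ?a - \<delta> ?b - \<delta> ?c\<bar> < 1" by linarith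
    moreover have eq: "\<delta> ?a - \<delta> ?b - \<delta> ?c = of_int (round ?a - round ?b - round ?c)"
      by (simp add: \<delta>_def algebra_simps)
    ultimately have "\<bar>real_of_int (round ?a - round ?b - round ?c)\<bar> < 1" by metis
    then have "round ?a - round ?b - round ?c = 0" by linarith
    with eq show ?thesis by simp
  qed
  \<comment> \<open>Since \<open>D * (F i p - F j p)\<close> plus its rounding error is an integer,
    the bracket is the average, with weights \<open>\<rho> j p\<close>, of the numbers
    \<open>D * F j p\<close> each shifted by an integer. Passing from \<open>i\<close> to
    \<open>l\<close> changes all relevant shifts by the same integer.\<close>
  define G where "G i p = 2 * pi * (D * F i p + (\<Sum>j\<in>J. \<delta> (D * (F i p - F j p)) * \<rho> j p))" for i p
  have "cis (G i p) = cis (G l p)" if il: "i \<in> J" "l \<in> J" "p \<in> V i" "p \<in> V l" for i l p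
  proof -
    let ?c = "D * (F i p - F l p)"
    have pK: "p \<in> K i" "p \<in> K l" using KV il by blast+
    have pM: "p \<in> mpoints M" using cov il by blast
    have "(\<Sum>j\<in>J. \<delta> (D * (F i p - F j p)) * \<rho> j p) - (\<Sum>j\<in>J. \<delta> (D * (F l p - F j p)) * \<rho> j p)
        = (\<Sum>j\<in>J. (\<delta> (D * (F i p - F j p)) - \<delta> (D * (F l p - F j p))) * \<rho> j p)"
      by (simp add: sum_subtractf left_diff_distrib)
    also have "\<dots> = (\<Sum>j\<in>J. \<delta> ?c * \<rho> j p)"
    proof (rule sum.cong[OF refl])
      fix j assume j: "j \<in> J"
      \<comment> \<open>The cocycle identity is available only in \<open>K j\<close>; elsewhere the
        weight vanishes.\<close>
      show "(\<delta> (D * (F i p - F j p)) - \<delta> (D * (F l p - F j p))) * \<rho> j p = \<delta> ?c * \<rho> j p"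
        using cocycle[OF il(1,2) j pK] \<rho>0[OF j, of p] by (cases "p \<in> K j") simp_all
    qed
    also have "\<dots> = \<delta> ?c" using \<rho>1[OF pM] by (simp flip: sum_distrib_left)
    finally have "G i p - G l p = 2 * pi * (?c + \<delta> ?c)"
      by (simp add: G_def algebra_simps)
    also have "?c + \<delta> ?c = of_int (round ?c)" by (simp add: \<delta>_def)
    finally have "G i p = 2 * pi * of_int (round ?c) + G l p" by simp
    then have "cis (G i p) = cis (2 * pi * of_int (round ?c)) * cis (G l p)"
      by (simp only: cis_mult)
    also have "cis (2 * pi * of_int (round ?c)) = 1" by (rule cis_multiple_2pi) simp
    finally show ?thesis by simp
  qed
  moreover have "\<exists>k W. (\<forall>j\<in>J. \<bar>k j\<bar> \<le> \<epsilon>) \<and> openin (mtop M) W \<and> p \<in> W \<and>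
      (\<forall>q\<in>W. G i q = 2 * pi * (D * F i q + (\<Sum>j\<in>J. k j * \<rho> j q)))" if i: "i \<in> J" and p: "p \<in> V i" for i p
  proof -
    have pM: "p \<in> mpoints M" using cov i p by blast
    have pK: "p \<in> K i" using KV i p by blast
    \<comment> \<open>The rounding error is frozen at its value in \<open>p\<close>. If
      \<open>p\<close> is outside the closed set \<open>K j\<close>, the weight
      \<open>\<rho> j\<close> vanishes near \<open>p\<close>; the default 0 keeps the bound by
      \<open>\<epsilon>\<close> even where the error is not controlled.\<close>
    define k where "k j = (if p \<in> K j then \<delta> (D * (F i p - F j p)) else 0)" for j
    have kb: "\<bar>k j\<bar> \<le> \<epsilon>" if "j \<in> J" for j
      using \<delta>S[OF Smem[OF i that pK]] \<epsilon> by (auto simp: k_def)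
    have "\<exists>W. openin (mtop M) W \<and> p \<in> W \<and> (\<forall>q\<in>W. \<delta> (D * (F i q - F j q)) * \<rho> j q = k j * \<rho> j q)" if j: "j \<in> J" for j
    proof (cases "p \<in> K j")
      case True
      then have pU: "p \<in> U i" "p \<in> U j" using KU i j pK by blast+
      obtain W where W: "openin (mtop M) W" "p \<in> W" "\<forall>q\<in>W. F i q - F j q = F i p - F j p"
        by (rule primitive_diff_locally_constant[OF M F[OF i] F[OF j] pU]) blast
      have "\<delta> (D * (F i q - F j q)) = k j" if "q \<in> W" for q
        using bspec[OF W(3) that] True unfolding k_def by presburger
      then show ?thesis using W(1,2) by auto
    next
      case False
      then show ?thesis
        using KV[OF j] pM \<rho>0[OF j] by (intro exI[of _ "mpoints M - K j"]) auto
    qed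
    then obtain W where W: "\<And>j. j \<in> J \<Longrightarrow> openin (mtop M) (W j) \<and> p \<in> W j \<and>
        (\<forall>q\<in>W j. \<delta> (D * (F i q - F j q)) * \<rho> j q = k j * \<rho> j q)" by metis
    let ?W = "\<Inter>j\<in>J. W j"
    have "J \<noteq> {}" using i by blast
    then have "openin (mtop M) ?W" using W J by (intro openin_INT2) blast+
    moreover have "p \<in> ?W" using W by blast
    moreover have "G i q = 2 * pi * (D * F i q + (\<Sum>j\<in>J. k j * \<rho> j q))" if "q \<in> ?W" for q
    proof -
      have "(\<Sum>j\<in>J. \<delta> (D * (F i q - F j q)) * \<rho> j q) = (\<Sum>j\<in>J. k j * \<rho> j q)"
        using W that by (intro sum.cong) blast+
      then show ?thesis by (simp add: G_def)
    qed
    ultimately show ?thesis using kb by blast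
  qed
  ultimately show ?thesis unfolding circle_potential_def using D by blast
qed

section \<open>Perturbing linearly independent families\<close>

text \<open>In the application \<open>N a\<close> is the coefficient vector of the form with index
  \<open>a\<close> and \<open>R j\<close> the gradient of \<open>\<rho> j\<close>, both in one
  chart. As \<open>k\<close> is chosen after the point, coefficients that vary from point to point
  are covered.\<close>

definition stably_independent ::
  "'e set \<Rightarrow> 'j set \<Rightarrow> ('k::finite \<Rightarrow> 'e \<Rightarrow> 'f::euclidean_space) \<Rightarrow> ('j \<Rightarrow> 'e \<Rightarrow> 'f) \<Rightarrow> real \<Rightarrow> bool" where
  "stably_independent X J N R \<epsilon> \<longleftrightarrow> (\<forall>x\<in>X. \<forall>k. \<forall>u :: real^'k. (\<forall>a. \<forall>j\<in>J. \<bar>k a j\<bar> \<le> \<epsilon>) \<longrightarrow>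
    (\<Sum>a\<in>UNIV. u $ a *\<^sub>R (N a x + (\<Sum>j\<in>J. k a j *\<^sub>R R j x))) = 0 \<longrightarrow> u = 0)"

lemma stably_independent_mono:
  assumes "stably_independent X J N R \<epsilon>" "\<epsilon>' \<le> \<epsilon>"
  shows "stably_independent X J N R \<epsilon>'"
  using assms(1) order_trans[OF _ assms(2)] unfolding stably_independent_def by blast

text \<open>On the compact product of the unit sphere with \<open>X\<close> the norm of the
  combination has a positive minimum \<open>m\<close>. The perturbation of a unit combination is
  bounded by a multiple of \<open>\<epsilon>\<close>, so a small \<open>\<epsilon>\<close> cannot
  bring it to zero.\<close>

lemma independent_family_perturb:
  fixes N :: "'k::finite \<Rightarrow> 'e::euclidean_space \<Rightarrow> 'f::euclidean_space" and R :: "'j \<Rightarrow> 'e \<Rightarrow> 'f"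
  assumes X: "compact X" and J: "finite J"
    and N: "\<And>a. continuous_on X (N a)" and R: "\<And>j. j \<in> J \<Longrightarrow> continuous_on X (R j)"
    and ind: "\<And>x u :: real^'k. x \<in> X \<Longrightarrow> (\<Sum>a\<in>UNIV. u $ a *\<^sub>R N a x) = 0 \<Longrightarrow> u = 0"
  shows "\<exists>\<epsilon>>0. stably_independent X J N R \<epsilon>"
proof (cases "X = {}")
  case True
  then show ?thesis by (intro exI[of _ 1]) (simp add: stably_independent_def)
next
  case False
  let ?h = "\<lambda>z. norm (\<Sum>a\<in>UNIV. fst z $ a *\<^sub>R N a (snd z))"
  let ?Z = "sphere (0 :: real^'k) 1 \<times> X"
  have contN: "continuous_on ?Z (\<lambda>z. N a (snd z))" for a
    by (rule continuous_on_compose2[OF N]) (auto intro!: continuous_intros)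
  have "compact ?Z" "?Z \<noteq> {}" using X False by (auto intro!: compact_Times)
  moreover have "continuous_on ?Z ?h"
    by (intro continuous_intros contN)
  ultimately obtain z0 where z0: "z0 \<in> ?Z" "\<And>z. z \<in> ?Z \<Longrightarrow> ?h z0 \<le> ?h z"
    using continuous_attains_inf[of ?Z ?h] by blast
  define m where "m = ?h z0"
  have m: "m > 0"
  proof (rule ccontr)
    assume "\<not> m > 0"
    then have "(\<Sum>a\<in>UNIV. fst z0 $ a *\<^sub>R N a (snd z0)) = 0" by (simp add: m_def)
    then have "fst z0 = 0" using ind z0(1) by (metis mem_Times_iff)
    then show False using z0(1) by auto
  qed
  have "\<exists>C>0. \<forall>x\<in>X. norm (R j x) \<le> C" if "j \<in> J" for j
    using compact_imp_bounded[OF compact_continuous_image[OF R[OF that] X]] by (auto simp: bounded_pos)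
  then obtain Cj where Cj: "\<And>j. j \<in> J \<Longrightarrow> Cj j > 0 \<and> (\<forall>x\<in>X. norm (R j x) \<le> Cj j)" by metis
  define C where "C = (\<Sum>j\<in>J. Cj j)"
  have C0: "C \<ge> 0" unfolding C_def using Cj by (intro sum_nonneg) (simp add: less_imp_le)
  \<comment> \<open>A unit vector has \<open>CARD('k)\<close> coordinates of size at most 1, so the
    total perturbation is at most \<open>CARD('k) * (\<epsilon> * C) \<le> m / 2\<close>. The added
    1 keeps the denominator positive when \<open>C = 0\<close>.\<close>
  define \<epsilon> where "\<epsilon> = m / (2 * (CARD('k) * C + 1))"
  have den: "CARD('k) * C + 1 > 0" using C0 by (simp add: add_nonneg_pos)
  have \<epsilon>: "\<epsilon> > 0" using m den by (simp add: \<epsilon>_def)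
  have small: "CARD('k) * (\<epsilon> * C) < m"
  proof -
    have "CARD('k) * (\<epsilon> * C) \<le> \<epsilon> * (CARD('k) * C + 1)" using \<epsilon> by (simp add: algebra_simps)
    also have "\<dots> = m / 2" using den by (simp add: \<epsilon>_def field_simps)
    finally show ?thesis using m by linarith
  qed
  show ?thesis
    unfolding stably_independent_def
  proof (intro exI[of _ \<epsilon>] conjI \<epsilon> ballI allI impI, rule ccontr)
    fix x k and u :: "real^'k"
    assume x: "x \<in> X" and k: "\<forall>a. \<forall>j\<in>J. \<bar>k a j\<bar> \<le> \<epsilon>"
      and 0: "(\<Sum>a\<in>UNIV. u $ a *\<^sub>R (N a x + (\<Sum>j\<in>J. k a j *\<^sub>R R j x))) = 0" and u: "u \<noteq> 0"
    define v where "v = (1 / norm u) *\<^sub>R u"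
    have nv: "norm v = 1" using u by (simp add: v_def)
    define E where "E a = (\<Sum>j\<in>J. k a j *\<^sub>R R j x)" for a
    have "(\<Sum>a\<in>UNIV. v $ a *\<^sub>R (N a x + E a)) = (1 / norm u) *\<^sub>R (\<Sum>a\<in>UNIV. u $ a *\<^sub>R (N a x + E a))"
      by (simp add: v_def scaleR_sum_right)
    also have "\<dots> = 0" using 0 by (simp add: E_def)
    finally have "(\<Sum>a\<in>UNIV. v $ a *\<^sub>R N a x) + (\<Sum>a\<in>UNIV. v $ a *\<^sub>R E a) = 0"
      by (simp add: scaleR_add_right sum.distrib)
    then have "norm (\<Sum>a\<in>UNIV. v $ a *\<^sub>R N a x) = norm (\<Sum>a\<in>UNIV. v $ a *\<^sub>R E a)"
      by (metis add_eq_0_iff norm_minus_cancel)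
    moreover have "m \<le> norm (\<Sum>a\<in>UNIV. v $ a *\<^sub>R N a x)"
      using z0(2)[of "(v, x)"] nv x by (simp add: m_def)
    moreover have "norm (\<Sum>a\<in>UNIV. v $ a *\<^sub>R E a) \<le> CARD('k) * (\<epsilon> * C)"
    proof -
      have "norm (E a) \<le> \<epsilon> * C" for a
      proof -
        have "norm (E a) \<le> (\<Sum>j\<in>J. norm (k a j *\<^sub>R R j x))" unfolding E_def by (rule norm_sum)
        also have "\<dots> \<le> (\<Sum>j\<in>J. \<epsilon> * Cj j)"
          using k Cj x \<epsilon> by (intro sum_mono) (auto intro!: mult_mono)
        finally show ?thesis by (simp add: C_def sum_distrib_left)
      qed
      moreover have "\<bar>v $ a\<bar> \<le> 1" for a using component_le_norm_cart[of v a] nv by simp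
      ultimately have "norm (v $ a *\<^sub>R E a) \<le> 1 * (\<epsilon> * C)" for a
        unfolding norm_scaleR by (intro mult_mono) auto
      then have "norm (\<Sum>a\<in>UNIV. v $ a *\<^sub>R E a) \<le> (\<Sum>a\<in>(UNIV::'k set). \<epsilon> * C)"
        by (intro order_trans[OF norm_sum] sum_mono) simp
      then show ?thesis by simp
    qed
    ultimately show False using small by linarith
  qed
qed

text \<open>A vector orthogonal to a proper range is exactly the coefficient vector of a nontrivial
  relation among the \<open>v a\<close>.\<close>

lemma surj_inner_family:
  fixes v :: "'k::finite \<Rightarrow> 'e::euclidean_space"
  assumes "\<And>u :: real^'k. (\<Sum>a\<in>UNIV. u $ a *\<^sub>R v a) = 0 \<Longrightarrow> u = 0"
  shows "surj (\<lambda>w. \<chi> a. v a \<bullet> w)"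
proof (rule ccontr)
  let ?f = "\<lambda>w. (\<chi> a. v a \<bullet> w) :: real^'k"
  assume ns: "\<not> surj ?f"
  have lin: "linear ?f" by (rule linearI) (simp_all add: vec_eq_iff inner_add_right)
  have sp: "span (range ?f) = range ?f"
    by (rule span_eq_iff[THEN iffD2, OF linear_subspace_image[OF lin subspace_UNIV]])
  then obtain u where u: "u \<noteq> 0" "\<forall>y\<in>span (range ?f). u \<bullet> y = 0"
    using span_not_UNIV_orthogonal[of "range ?f"] ns by metis
  have "(\<Sum>a\<in>UNIV. u $ a *\<^sub>R v a) \<bullet> w = 0" for w
  proof -
    have "u \<bullet> ?f w = 0" using u(2) sp by blast
    then show ?thesis by (simp add: inner_vec_def inner_sum_left)
  qed
  then have "(\<Sum>a\<in>UNIV. u $ a *\<^sub>R v a) = 0" by (metis inner_eq_zero_iff)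
  then show False using assms u(1) by blast
qed

section \<open>Tischler's theorem\<close>

text \<open>Regularity gives a local section through \<open>p\<close>: in adapted coordinates,
  moving from \<open>\<kappa> p\<close> along \<open>S\<close> changes the value of \<open>f\<close>
  by exactly the prescribed amount.\<close>

lemma openin_image_regular:
  fixes M :: "('a, real^'n) manifold" and N :: "('b, real^'k) manifold"
  assumes M: "smooth_atlas M" and N: "smooth_atlas N"
    and reg: "\<And>p. p \<in> mpoints M \<Longrightarrow> regular_at M N f p"
  shows "openin (mtop N) (f ` mpoints M)"
proof (subst openin_subopen, intro ballI)
  fix b assume "b \<in> f ` mpoints M"
  then obtain p where p: "p \<in> mpoints M" "b = f p" by blast
  have "smooth_at M N f p" using reg[OF p(1)] by (simp add: regular_at_def)
  then obtain d where d: "d \<in> charts_at N (f p)" "d \<in> atlas N" "f p \<in> fst d"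
    using charts_at_nonempty[OF N] smooth_at_mem by metis
  obtain U Y \<kappa> \<kappa>i L S where ac: "adapted_coords M f d U Y \<kappa> \<kappa>i L S" and pU: "p \<in> U"
    using straighten[OF M N reg[OF p(1)] d(1)] by blast
  note U = adapted_coordsD(1)[OF ac] and Y = adapted_coordsD(2)[OF ac]
    and \<kappa> = adapted_coordsD(3)[OF ac] and \<kappa>i = adapted_coordsD(4)[OF ac] and LS = adapted_coordsD(5-7)[OF ac]
  have linL: "linear L" and linS: "linear S" using LS bounded_linear.linear by blast+
  define m where "m v = \<kappa> p + S (v - snd d (f p))" for v
  let ?X = "m -` Y" and ?T = "{z \<in> fst d. snd d z \<in> m -` Y}"
  have "open ?X"
    unfolding m_def by (intro open_vimage[OF Y] continuous_intros linear_continuous_on_compose[OF _ linS])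
  then have "openin (mtop N) ?T" by (rule openin_chart_preimage[OF N d(2)])
  moreover have "b \<in> ?T"
    using d(3) p(2) \<kappa>[OF pU] linear_0[OF linS] by (simp add: m_def)
  moreover have "?T \<subseteq> f ` mpoints M"
  proof
    fix z assume z: "z \<in> ?T"
    define q where "q = \<kappa>i (m (snd d z))"
    have q: "q \<in> U" "\<kappa> q = m (snd d z)" using \<kappa>i[of "m (snd d z)"] z by (auto simp: q_def)
    have "snd d (f q) = L (m (snd d z))" "f q \<in> fst d" using \<kappa>[OF q(1)] q(2) by auto
    moreover have "L (m (snd d z)) = snd d z"
      using \<kappa>[OF pU] by (simp add: m_def linear_add[OF linL] LS(3))
    ultimately have "f q = z" using inj_on_chart[OF N d(2)] z by (auto dest: inj_onD)
    moreover have "q \<in> mpoints M" using q(1) U openin_subset by blast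
    ultimately show "z \<in> f ` mpoints M" by blast
  qed
  ultimately show "\<exists>T. openin (mtop N) T \<and> b \<in> T \<and> T \<subseteq> f ` mpoints M" by blast
qed

lemma fibers_over_torusI:
  fixes M :: "('a, real^'n) manifold" and f :: "'a \<Rightarrow> complex^'k"
  assumes M: "smooth_manifold M" and comp: "compact_space (mtop M)" and ne: "mpoints M \<noteq> {}"
    and reg: "\<And>p. p \<in> mpoints M \<Longrightarrow> regular_at M torus f p"
  shows "fibers_over M (torus :: (complex^'k, real^'k) manifold)"
proof -
  let ?T = "torus :: (complex^'k, real^'k) manifold"
  have A: "smooth_atlas M" and HM: "Hausdorff_space (mtop M)"
    using M smooth_manifold_atlas by (auto simp: smooth_manifold_def)
  have sub: "submersion M ?T f" by (rule submersionI[OF A smooth_atlas_torus reg])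
  then have sm: "smooth_map M ?T f" by (simp add: submersion_def)
  then have cont: "continuous_map (mtop M) (mtop ?T) f" by (simp add: smooth_map_on_def)
  have "openin (mtop ?T) (f ` mpoints M)" by (rule openin_image_regular[OF A smooth_atlas_torus reg])
  moreover have "closedin (mtop ?T) (f ` mpoints M)"
    using comp cont unfolding compact_space_def by (intro compactin_imp_closedin[OF Hausdorff_torus] image_compactin)
  ultimately have "f ` mpoints M = mpoints ?T"
    using connected_torus ne unfolding connected_space_clopen_in by blast
  then show ?thesis
    unfolding fibers_over_def
    using sm sub ehresmann_compact[OF A smooth_atlas_torus HM Hausdorff_torus comp reg] by blast
qed

lemma common_radius:
  fixes P :: "'j \<Rightarrow> real \<Rightarrow> bool"
  assumes "finite J" "\<And>j. j \<in> J \<Longrightarrow> \<exists>\<epsilon>>0. P j \<epsilon>" "\<And>j \<epsilon> \<epsilon>'. P j \<epsilon> \<Longrightarrow> \<epsilon>' \<le> \<epsilon> \<Longrightarrow> P j \<epsilon>'"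
  shows "\<exists>\<epsilon>>0. \<forall>j\<in>J. P j \<epsilon>"
proof -
  obtain e where e: "\<And>j. j \<in> J \<Longrightarrow> e j > 0 \<and> P j (e j)" using assms(2) by metis
  let ?e = "Min (insert 1 (e ` J))"
  have "?e > 0" using e assms(1) by simp
  moreover have "P j ?e" if "j \<in> J" for j
  proof -
    have "P j (e j)" using e[OF that] by blast
    moreover have "?e \<le> e j" using assms(1) that by simp
    ultimately show ?thesis by (rule assms(3))
  qed
  ultimately show ?thesis by blast
qed

theorem theorem2p2:
  fixes M :: "('a, real ^ 'n::finite) manifold"
    and \<beta> :: "'k::finite \<Rightarrow> ('a, real ^ 'n) form1"
  assumes "smooth_manifold M"
    and "compact_space (mtop M)"
    and "connected_space (mtop M)"
    and "mpoints M \<noteq> {}"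
    and "\<And>i. closed_form1 M (\<beta> i)"
    and "\<And>p. p \<in> mpoints M \<Longrightarrow> lin_indep_at M \<beta> p"
  shows "fibers_over M (torus :: (complex ^ 'k, real ^ 'k) manifold)"
proof -
  note comp = assms(2) and closed = assms(5) and indep = assms(6)
  have M: "smooth_atlas M" and H: "Hausdorff_space (mtop M)"
    using assms(1) smooth_manifold_atlas by (auto simp: smooth_manifold_def)
  have sf: "smooth_form1 M (\<beta> a)" for a using closed by (simp add: closed_form1_def)
  \<comment> \<open>Intersecting over the finitely many forms gives them common domains and charts,
    so one partition of unity serves all of them and their perturbations involve the same functions
    \<open>\<rho> j\<close>.\<close>
  have "\<exists>U c F. p \<in> U \<and> c \<in> atlas M \<and> U \<subseteq> fst c \<and> (\<forall>a. primitive_on M (\<beta> a) U (F a))"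
    if p: "p \<in> mpoints M" for p
  proof -
    obtain c where c: "c \<in> atlas M" "p \<in> fst c" using charts_at_nonempty[OF M p] by metis
    have "\<exists>U F. p \<in> U \<and> primitive_on M (\<beta> a) U F" for a
      using primitive_exists[OF M closed p] by metis
    then obtain U F where UF: "\<And>a. p \<in> U a \<and> primitive_on M (\<beta> a) (U a) (F a)" by metis
    let ?U = "fst c \<inter> (\<Inter>a. U a)"
    have "openin (mtop M) (\<Inter>a. U a)"
      using UF by (intro openin_INT2) (auto simp: primitive_on_def)
    then have "openin (mtop M) ?U" using chart_openin[OF M c(1)] by (rule openin_Int[rotated])
    then have "primitive_on M (\<beta> a) ?U (F a)" for a
      using UF primitive_on_subset[of M "\<beta> a" "U a" "F a" ?U] by blast
    then show ?thesis using c UF by (intro exI[of _ ?U] exI[of _ c] exI[of _ F]) auto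
  qed
  then obtain U c F where UcF: "\<And>p. p \<in> mpoints M \<Longrightarrow> p \<in> U p \<and> c p \<in> atlas M \<and> U p \<subseteq> fst (c p) \<and>
      (\<forall>a. primitive_on M (\<beta> a) (U p) (F p a))" by metis
  have "openin (mtop M) (U p) \<and> p \<in> U p" if "p \<in> mpoints M" for p
    using UcF[OF that] unfolding primitive_on_def by blast
  then obtain J K V \<rho> where pou: "partition_of_unity M J K V \<rho>" and KU: "\<And>j. j \<in> J \<Longrightarrow> K j \<subseteq> U j"
    using partition_of_unity_exists[OF M H comp, of U] by metis
  have J: "finite J" "J \<subseteq> mpoints M" and cov: "mpoints M = (\<Union>j\<in>J. V j)"
    and KV: "\<And>j. j \<in> J \<Longrightarrow> closedin (mtop M) (K j) \<and> openin (mtop M) (V j) \<and> V j \<subseteq> K j"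
    and \<rho>sm: "\<And>j q. j \<in> J \<Longrightarrow> q \<in> mpoints M \<Longrightarrow> smooth_at M euclid (\<rho> j) q"
    using pou unfolding partition_of_unity_def by blast+
  have prim: "primitive_on M (\<beta> a) (U j) (F j a)" and cM: "c j \<in> atlas M" and Uc: "U j \<subseteq> fst (c j)" if "j \<in> J" for a j
    using UcF[of j] J(2) that by blast+
  \<comment> \<open>On the compact coordinate images \<open>X i\<close> all bounds are uniform. The
    inner product turns covectors into vectors: \<open>N i a x\<close> represents
    \<open>\<beta> a\<close> in the chart \<open>c i\<close>, and \<open>R i j x\<close> is the
    gradient of \<open>\<rho> j\<close>.\<close>
  define X where "X i = snd (c i) ` K i" for i
  define N where "N i a x = (\<Sum>b\<in>Basis. form_in_chart M (\<beta> a) (c i) b x *\<^sub>R b)" for i a x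

  define r where "r i j = (\<lambda>x. \<rho> j (chart_inv (c i) x))" for i j
  define R where "R i j x = (\<Sum>b\<in>Basis. frechet_derivative (r i j) (at x) b *\<^sub>R b)" for i j x
  have rsm: "smooth_on (r i j) (chart_image (c i))" if "i \<in> J" "j \<in> J" for i j
  proof (rule smooth_on_smooth_at)
    fix x assume x: "x \<in> chart_image (c i)"
    have "chart_inv (c i) x \<in> mpoints M"
      using chart_inv_in[OF x] chart_subset[OF M cM[OF that(1)]] by blast
    then show "smooth_at euclid euclid (r i j) x"
      unfolding r_def
      using smooth_at_compose[OF smooth_atlas_euclid M smooth_atlas_euclid smooth_at_chart_inv[OF M cM[OF that(1)] x]]
        \<rho>sm[OF that(2)] by blast
  qed
  have KM: "K i \<subseteq> mpoints M" if "i \<in> J" for i using KV[OF that] closedin_subset by blast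
  have Kc: "K i \<subseteq> fst (c i)" if "i \<in> J" for i using KU Uc that by blast
  have XI: "X i \<subseteq> chart_image (c i)" if "i \<in> J" for i
    using Kc[OF that] by (auto simp: X_def chart_image_def)
  have N_inner: "N i a x \<bullet> w = form_in_chart M (\<beta> a) (c i) w x" if i: "i \<in> J" and x: "x \<in> chart_image (c i)" for i a x w
  proof -
    have "form_in_chart M (\<beta> a) (c i) w x = (\<Sum>b\<in>Basis. (w \<bullet> b) *\<^sub>R form_in_chart M (\<beta> a) (c i) b x)"
      by (rule linear_euclidean_expansion[OF linear_form_in_chart[OF M sf cM[OF i] x]])
    also have "\<dots> = N i a x \<bullet> w"
      unfolding N_def inner_sum_left by (rule sum.cong) (simp_all add: inner_commute mult.commute)
    finally show ?thesis by (rule sym)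
  qed
  have "\<exists>\<epsilon>>0. stably_independent (X i) J (N i) (R i) \<epsilon>" if i: "i \<in> J" for i
  proof -
    have "compactin (mtop M) (K i)" using KV[OF i] comp closedin_compact_space by blast
    moreover have "continuous_map (subtopology (mtop M) (fst (c i))) euclidean (snd (c i))"
      using chart_homeo[OF M cM[OF i]] continuous_map_in_subtopology homeomorphic_imp_continuous_map by blast
    ultimately have "compactin euclidean (X i)"
      unfolding X_def using Kc[OF i] by (intro image_compactin) (auto simp: compactin_subtopology)
    then have cX: "compact (X i)" by simp
    have cN: "continuous_on (X i) (N i a)" for a
    proof -
      have "continuous_on (chart_image (c i)) (form_in_chart M (\<beta> a) (c i) b)" for b
        using sf[of a] cM[OF i] smooth_on_continuous unfolding smooth_form1_def by blast
      then show ?thesis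
        unfolding N_def using XI[OF i] by (intro continuous_intros) (blast intro: continuous_on_subset)
    qed
    have cR: "continuous_on (X i) (R i j)" if "j \<in> J" for j
      unfolding R_def
      by (intro continuous_intros continuous_on_subset[OF _ XI[OF i]] smooth_on_continuous
          smooth_on_frechet_derivative rsm i that)
    have ind: "u = 0" if x: "x \<in> X i" and 0: "(\<Sum>a\<in>UNIV. u $ a *\<^sub>R N i a x) = 0" for x and u :: "real^'k"
    proof -
      obtain p where p: "p \<in> K i" "x = snd (c i) p" using x by (auto simp: X_def)
      have pM: "p \<in> mpoints M" using KM[OF i] p by blast
      have cp: "c i \<in> charts_at M p" using cM[OF i] Kc[OF i] p by (auto simp: charts_at_iff)
      have xI: "x \<in> chart_image (c i)" using XI[OF i] x by blast
      have "(\<Sum>a\<in>UNIV. u $ a * \<beta> a p v) = 0" if v: "v \<in> tangent_space M p" for v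
      proof -
        have "\<beta> a p v = N i a x \<bullet> v (c i)" for a
          using N_inner[OF i xI] form_in_chart_at[OF M cp] tangent_of_coords_eq[OF M pM cp v] p(2) by simp
        then have "(\<Sum>a\<in>UNIV. u $ a * \<beta> a p v) = (\<Sum>a\<in>UNIV. u $ a *\<^sub>R N i a x) \<bullet> v (c i)"
          by (simp add: inner_sum_left)
        then show ?thesis using 0 by simp
      qed
      then have "\<forall>a. u $ a = 0"
        using indep[OF pM] unfolding lin_indep_at_def by (elim allE[of _ "\<lambda>a. u $ a"]) blast
      then show ?thesis by (simp add: vec_eq_iff)
    qed
    show ?thesis by (rule independent_family_perturb[OF cX J(1) cN cR ind])
  qed
  \<comment> \<open>One radius for all the finitely many charts, available before any multiple
    \<open>D a\<close> is chosen.\<close>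
  then obtain \<epsilon> where \<epsilon>: "\<epsilon> > 0" and "\<forall>i\<in>J. stably_independent (X i) J (N i) (R i) \<epsilon>"
    using common_radius[OF J(1), of "\<lambda>i. stably_independent (X i) J (N i) (R i)"] stably_independent_mono by metis
  then have ind: "\<And>i x k (u :: real^'k). i \<in> J \<Longrightarrow> x \<in> X i \<Longrightarrow> (\<forall>a. \<forall>j\<in>J. \<bar>k a j\<bar> \<le> \<epsilon>) \<Longrightarrow>
      (\<Sum>a\<in>UNIV. u $ a *\<^sub>R (N i a x + (\<Sum>j\<in>J. k a j *\<^sub>R R i j x))) = 0 \<Longrightarrow> u = 0"
    unfolding stably_independent_def by blast
  have "\<exists>D G. circle_potential M J V \<rho> (\<lambda>i. F i a) \<epsilon> D G" for a
    using integral_periods[where F="\<lambda>i. F i a" and \<beta>="\<beta> a", OF M comp pou prim KU \<epsilon>] by blast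
  then obtain D G where pot: "\<And>a. circle_potential M J V \<rho> (\<lambda>i. F i a) \<epsilon> (D a) (G a)" by metis
  have D: "D a \<ge> 1" and Gcis: "i \<in> J \<Longrightarrow> l \<in> J \<Longrightarrow> p \<in> V i \<Longrightarrow> p \<in> V l \<Longrightarrow> cis (G a i p) = cis (G a l p)"
    and Gloc: "i \<in> J \<Longrightarrow> p \<in> V i \<Longrightarrow> \<exists>k W. (\<forall>j\<in>J. \<bar>k j\<bar> \<le> \<epsilon>) \<and> openin (mtop M) W \<and> p \<in> W \<and>
      (\<forall>q\<in>W. G a i q = 2 * pi * (D a * F i a q + (\<Sum>j\<in>J. k j * \<rho> j q)))" for a i l p
    using pot[of a] unfolding circle_potential_def by blast+
  \<comment> \<open>The choice among the sets \<open>V i\<close> containing the point is arbitrary;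
    agreement of the lifts under \<open>cis\<close> makes it immaterial, as \<open>f_eq\<close>
    records.\<close>
  define idx where "idx p = (SOME i. i \<in> J \<and> p \<in> V i)" for p
  have idx: "idx p \<in> J \<and> p \<in> V (idx p)" if "p \<in> mpoints M" for p
    unfolding idx_def by (rule someI_ex) (use that cov in blast)
  define f where "f p = torus_exp (\<chi> a. G a (idx p) p)" for p
  have f_eq: "f p = torus_exp (\<chi> a. G a i p)" if "i \<in> J" "p \<in> V i" for i p
  proof -
    have "p \<in> mpoints M" using cov that by blast
    then have "cis (G a (idx p) p) = cis (G a i p)" for a using Gcis idx that by blast
    then show ?thesis by (simp add: f_def torus_exp_def)
  qed
  have reg: "regular_at M torus f p" if pM: "p \<in> mpoints M" for p
  proof -
    obtain i where i: "i \<in> J" "p \<in> V i" using cov pM by blast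
    have pK: "p \<in> K i" using KV i by blast
    have pU: "p \<in> U i" using KU i pK by blast
    have cp: "c i \<in> charts_at M p" using cM[OF i(1)] Kc[OF i(1)] pK by (auto simp: charts_at_iff)
    let ?x = "snd (c i) p"
    have xX: "?x \<in> X i" using pK by (simp add: X_def)
    have xI: "?x \<in> chart_image (c i)" using XI[OF i(1)] xX by blast
    define near where "near a k W \<longleftrightarrow> (\<forall>j\<in>J. \<bar>k j\<bar> \<le> \<epsilon>) \<and> openin (mtop M) W \<and> p \<in> W \<and>
      (\<forall>q\<in>W. G a i q = 2 * pi * (D a * F i a q + (\<Sum>j\<in>J. k j * \<rho> j q)))" for a k W
    have "\<exists>k W. near a k W" for a unfolding near_def by (rule Gloc[OF i])
    then obtain k W where near: "\<And>a. near a (k a) (W a)" by metis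
    have k: "\<And>a. \<forall>j\<in>J. \<bar>k a j\<bar> \<le> \<epsilon>" and W: "\<And>a. openin (mtop M) (W a)" "\<And>a. p \<in> W a"
      and G_eq: "\<And>a q. q \<in> W a \<Longrightarrow> G a i q = 2 * pi * (D a * F i a q + (\<Sum>j\<in>J. k a j * \<rho> j q))"
      using near unfolding near_def by blast+
    \<comment> \<open>The lift near \<open>p\<close> with frozen rounding errors: it agrees with
      \<open>G a i\<close> on \<open>W a\<close> and is visibly differentiable.\<close>
    define g where "g q = (\<chi> a. 2 * pi * (D a * F i a q + (\<Sum>j\<in>J. k a j * \<rho> j q)))" for q
    let ?W = "V i \<inter> (\<Inter>a. W a)"
    have oW: "openin (mtop M) ?W"
      using KV[OF i(1)] W(1) by (intro openin_Int openin_INT2) auto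
    have fg: "f q = torus_exp (g q)" if "q \<in> ?W" for q
      using f_eq[OF i(1), of q] G_eq that by (simp add: g_def)
    have Fp: "smooth_at M euclid (F i a) p"
      "((\<lambda>x. F i a (chart_inv (c i) x)) has_derivative (\<lambda>w. \<beta> a p (tangent_of_coords M (c i) p w))) (at ?x)" for a
      using prim[OF i(1), of a] pU cp unfolding primitive_on_def by blast+
    have gsm: "smooth_at M euclid g p"
    proof -
      have 1: "smooth_at M euclid (\<lambda>q. 2 * pi * (D a * F i a q + (\<Sum>j\<in>J. k a j * \<rho> j q))) p" for a
        using Fp(1) \<rho>sm pM
        by (intro smooth_at_mult[OF M] smooth_at_add[OF M] smooth_at_sum[OF M] smooth_at_const[OF M smooth_atlas_euclid]) auto
      have "g = (\<lambda>q. \<Sum>a\<in>UNIV. (2 * pi * (D a * F i a q + (\<Sum>j\<in>J. k a j * \<rho> j q))) *\<^sub>R axis a 1)"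
        by (rule ext) (simp add: g_def vec_eq_iff axis_def if_distrib cong: if_cong)
      then show ?thesis
        using 1 pM
        by (simp only:) (intro smooth_at_sum[OF M] smooth_at_scaleR[OF M] smooth_at_const[OF M smooth_atlas_euclid], auto)
    qed
    \<comment> \<open>The gradient of component \<open>a\<close> of \<open>g\<close>, divided by
      \<open>2 * pi * D a\<close>: the coefficient vector of the form plus a perturbation with
      coefficients \<open>k a j / D a\<close>.\<close>
    define v where "v a = N i a ?x + (\<Sum>j\<in>J. (k a j / D a) *\<^sub>R R i j ?x)" for a
    have rder: "(r i j has_derivative (\<lambda>w. R i j ?x \<bullet> w)) (at ?x)" if "j \<in> J" for j
    proof -
      have der: "(r i j has_derivative frechet_derivative (r i j) (at ?x)) (at ?x)"
        by (rule smooth_on_has_derivative[OF rsm[OF i(1) that] xI])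
      have "frechet_derivative (r i j) (at ?x) w = R i j ?x \<bullet> w" for w
      proof -
        have "frechet_derivative (r i j) (at ?x) w = (\<Sum>b\<in>Basis. (w \<bullet> b) *\<^sub>R frechet_derivative (r i j) (at ?x) b)"
          by (rule linear_euclidean_expansion[OF has_derivative_linear[OF der]])
        also have "\<dots> = R i j ?x \<bullet> w"
          unfolding R_def inner_sum_left by (rule sum.cong) (simp_all add: inner_commute mult.commute)
        finally show ?thesis .
      qed
      then have "frechet_derivative (r i j) (at ?x) = (\<lambda>w. R i j ?x \<bullet> w)" by blast
      then show ?thesis using der by simp
    qed
    have Fder: "((\<lambda>x. F i a (chart_inv (c i) x)) has_derivative (\<lambda>w. N i a ?x \<bullet> w)) (at ?x)" for a
    proof -
      have "\<beta> a p (tangent_of_coords M (c i) p w) = N i a ?x \<bullet> w" for w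
        using N_inner[OF i(1) xI] form_in_chart_at[OF M cp] by simp
      then show ?thesis using Fp(2)[of a] by simp
    qed
    have comp_der: "((\<lambda>x. g (chart_inv (c i) x) $ a) has_derivative (\<lambda>w. (2 * pi * D a) * (v a \<bullet> w))) (at ?x)" for a
    proof -
      have "((\<lambda>x. 2 * pi * (D a * F i a (chart_inv (c i) x) + (\<Sum>j\<in>J. k a j * r i j x))) has_derivative
          (\<lambda>w. 2 * pi * (D a * (N i a ?x \<bullet> w) + (\<Sum>j\<in>J. k a j * (R i j ?x \<bullet> w))))) (at ?x)"
        by (intro has_derivative_mult_right has_derivative_add has_derivative_sum Fder rder)
      moreover have "D a * (N i a ?x \<bullet> w) + (\<Sum>j\<in>J. k a j * (R i j ?x \<bullet> w)) = D a * (v a \<bullet> w)" for w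
        using D[of a] by (simp add: v_def inner_add_left inner_sum_left distrib_left sum_distrib_left)
      ultimately show ?thesis by (simp add: g_def r_def mult.assoc)
    qed
    have der: "((\<lambda>x. g (chart_inv (c i) x)) has_derivative (\<lambda>w. \<chi> a. (2 * pi * D a) * (v a \<bullet> w))) (at ?x)"
      unfolding has_derivative_componentwise_within[of "\<lambda>x. g (chart_inv (c i) x)"]
      using comp_der by (auto simp: Basis_vec_def inner_axis)
    have "surj (\<lambda>w. \<chi> a. ((2 * pi * D a) *\<^sub>R v a) \<bullet> w)"
    proof (rule surj_inner_family)
      fix u :: "real^'k" assume 0: "(\<Sum>a\<in>UNIV. u $ a *\<^sub>R ((2 * pi * D a) *\<^sub>R v a)) = 0"
      \<comment> \<open>The factors \<open>2 * pi * D a\<close> move into the coefficients of the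
        relation, which then concerns the \<open>v a\<close>. From \<open>D a \<ge> 1\<close> the
        quotients \<open>k a j / D a\<close> stay within \<open>\<epsilon>\<close>, so stable
        independence applies.\<close>
      have "(\<chi> a. u $ a * (2 * pi * D a)) = (0 :: real^'k)"
      proof (rule ind[OF i(1) xX])
        have "\<bar>k a j / D a\<bar> \<le> \<epsilon>" if "j \<in> J" for a j
        proof -
          have "\<bar>k a j / D a\<bar> \<le> \<bar>k a j\<bar>" using D[of a] by (simp add: abs_divide divide_le_eq mult_left_le mult_le_cancel_left1)
          then show ?thesis using k[of a] that by fastforce
        qed
        then show "\<forall>a. \<forall>j\<in>J. \<bar>k a j / D a\<bar> \<le> \<epsilon>" by blast
        show "(\<Sum>a\<in>UNIV. (\<chi> a. u $ a * (2 * pi * D a)) $ a *\<^sub>R (N i a ?x + (\<Sum>j\<in>J. (k a j / D a) *\<^sub>R R i j ?x))) = 0"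
          using 0 by (simp add: v_def)
      qed
      then have "u $ a * (2 * pi * D a) = 0" for a by (simp add: vec_eq_iff)
      moreover have "D a \<noteq> 0" for a using D[of a] by linarith
      ultimately show "u = 0" by (simp add: vec_eq_iff)
    qed
    then have "surj (\<lambda>w. \<chi> a. (2 * pi * D a) * (v a \<bullet> w))" by simp
    then show ?thesis
      using regular_at_torus[OF M oW _ fg gsm cp der] i(2) W(2) by blast
  qed
  show ?thesis by (rule fibers_over_torusI[OF assms(1) comp assms(4) reg])
qed

end
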